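(* Let $\phi$ be a translation-invariant, tempered, repulsive potential on $\mathbb{R}^d$ with potential-weighted connective constant $\Delta_\phi$. Then the infinite volume pressure $p(\lambda)=\lim_{n\to\infty}\frac1n\log Z_{\Lambda_n}(\lambda)$ is analytic for activities $0\le\lambda<e/\Delta_\phi$.
   Context: Here $\mathbb{R}^d$ carries Lebesgue measure $\mu$ and the Euclidean metric $d(\cdot,\cdot)$, and $\Lambda_n$ is the (axis-parallel, origin-centred) box (cube) of volume $n$ in $\mathbb{R}^d$. A potential is a measurable symmetric function $\phi:\mathbb{R}^d\times\mathbb{R}^d\to(-\infty,\infty]$; it is repulsive if $\phi\ge0$, tempered if $C_\phi:=\sup_{v}\int_{\mathbb{R}^d}|1-e^{-\phi(x,v)}|\,dx<\infty$, and translation-invariant if $\phi(x+a,y+a)=\phi(x,y)$ for all $x,y,a$. Conventions: $e^{-\infty}=0$, $0\cdot(+\infty)=0$, empty sums are $0$, $e/0=+\infty$. Partition function: $Z_\Lambda(\lambda)=1+\sum_{k\ge1}\frac{\lambda^k}{k!}\int_{\Lambda^k}e^{-H(x_1,\dots,x_k)}\,dx_1\cdots dx_k$ with $H(x_1,\dots,x_k)=\sum_{1\le i<j\le k}\phi(x_i,x_j)$. Analytic on $[0,e/\Delta_\phi)$ means that $p$ agrees on this interval with a function holomorphic in an open complex neighbourhood of it. Potential-weighted connective constant: for $k\ge1$ let $$V_k:=\sup_{v_0}\int_{(\mathbb{R}^d)^k}\prod_{j=1}^k\left(\exp\Big(-\sum_{i=0}^{j-2}\mathbf{1}_{d(v_j,v_i)<d(v_i,v_{i+1})}\,\phi(v_j,v_i)\Big)\cdot\big(1-e^{-\phi(v_j,v_{j-1})}\big)\right)dv_1\cdots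 dv_k,$$ and $\Delta_\phi:=\lim_{k\to\infty}V_k^{1/k}=\inf_{k\ge1}V_k^{1/k}$. *)

theory Defs
  imports "HOL-Complex_Analysis.Complex_Analysis"
begin

text \<open>Euclidean space of arbitrary dimension \<open>d = DIM('a)\<close> is an arbitrary type
  \<open>'a :: euclidean_space\<close>; ``measurable'' means Borel measurable.
  The letter \<open>z\<close> stands for the activity $\lambda$.\<close>

definition potential :: "('a::euclidean_space \<Rightarrow> 'a \<Rightarrow> ereal) \<Rightarrow> bool" where
  "potential \<phi> \<longleftrightarrow>
     (\<lambda>(x, y). \<phi> x y) \<in> borel_measurable borel \<and>
     (\<forall>x y. \<phi> x y = \<phi> y x) \<and>
     (\<forall>x y. \<phi> x y \<noteq> -\<infinity>)"

definition repulsive :: "('a::euclidean_space \<Rightarrow> 'a \<Rightarrow> ereal) \<Rightarrow> bool" where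
  "repulsive \<phi> \<longleftrightarrow> (\<forall>x y. 0 \<le> \<phi> x y)"

definition translation_invariant :: "('a::euclidean_space \<Rightarrow> 'a \<Rightarrow> ereal) \<Rightarrow> bool" where
  "translation_invariant \<phi> \<longleftrightarrow> (\<forall>x y a. \<phi> (x + a) (y + a) = \<phi> x y)"

text \<open>\<open>exp_neg t\<close> is $e^{-t}$ for \<open>t \<in> (-\<infinity>, \<infinity>]\<close>, with $e^{-\infty} = 0$; the value at \<open>-\<infinity>\<close>
  is irrelevant.\<close>

definition exp_neg :: "ereal \<Rightarrow> real" where
  "exp_neg t = (if t = \<infinity> then 0 else exp (- real_of_ereal t))"

definition temperedness_const :: "('a::euclidean_space \<Rightarrow> 'a \<Rightarrow> ereal) \<Rightarrow> ennreal" where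
  "temperedness_const \<phi> = (SUP v. \<integral>\<^sup>+ x. ennreal \<bar>1 - exp_neg (\<phi> x v)\<bar> \<partial>lborel)"

definition tempered :: "('a::euclidean_space \<Rightarrow> 'a \<Rightarrow> ereal) \<Rightarrow> bool" where
  "tempered \<phi> \<longleftrightarrow> temperedness_const \<phi> < \<infinity>"

text \<open>A configuration $(x_1, \dots, x_k)$ is a function on \<open>{1..k}\<close>.\<close>

definition energy :: "('a::euclidean_space \<Rightarrow> 'a \<Rightarrow> ereal) \<Rightarrow> nat \<Rightarrow> (nat \<Rightarrow> 'a) \<Rightarrow> ereal" where
  "energy \<phi> k x = (\<Sum>j\<in>{1..k}. \<Sum>i\<in>{1..<j}. \<phi> (x i) (x j))"

definition partition_function ::
    "('a::euclidean_space \<Rightarrow> 'a \<Rightarrow> ereal) \<Rightarrow> 'a set \<Rightarrow> real \<Rightarrow> real" where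
  "partition_function \<phi> \<Lambda> z =
     1 + (\<Sum>m. z ^ Suc m / fact (Suc m) *
           set_lebesgue_integral (Pi\<^sub>M {1..Suc m} (\<lambda>_. lborel)) (Pi\<^sub>E {1..Suc m} (\<lambda>_. \<Lambda>))
             (\<lambda>x. exp_neg (energy \<phi> (Suc m) x)))"

text \<open>The cube with side length $n^{1/d}$.\<close>

definition centred_cube :: "nat \<Rightarrow> 'a::euclidean_space set" where
  "centred_cube n =
     (let s = root DIM('a) (real n) in cbox (- (s / 2) *\<^sub>R One) ((s / 2) *\<^sub>R One))"

definition finite_volume_pressure ::
    "('a::euclidean_space \<Rightarrow> 'a \<Rightarrow> ereal) \<Rightarrow> real \<Rightarrow> nat \<Rightarrow> real" where
  "finite_volume_pressure \<phi> z n = ln (partition_function \<phi> (centred_cube n) z) / real n"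

definition pressure :: "('a::euclidean_space \<Rightarrow> 'a \<Rightarrow> ereal) \<Rightarrow> real \<Rightarrow> real" where
  "pressure \<phi> z = lim (finite_volume_pressure \<phi> z)"

text \<open>The integrand defining $V_k$. For \<open>j \<ge> 1\<close> the range \<open>i < j - 1\<close> is
  $0 \le i \le j - 2$, which is empty for \<open>j = 1\<close>.\<close>

definition walk_weight :: "('a::euclidean_space \<Rightarrow> 'a \<Rightarrow> ereal) \<Rightarrow> nat \<Rightarrow> (nat \<Rightarrow> 'a) \<Rightarrow> real" where
  "walk_weight \<phi> k v =
     (\<Prod>j\<in>{1..k}.
        exp_neg (\<Sum>i<j - 1. if dist (v j) (v i) < dist (v i) (v (i + 1)) then \<phi> (v j) (v i) else 0)
        * (1 - exp_neg (\<phi> (v j) (v (j - 1)))))"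

text \<open>$V_k$; only used for repulsive potentials, for which \<open>walk_weight\<close> is nonnegative, so
  that its embedding into \<^typ>\<open>ennreal\<close> loses nothing.\<close>

definition walk_volume :: "('a::euclidean_space \<Rightarrow> 'a \<Rightarrow> ereal) \<Rightarrow> nat \<Rightarrow> ennreal" where
  "walk_volume \<phi> k =
     (SUP v\<^sub>0. \<integral>\<^sup>+ v. ennreal (walk_weight \<phi> k (v(0 := v\<^sub>0))) \<partial>(Pi\<^sub>M {1..k} (\<lambda>_. lborel)))"

text \<open>For a repulsive tempered potential $V_k \le C_\phi^k < \infty$, so \<^const>\<open>enn2real\<close> loses
  nothing.\<close>

definition connective_constant :: "('a::euclidean_space \<Rightarrow> 'a \<Rightarrow> ereal) \<Rightarrow> real" where
  "connective_constant \<phi> = lim (\<lambda>k. root k (enn2real (walk_volume \<phi> k)))"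

text \<open>The interval $[0, e/\Delta_\phi)$; division on \<^typ>\<open>ereal\<close> satisfies $e/0 = \infty$.\<close>

definition activity_interval :: "('a::euclidean_space \<Rightarrow> 'a \<Rightarrow> ereal) \<Rightarrow> real set" where
  "activity_interval \<phi> =
     {z. 0 \<le> z \<and> ereal z < ereal (exp 1) / ereal (connective_constant \<phi>)}"

end

theory Submission
  imports Defs
begin

text \<open>Write \<open>b x y\<close> for $e^{-\phi(x,y)}$ and let $Z(z, m)$ be the partition function with complex
  activity $z\,m(x)$, where the profile $m$ takes values in $[0,1]$ and has bounded support.
  Switching on the interaction with a new point $v$ in order of increasing distance from $v$
  yields the recursion
  $Z(z, m\,b(\cdot,v)) / Z(z,m) = e^{-u_v}$ with
  $u_v = z \int m(x)\,(1 - b(x,v))\,e^{-u_x}\,dx$, where the inner $u_x$ belongs to the profile in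
  which the points nearer to $v$ than $x$ already feel $v$. Iterating it produces the walks that
  define $V_k$.

  Differentiating in $z$ and applying the Cauchy--Schwarz inequality with the weight
  $1 / \sqrt{u}$, the maximum $1/e$ of $u e^{-u}$ turns $k$ steps of the recursion into a
  contraction by about $(z/e)^k V_k$, which is less than one for large $k$ if $z \Delta_\phi < e$.
  Hence $\partial_z u$ is bounded uniformly in the volume, and a continuity argument gives a complex
  neighbourhood of $z$ in which no finite-volume partition function vanishes. There the functions
  $Z_n^{1/n}$ are holomorphic and uniformly bounded, Montel's theorem provides a subsequential limit
  $G$, and the pressure is the logarithm of $|G|$ on the real axis. Convergence at real activities
  is Fekete's argument for $\log Z$ on cubes.\<close>

section \<open>Finite-volume integrals\<close>

text \<open>Cauchy--Schwarz has to be arranged so that it keeps the decay of the ratios. With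
  \<open>E\<close> = |du|^2 / U, the square of the integral over neighbours is at most U times an
  integral of |ratio| |du|^2. Writing |du|^2 as E U then puts |ratio| next to U at the same point.
  Of the two factors |z| produced by squaring, one turns |ratio| U into x exp(-x) \<le> 1/e and the
  other survives: this is z/e per step, where the estimate |ratio| \<le> 1 would leave z.

  Two circularities shape the rest. The inequality x exp(-x) \<le> 1/e concerns real x, so
  \<open>u\<close> at a complex activity must stay close to its value at a real one; but closeness
  is to follow from the very derivative bound that relies on it. Moreover, \<open>u\<close>
  represents the ratios only where no partition function vanishes. Both are handled by treating all
  profiles on a region at once, a class closed under tilting and partial exposure, and by carrying a
  lower bound for |Z| along: bounded ratios give back a lower bound that depends on the region but
  does not deteriorate from step to step.\<close>

lemma lborel_product_sigma_finite: "product_sigma_finite (\<lambda>_. lborel)"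
  by standard

text \<open>From here on the potential enters only through its Boltzmann factor; infinite energies
  become zeros of \<open>b\<close>.\<close>

locale boltzmann_factor =
  fixes b :: "'a::euclidean_space \<Rightarrow> 'a \<Rightarrow> real"
  assumes b_measurable_pair: "(\<lambda>p. b (fst p) (snd p)) \<in> borel_measurable (borel \<Otimes>\<^sub>M borel)"
    and b_sym: "b x y = b y x"
    and b_nonneg [simp]: "0 \<le> b x y"
    and b_le_1 [simp]: "b x y \<le> 1"
begin

lemma b_measurable [measurable (raw)]:
  assumes "f \<in> borel_measurable N" "g \<in> borel_measurable N"
  shows "(\<lambda>x. b (f x) (g x)) \<in> borel_measurable N"
  using measurable_compose[OF measurable_Pair[OF assms] b_measurable_pair] by simp

definition act :: "('a \<Rightarrow> real) \<Rightarrow> bool" where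
  "act m \<longleftrightarrow> integrable lborel m \<and> (\<forall>x. 0 \<le> m x)"

definition mass :: "('a \<Rightarrow> real) \<Rightarrow> real" where
  "mass m = (\<integral>x. m x \<partial>lborel)"

text \<open>The activity felt by the gas when a particle is held fixed at \<open>y\<close>.\<close>

definition tilt :: "'a \<Rightarrow> ('a \<Rightarrow> real) \<Rightarrow> 'a \<Rightarrow> real" where
  "tilt y m = (\<lambda>x. m x * b x y)"

definition bprod :: "nat \<Rightarrow> (nat \<Rightarrow> 'a) \<Rightarrow> real" where
  "bprod k x = (\<Prod>j\<in>{1..k}. \<Prod>i\<in>{1..<j}. b (x i) (x j))"

definition W :: "nat \<Rightarrow> ('a \<Rightarrow> real) \<Rightarrow> real" where
  "W k m = (\<integral>x. (\<Prod>i\<in>{1..k}. m (x i)) * bprod k x \<partial>Pi\<^sub>M {1..k} (\<lambda>_. lborel))"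

lemma actI: "integrable lborel m \<Longrightarrow> (\<And>x. 0 \<le> m x) \<Longrightarrow> act m"
  by (simp add: act_def)

lemma act_integrable [simp]: "act m \<Longrightarrow> integrable lborel m"
  and act_nonneg [simp]: "act m \<Longrightarrow> 0 \<le> m x"
  by (simp_all add: act_def)

lemma act_measurable: "act m \<Longrightarrow> m \<in> borel_measurable borel"
  unfolding act_def using borel_measurable_integrable by fastforce

lemma act_bounded:
  assumes "act m" and [measurable]: "m' \<in> borel_measurable borel"
    and "\<And>x. 0 \<le> m' x" "\<And>x. m' x \<le> m x"
  shows "act m'"
proof -
  have "integrable lborel m'"
  proof (rule Bochner_Integration.integrable_bound[OF act_integrable[OF assms(1)]])
    have "norm (m' x) \<le> norm (m x)" for x
      using assms(3)[of x] assms(4)[of x] by simp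
    then show "AE x in lborel. norm (m' x) \<le> norm (m x)" by simp
  qed simp
  then show ?thesis using assms(3) by (rule actI)
qed

lemma act_mult:
  assumes "act m" and [measurable]: "h \<in> borel_measurable borel"
    and h: "\<And>x. 0 \<le> h x" "\<And>x. h x \<le> 1"
  shows "act (\<lambda>x. m x * h x)"
proof (rule act_bounded[OF assms(1)])
  note [measurable] = act_measurable[OF assms(1)]
  show "(\<lambda>x. m x * h x) \<in> borel_measurable borel" by measurable
  show "0 \<le> m x * h x" "m x * h x \<le> m x" for x
    using assms(1) h[of x] by (simp_all add: mult_left_le)
qed

lemma act_tilt [simp]: "act m \<Longrightarrow> act (tilt y m)"
  unfolding tilt_def by (rule act_mult) auto

lemma tilt_commute: "tilt x (tilt y m) = tilt y (tilt x m)"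
  by (auto simp: tilt_def)

lemma tilt_le: "act m \<Longrightarrow> tilt y m x \<le> m x"
  by (simp add: tilt_def mult_left_le)

lemma mass_nonneg [simp]: "act m \<Longrightarrow> 0 \<le> mass m"
  by (simp add: mass_def)

lemma mass_mono: "act m \<Longrightarrow> act m' \<Longrightarrow> (\<And>x. m' x \<le> m x) \<Longrightarrow> mass m' \<le> mass m"
  unfolding mass_def by (rule integral_mono) simp_all

lemma mass_tilt_le: "act m \<Longrightarrow> mass (tilt y m) \<le> mass m"
  by (rule mass_mono) (simp_all add: tilt_le)

lemma bprod_measurable [measurable]: "bprod k \<in> borel_measurable (Pi\<^sub>M {1..k} (\<lambda>_. lborel))"
  unfolding bprod_def by measurable

lemma bprod_nonneg [simp]: "0 \<le> bprod k x"
  unfolding bprod_def by (simp add: prod_nonneg)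

lemma bprod_le_1 [simp]: "bprod k x \<le> 1"
  unfolding bprod_def by (simp add: prod_le_1 prod_nonneg)

lemma W_0 [simp]: "W 0 m = 1"
  by (simp add: W_def bprod_def PiM_empty)

lemma W_integrable:
  assumes "act m"
  shows "integrable (Pi\<^sub>M {1..k} (\<lambda>_. lborel)) (\<lambda>x. (\<Prod>i\<in>{1..k}. m (x i)) * bprod k x)"
proof -
  interpret product_sigma_finite "\<lambda>_::nat. lborel :: 'a measure" by (rule lborel_product_sigma_finite)
  note [measurable] = act_measurable[OF assms]
  have "integrable (Pi\<^sub>M {1..k} (\<lambda>_. lborel)) (\<lambda>x. \<Prod>i\<in>{1..k}. m (x i))"
    by (rule product_integrable_prod) (use assms in auto)
  moreover have "(\<lambda>x. (\<Prod>i\<in>{1..k}. m (x i)) * bprod k x) \<in> borel_measurable (Pi\<^sub>M {1..k} (\<lambda>_. lborel))"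
    by measurable
  ultimately show ?thesis
    by (rule Bochner_Integration.integrable_bound)
       (auto simp: abs_mult intro!: mult_left_le)
qed

lemma W_nonneg [simp]: "act m \<Longrightarrow> 0 \<le> W k m"
  unfolding W_def by (simp add: prod_nonneg)

lemma W_eq_nn_integral:
  assumes "act m"
  shows "ennreal (W k m) =
    (\<integral>\<^sup>+x. ennreal ((\<Prod>i\<in>{1..k}. m (x i)) * bprod k x) \<partial>Pi\<^sub>M {1..k} (\<lambda>_. lborel))"
  unfolding W_def
  by (rule nn_integral_eq_integral[symmetric])
     (use assms W_integrable in \<open>auto simp: prod_nonneg\<close>)

text \<open>The profile depends on a parameter because tilted profiles are later integrated over the
  tilting point.\<close>

lemma W_measurable [measurable (raw)]:
  assumes [measurable]: "case_prod f \<in> borel_measurable (N \<Otimes>\<^sub>M borel)"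
  shows "(\<lambda>p. W k (f p)) \<in> borel_measurable N"
proof -
  interpret product_sigma_finite "\<lambda>_::nat. lborel :: 'a measure" by (rule lborel_product_sigma_finite)
  interpret sigma_finite_measure "Pi\<^sub>M {1..k} (\<lambda>_. lborel :: 'a measure)"
    by (rule sigma_finite) simp
  have [measurable]: "(\<lambda>q. f (fst q) (snd q i)) \<in> borel_measurable (N \<Otimes>\<^sub>M Pi\<^sub>M {1..k} (\<lambda>_. lborel))"
    if "i \<in> {1..k}" for i
  proof -
    have "(\<lambda>q. (fst q, snd q i)) \<in> N \<Otimes>\<^sub>M Pi\<^sub>M {1..k} (\<lambda>_. lborel) \<rightarrow>\<^sub>M N \<Otimes>\<^sub>M borel"
      using that by measurable
    from measurable_compose[OF this assms] show ?thesis by (simp add: split_beta')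
  qed
  show ?thesis unfolding W_def by measurable
qed

text \<open>The last point is integrated out, and its Boltzmann factors with the other points tilt
  their activity. Most later estimates of \<open>W\<close> are inductions along this recursion. It
  is proved for nonnegative integrals first, so that integrability in \<open>W_Suc\<close> follows
  from finiteness.\<close>

lemma nn_W_Suc:
  assumes m: "act m"
  shows "ennreal (W (Suc k) m) = (\<integral>\<^sup>+y. ennreal (m y * W k (tilt y m)) \<partial>lborel)"
proof -
  interpret product_sigma_finite "\<lambda>_::nat. lborel :: 'a measure" by (rule lborel_product_sigma_finite)
  note [measurable] = act_measurable[OF m]
  let ?f = "\<lambda>x. ennreal ((\<Prod>i\<in>{1..Suc k}. m (x i)) * bprod (Suc k) x)"
  have ins: "{1..Suc k} = insert (Suc k) {1..k}" by auto
  have meas: "?f \<in> borel_measurable (Pi\<^sub>M (insert (Suc k) {1..k}) (\<lambda>_. lborel))"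
    unfolding ins[symmetric] by measurable
  have "ennreal (W (Suc k) m) = integral\<^sup>N (Pi\<^sub>M (insert (Suc k) {1..k}) (\<lambda>_. lborel)) ?f"
    unfolding W_eq_nn_integral[OF m] ins[symmetric] ..
  also have "\<dots> = (\<integral>\<^sup>+y. (\<integral>\<^sup>+x. ?f (x(Suc k := y)) \<partial>Pi\<^sub>M {1..k} (\<lambda>_. lborel)) \<partial>lborel)"
    by (rule product_nn_integral_insert_rev) (use meas in auto)
  also have "\<dots> = (\<integral>\<^sup>+y. ennreal (m y * W k (tilt y m)) \<partial>lborel)"
  proof (rule nn_integral_cong)
    fix y
    have "?f (x(Suc k := y)) = ennreal (m y) * ennreal ((\<Prod>i\<in>{1..k}. tilt y m (x i)) * bprod k x)" for x
    proof -
      have "bprod (Suc k) (x(Suc k := y)) = (\<Prod>i\<in>{1..k}. b (x i) y) * bprod k x"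
        unfolding bprod_def ins
        by (subst prod.insert)
           (auto simp: atLeastLessThanSuc_atLeastAtMost intro!: prod.cong arg_cong2[where f="(*)"])
      moreover have "(\<Prod>i\<in>{1..Suc k}. m ((x(Suc k := y)) i)) = m y * (\<Prod>i\<in>{1..k}. m (x i))"
        unfolding ins by (subst prod.insert) (auto intro!: prod.cong arg_cong2[where f="(*)"])
      ultimately show ?thesis
        using m by (simp add: tilt_def prod.distrib ennreal_mult'[symmetric] mult_ac)
    qed
    moreover have "(\<lambda>x. ennreal ((\<Prod>i\<in>{1..k}. tilt y m (x i)) * bprod k x))
        \<in> borel_measurable (Pi\<^sub>M {1..k} (\<lambda>_. lborel))"
      unfolding tilt_def by measurable
    ultimately have "(\<integral>\<^sup>+x. ?f (x(Suc k := y)) \<partial>Pi\<^sub>M {1..k} (\<lambda>_. lborel)) =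
       ennreal (m y) * (\<integral>\<^sup>+x. ennreal ((\<Prod>i\<in>{1..k}. tilt y m (x i)) * bprod k x) \<partial>Pi\<^sub>M {1..k} (\<lambda>_. lborel))"
      by (simp only: nn_integral_cmult)
    also have "\<dots> = ennreal (m y * W k (tilt y m))"
      using m W_eq_nn_integral[OF act_tilt[OF m], of k y] by (simp add: ennreal_mult')
    finally show "(\<integral>\<^sup>+x. ?f (x(Suc k := y)) \<partial>Pi\<^sub>M {1..k} (\<lambda>_. lborel)) = ennreal (m y * W k (tilt y m))" .
  qed
  finally show ?thesis .
qed

lemma W_tilt_measurable [measurable (raw)]:
  assumes [measurable]: "m \<in> borel_measurable borel" "g \<in> borel_measurable N"
  shows "(\<lambda>p. W k (tilt (g p) m)) \<in> borel_measurable N"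
  unfolding tilt_def by measurable

lemma W_Suc:
  assumes m: "act m"
  shows "integrable lborel (\<lambda>y. m y * W k (tilt y m))"
    and "W (Suc k) m = (\<integral>y. m y * W k (tilt y m) \<partial>lborel)"
proof -
  note [measurable] = act_measurable[OF m]
  note [simp] = m
  show int: "integrable lborel (\<lambda>y. m y * W k (tilt y m))"
    by (rule integrableI_nonneg) (auto simp: nn_W_Suc[symmetric])
  show "W (Suc k) m = (\<integral>y. m y * W k (tilt y m) \<partial>lborel)"
    using nn_W_Suc[OF m, of k] int
    by (subst (asm) nn_integral_eq_integral) (auto simp: ennreal_inj)
qed

lemma W_mono:
  assumes "act m" "act m'" "\<And>x. m' x \<le> m x"
  shows "W k m' \<le> W k m"
  unfolding W_def
proof (rule integral_mono[OF W_integrable[OF assms(2)] W_integrable[OF assms(1)]])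
  fix x :: "nat \<Rightarrow> 'a"
  have "(\<Prod>i\<in>{1..k}. m' (x i)) \<le> (\<Prod>i\<in>{1..k}. m (x i))"
    using assms(2,3) by (intro prod_mono) simp
  then show "(\<Prod>i\<in>{1..k}. m' (x i)) * bprod k x \<le> (\<Prod>i\<in>{1..k}. m (x i)) * bprod k x"
    by (rule mult_right_mono) simp
qed

lemma W_le_power: "act m \<Longrightarrow> W k m \<le> mass m ^ k"
proof (induction k arbitrary: m)
  case (Suc k)
  have "W (Suc k) m = (\<integral>y. m y * W k (tilt y m) \<partial>lborel)" by (rule W_Suc[OF Suc.prems])
  also have "\<dots> \<le> (\<integral>y. m y * mass m ^ k \<partial>lborel)"
  proof (intro integral_mono mult_left_mono W_Suc Suc.prems)
    fix y
    have "W k (tilt y m) \<le> W k m" using Suc.prems by (intro W_mono) (auto simp: tilt_le)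
    also have "\<dots> \<le> mass m ^ k" using Suc by simp
    finally show "W k (tilt y m) \<le> mass m ^ k" .
  qed (use Suc.prems in auto)
  also have "\<dots> = mass m ^ Suc k" by (simp add: mass_def)
  finally show ?case .
qed simp

lemma W_le: "act m \<Longrightarrow> mass m \<le> V \<Longrightarrow> W k m \<le> V ^ k"
  using W_le_power[of m k] power_mono[of "mass m" V k] by simp

section \<open>Integrals of bounded functions against a nonnegative density\<close>

lemma act_integrable_scaleR:
  fixes F :: "'a \<Rightarrow> 'b::{banach, second_countable_topology}"
  assumes m: "act m" and [measurable]: "F \<in> borel_measurable borel"
    and F: "\<And>x. m x \<noteq> 0 \<Longrightarrow> norm (F x) \<le> c"
  shows "integrable lborel (\<lambda>x. m x *\<^sub>R F x)"
    and "norm (\<integral>x. m x *\<^sub>R F x \<partial>lborel) \<le> mass m * c"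
proof -
  note [measurable] = act_measurable[OF m]
  have i: "integrable lborel (\<lambda>x. m x * c)" using m by simp
  have le: "norm (m x *\<^sub>R F x) \<le> m x * c" for x
    using F[of x] act_nonneg[OF m, of x] by (cases "m x = 0") (simp_all add: mult_left_mono)
  show int: "integrable lborel (\<lambda>x. m x *\<^sub>R F x)"
  proof (rule Bochner_Integration.integrable_bound[OF i])
    show "(\<lambda>x. m x *\<^sub>R F x) \<in> borel_measurable lborel" by measurable
    show "AE x in lborel. norm (m x *\<^sub>R F x) \<le> norm (m x * c)"
      using order_trans[OF le abs_ge_self] by simp
  qed
  have "norm (\<integral>x. m x *\<^sub>R F x \<partial>lborel) \<le> (\<integral>x. m x * c \<partial>lborel)"
    by (rule Bochner_Integration.integral_norm_bound_integral[OF int i le])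
  then show "norm (\<integral>x. m x *\<^sub>R F x \<partial>lborel) \<le> mass m * c" by (simp add: mass_def)
qed

lemma
  fixes F :: "'a \<Rightarrow> real"
  assumes "act m" "F \<in> borel_measurable borel" "\<And>x. \<bar>F x\<bar> \<le> c"
  shows act_integrable_mult: "integrable lborel (\<lambda>x. m x * F x)"
    and act_integral_abs_le: "\<bar>\<integral>x. m x * F x \<partial>lborel\<bar> \<le> mass m * c"
  using act_integrable_scaleR[of m F c] assms by simp_all

lemma
  fixes F :: "'a \<Rightarrow> complex"
  assumes "act m" "F \<in> borel_measurable borel" "\<And>x. m x \<noteq> 0 \<Longrightarrow> cmod (F x) \<le> c"
  shows act_cintegrable: "integrable lborel (\<lambda>x. of_real (m x) * F x)"
    and act_cintegral_norm_le: "cmod (\<integral>x. of_real (m x) * F x \<partial>lborel) \<le> mass m * c"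
  using act_integrable_scaleR[of m F c] assms by (simp_all add: scaleR_conv_of_real)

section \<open>First- and second-order dependence of \<open>W\<close> on the profile\<close>

lemma act_diff:
  assumes "act m" "act m'" "\<And>x. m' x \<le> m x"
  shows "act (\<lambda>x. m x - m' x)"
proof (rule actI)
  show "integrable lborel (\<lambda>x. m x - m' x)" using assms(1,2) by simp
  show "0 \<le> m x - m' x" for x using assms(3)[of x] by simp
qed

lemma mass_diff: "act m \<Longrightarrow> act m' \<Longrightarrow> mass (\<lambda>x. m x - m' x) = mass m - mass m'"
  by (simp add: mass_def)

lemma tilt_mono: "(\<And>x. m' x \<le> m x) \<Longrightarrow> tilt y m' x \<le> tilt y m x"
  unfolding tilt_def by (rule mult_right_mono) simp_all

lemma tilt_diff: "tilt y (\<lambda>x. m x - m' x) = (\<lambda>x. tilt y m x - tilt y m' x)"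
  by (simp add: tilt_def algebra_simps)

text \<open>Either the point integrated out carries the difference of the profiles, or the
  difference sits in the tilted profiles of the remaining points. Tilting only lowers masses, so one
  \<open>V\<close> serves at every level of the induction.\<close>

lemma W_lipschitz:
  assumes "act m" "act m'" "\<And>x. m' x \<le> m x" "mass m \<le> V"
  shows "W k m - W k m' \<le> real k * mass (\<lambda>x. m x - m' x) * V ^ (k - 1)"
  using assms
proof (induction k arbitrary: m m')
  case (Suc k)
  note m = Suc.prems
  define e where "e = (\<lambda>x. m x - m' x)"
  have e: "act e" unfolding e_def by (rule act_diff[OF m(1-3)])
  have V: "0 \<le> V" using mass_nonneg[OF m(1)] m(4) by simp
  note [measurable] = m(1,2)[THEN act_measurable] e[THEN act_measurable]
  have mt: "mass (tilt y m) \<le> V" for y using mass_tilt_le[OF m(1), of y] m(4) by simp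
  have Wb: "\<bar>W k (tilt y m)\<bar> \<le> V ^ k" for y
    using W_le[OF act_tilt[OF m(1)] mt] m by simp
  have diff: "\<bar>W k (tilt y m) - W k (tilt y m')\<bar> \<le> real k * mass e * V ^ (k - 1)" for y
  proof -
    have 1: "W k (tilt y m') \<le> W k (tilt y m)"
      using m by (intro W_mono) (auto simp: tilt_mono)
    have "W k (tilt y m) - W k (tilt y m') \<le>
       real k * mass (\<lambda>x. tilt y m x - tilt y m' x) * V ^ (k - 1)"
      by (rule Suc.IH) (use m mt in \<open>auto simp: tilt_mono\<close>)
    also have "(\<lambda>x. tilt y m x - tilt y m' x) = tilt y e" by (simp add: e_def tilt_diff)
    also have "real k * mass (tilt y e) * V ^ (k - 1) \<le> real k * mass e * V ^ (k - 1)"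
      using V mass_tilt_le[OF e] by (intro mult_right_mono mult_left_mono) auto
    finally show ?thesis using 1 by simp
  qed
  have int: "integrable lborel (\<lambda>y. e y * W k (tilt y m))"
    by (rule act_integrable_mult[OF e _ Wb]) measurable
  have int': "integrable lborel (\<lambda>y. m' y * (W k (tilt y m) - W k (tilt y m')))"
    by (rule act_integrable_mult[OF m(2) _ diff]) measurable
  have "W (Suc k) m - W (Suc k) m' =
     (\<integral>y. m y * W k (tilt y m) - m' y * W k (tilt y m') \<partial>lborel)"
    unfolding W_Suc(2)[OF m(1)] W_Suc(2)[OF m(2)] using m
    by (intro Bochner_Integration.integral_diff[symmetric] W_Suc) auto
  also have "\<dots> = (\<integral>y. e y * W k (tilt y m) + m' y * (W k (tilt y m) - W k (tilt y m')) \<partial>lborel)"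
    by (simp add: e_def algebra_simps)
  also have "\<dots> = (\<integral>y. e y * W k (tilt y m) \<partial>lborel) +
      (\<integral>y. m' y * (W k (tilt y m) - W k (tilt y m')) \<partial>lborel)"
    by (rule Bochner_Integration.integral_add[OF int int'])
  also have "\<dots> \<le> mass e * V ^ k + mass m' * (real k * mass e * V ^ (k - 1))"
  proof (intro add_mono)
    have "\<bar>\<integral>y. e y * W k (tilt y m) \<partial>lborel\<bar> \<le> mass e * V ^ k"
      by (rule act_integral_abs_le[OF e _ Wb]) measurable
    then show "(\<integral>y. e y * W k (tilt y m) \<partial>lborel) \<le> mass e * V ^ k" by simp
    have "\<bar>\<integral>y. m' y * (W k (tilt y m) - W k (tilt y m')) \<partial>lborel\<bar> \<le>
        mass m' * (real k * mass e * V ^ (k - 1))"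
      by (rule act_integral_abs_le[OF m(2) _ diff]) measurable
    then show "(\<integral>y. m' y * (W k (tilt y m) - W k (tilt y m')) \<partial>lborel) \<le>
        mass m' * (real k * mass e * V ^ (k - 1))" by simp
  qed
  also have "\<dots> \<le> mass e * V ^ k + V * (real k * mass e * V ^ (k - 1))"
    using mass_mono[OF m(1-3)] m(4) V e by (intro add_left_mono mult_right_mono) auto
  also have "\<dots> = real (Suc k) * mass e * V ^ k"
    by (cases k) (auto simp: algebra_simps)
  finally show ?case by (simp add: e_def)
qed simp

lemma act_pair_integrable:
  fixes F :: "'a \<Rightarrow> 'a \<Rightarrow> real"
  assumes m: "act m" "act m'" and [measurable]: "case_prod F \<in> borel_measurable (borel \<Otimes>\<^sub>M borel)"
    and F: "\<And>x y. \<bar>F x y\<bar> \<le> c"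
  shows "integrable (lborel \<Otimes>\<^sub>M lborel) (\<lambda>(x, y). m x * m' y * F x y)"
proof (rule Bochner_Integration.integrable_bound)
  note [measurable] = m[THEN act_measurable]
  show "integrable (lborel \<Otimes>\<^sub>M lborel) (\<lambda>(x, y). m x * (m' y * c))"
  proof (rule lborel_pair.Fubini_integrable)
    have "norm (m x) * (\<integral>y. norm (m' y * c) \<partial>lborel) = m x * (\<integral>y. norm (m' y * c) \<partial>lborel)" for x
      using m by simp
    moreover have "integrable lborel (\<lambda>x. m x * (\<integral>y. norm (m' y * c) \<partial>lborel))"
      using m by simp
    ultimately show "integrable lborel (\<lambda>x. \<integral>y. norm (case (x, y) of (x, y) \<Rightarrow> m x * (m' y * c)) \<partial>lborel)"
      using m by (simp add: abs_mult)
  qed (use m in \<open>auto intro!: AE_I2\<close>)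
  show "(\<lambda>(x, y). m x * m' y * F x y) \<in> borel_measurable (lborel \<Otimes>\<^sub>M lborel)" by measurable
  have "m x * m' y * \<bar>F x y\<bar> \<le> m x * m' y * \<bar>c\<bar>" for x y
    using m F[of x y] by (intro mult_left_mono) auto
  then show "AE z in lborel \<Otimes>\<^sub>M lborel. norm (case z of (x, y) \<Rightarrow> m x * m' y * F x y) \<le>
       norm (case z of (x, y) \<Rightarrow> m x * (m' y * c))"
    using m by (auto simp: abs_mult mult_ac)
qed

text \<open>A Taylor expansion around \<open>m'\<close>: by symmetry each of the
  \<open>Suc k\<close> points contributes the same linear term, and the remainder requires two
  different points to carry \<open>m - m'\<close>, whence the factor (k + 1) k.\<close>

lemma W_quadratic:
  assumes "act m" "act m'" "\<And>x. m' x \<le> m x" "mass m \<le> V"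
  shows "\<bar>W (Suc k) m - W (Suc k) m'
       - real (Suc k) * (\<integral>y. (m y - m' y) * W k (tilt y m') \<partial>lborel)\<bar>
     \<le> real (Suc k) * real k * (mass (\<lambda>x. m x - m' x))\<^sup>2 * V ^ (k - 1)"
  using assms
proof (induction k arbitrary: m m')
  case 0
  then show ?case
    using W_Suc(2)[OF 0(1), of 0] W_Suc(2)[OF 0(2), of 0] by simp
next
  case (Suc k)
  note m = Suc.prems
  define e where "e = (\<lambda>x. m x - m' x)"
  have e: "act e" unfolding e_def by (rule act_diff[OF m(1-3)])
  have V: "0 \<le> V" using mass_nonneg[OF m(1)] m(4) by simp
  have m'V: "mass m' \<le> V" using mass_mono[OF m(1-3)] m(4) by simp
  note [measurable] = m(1,2)[THEN act_measurable] e[THEN act_measurable]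
  have mt: "mass (tilt y m) \<le> V" for y using mass_tilt_le[OF m(1), of y] m(4) by simp
  have mt': "mass (tilt y m') \<le> V" for y using mass_tilt_le[OF m(2), of y] m'V by simp
  have te: "(\<lambda>x. tilt y m x - tilt y m' x) = tilt y e" for y by (simp add: e_def tilt_diff)
  let ?k = "Suc k"
  let ?L = "real ?k * mass e * V ^ k"
  let ?Q = "real ?k * real k * (mass e)\<^sup>2 * V ^ (k - 1)"
  let ?G = "\<lambda>y. \<integral>w. e w * b w y * W k (tilt w (tilt y m')) \<partial>lborel"
  let ?D = "\<lambda>y. W ?k (tilt y m) - W ?k (tilt y m')"
  have Wb: "\<bar>W ?k (tilt y m')\<bar> \<le> V ^ ?k" for y
    using W_le[OF act_tilt[OF m(2)] mt', of "Suc k" y] m by simp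
  have diff: "\<bar>?D y\<bar> \<le> ?L" for y
  proof -
    have 1: "W ?k (tilt y m') \<le> W ?k (tilt y m)"
      using m by (intro W_mono) (auto simp: tilt_mono)
    have "?D y \<le> real ?k * mass (\<lambda>x. tilt y m x - tilt y m' x) * V ^ (?k - 1)"
      by (rule W_lipschitz) (use m mt in \<open>auto simp: tilt_mono\<close>)
    also have "\<dots> \<le> ?L"
      unfolding te using V mass_tilt_le[OF e] by (simp add: mult_right_mono mult_left_mono)
    finally show ?thesis using 1 by simp
  qed
  have quad: "\<bar>?D y - real ?k * ?G y\<bar> \<le> ?Q" for y
  proof -
    have "\<bar>W ?k (tilt y m) - W ?k (tilt y m')
        - real ?k * (\<integral>w. (tilt y m w - tilt y m' w) * W k (tilt w (tilt y m')) \<partial>lborel)\<bar>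
      \<le> real ?k * real k * (mass (\<lambda>x. tilt y m x - tilt y m' x))\<^sup>2 * V ^ (k - 1)"
      by (rule Suc.IH) (use m mt in \<open>auto simp: tilt_mono\<close>)
    also have "\<dots> \<le> ?Q"
      unfolding te using V mass_tilt_le[OF e] e
      by (intro mult_right_mono mult_left_mono power_mono) auto
    finally show ?thesis
      by (simp add: tilt_def e_def left_diff_distrib)
  qed
  let ?H = "\<lambda>w y. b w y * W k (tilt w (tilt y m'))"
  have Wb2: "\<bar>?H w y\<bar> \<le> V ^ k" for w y
  proof -
    have "mass (tilt w (tilt y m')) \<le> V"
      using mass_tilt_le[OF act_tilt[OF m(2)]] mt' order_trans by blast
    from W_le[OF _ this, of k] m have "\<bar>W k (tilt w (tilt y m'))\<bar> \<le> V ^ k" by simp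
    then have "b w y * \<bar>W k (tilt w (tilt y m'))\<bar> \<le> 1 * V ^ k"
      by (intro mult_mono) auto
    then show ?thesis by (simp add: abs_mult)
  qed
  have [measurable]: "?G \<in> borel_measurable borel"
    unfolding tilt_def by measurable
  have Gb: "\<bar>?G y\<bar> \<le> mass e * V ^ k" for y
  proof -
    have "(\<lambda>w. ?H w y) \<in> borel_measurable borel"
      unfolding tilt_def by measurable
    from act_integral_abs_le[OF e this Wb2] show ?thesis by (simp add: mult.assoc)
  qed
  \<comment> \<open>The point integrated out and the point carrying \<open>e\<close> change places;
    symmetry of \<open>b\<close> and commutation of tilts identify the inner linear terms with the
    outer one. Their numbers \<open>?k\<close> and 1 add up to \<open>Suc ?k\<close>.\<close>
  have Fub: "(\<integral>y. m' y * ?G y \<partial>lborel) = (\<integral>w. e w * W ?k (tilt w m') \<partial>lborel)"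
  proof -
    have "integrable (lborel \<Otimes>\<^sub>M lborel) (\<lambda>(y, w). m' y * e w * ?H w y)"
      by (rule act_pair_integrable[OF m(2) e _ Wb2]) (unfold tilt_def, measurable)
    from lborel_pair.Fubini_integral[OF this]
    have "(\<integral>w. (\<integral>y. m' y * e w * ?H w y \<partial>lborel) \<partial>lborel) =
      (\<integral>y. (\<integral>w. m' y * e w * ?H w y \<partial>lborel) \<partial>lborel)" .
    also have "\<dots> = (\<integral>y. m' y * ?G y \<partial>lborel)"
      by (simp add: mult.assoc)
    also have "(\<integral>w. (\<integral>y. m' y * e w * ?H w y \<partial>lborel) \<partial>lborel) =
       (\<integral>w. e w * (\<integral>y. tilt w m' y * W k (tilt y (tilt w m')) \<partial>lborel) \<partial>lborel)"
    proof (intro Bochner_Integration.integral_cong refl)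
      fix w
      have "m' y * e w * ?H w y =
          e w * (tilt w m' y * W k (tilt y (tilt w m')))" for y
        by (subst tilt_commute) (simp add: tilt_def b_sym[of w y])
      then show "(\<integral>y. m' y * e w * ?H w y \<partial>lborel) =
         e w * (\<integral>y. tilt w m' y * W k (tilt y (tilt w m')) \<partial>lborel)"
        by (simp only: integral_mult_right_zero)
    qed
    also have "\<dots> = (\<integral>w. e w * W ?k (tilt w m') \<partial>lborel)"
      using m by (simp add: W_Suc(2))
    finally show ?thesis by simp
  qed
  have int1: "integrable lborel (\<lambda>y. e y * W ?k (tilt y m'))"
    by (rule act_integrable_mult[OF e _ Wb]) measurable
  have int2: "integrable lborel (\<lambda>y. e y * ?D y)"
    by (rule act_integrable_mult[OF e _ diff]) measurable
  have int3: "integrable lborel (\<lambda>y. m' y * (?D y - real ?k * ?G y))"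
    by (rule act_integrable_mult[OF m(2) _ quad]) measurable
  have int4: "integrable lborel (\<lambda>y. m' y * ?G y)"
    by (rule act_integrable_mult[OF m(2) _ Gb]) measurable
  have "W (Suc ?k) m - W (Suc ?k) m' =
     (\<integral>y. m y * W ?k (tilt y m) - m' y * W ?k (tilt y m') \<partial>lborel)"
    unfolding W_Suc(2)[OF m(1)] W_Suc(2)[OF m(2)] using m
    by (intro Bochner_Integration.integral_diff[symmetric] W_Suc) auto
  also have "\<dots> = (\<integral>y. (e y * W ?k (tilt y m') + e y * ?D y) +
       (m' y * (?D y - real ?k * ?G y) + real ?k * (m' y * ?G y)) \<partial>lborel)"
    by (simp add: e_def algebra_simps)
  also have "\<dots> = ((\<integral>y. e y * W ?k (tilt y m') \<partial>lborel) + (\<integral>y. e y * ?D y \<partial>lborel)) +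
       ((\<integral>y. m' y * (?D y - real ?k * ?G y) \<partial>lborel) + real ?k * (\<integral>y. m' y * ?G y \<partial>lborel))"
    using int1 int2 int3 int4 by simp
  also have "\<dots> = real (Suc ?k) * (\<integral>y. e y * W ?k (tilt y m') \<partial>lborel) + (\<integral>y. e y * ?D y \<partial>lborel)
      + (\<integral>y. m' y * (?D y - real ?k * ?G y) \<partial>lborel)"
    unfolding Fub by (simp add: algebra_simps)
  finally have "\<bar>W (Suc ?k) m - W (Suc ?k) m' - real (Suc ?k) * (\<integral>y. e y * W ?k (tilt y m') \<partial>lborel)\<bar>
      \<le> \<bar>\<integral>y. e y * ?D y \<partial>lborel\<bar> + \<bar>\<integral>y. m' y * (?D y - real ?k * ?G y) \<partial>lborel\<bar>"
    by simp
  also have "\<dots> \<le> mass e * ?L + mass m' * ?Q"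
  proof (rule add_mono)
    show "\<bar>\<integral>y. e y * ?D y \<partial>lborel\<bar> \<le> mass e * ?L"
      by (rule act_integral_abs_le[OF e _ diff]) measurable
    show "\<bar>\<integral>y. m' y * (?D y - real ?k * ?G y) \<partial>lborel\<bar> \<le> mass m' * ?Q"
      by (rule act_integral_abs_le[OF m(2) _ quad]) measurable
  qed
  also have "\<dots> \<le> mass e * ?L + V * ?Q"
    using m'V V by (intro add_left_mono mult_right_mono) auto
  also have "\<dots> = real ?k * real ?k * (mass e)\<^sup>2 * V ^ k"
    by (cases k) (auto simp: algebra_simps power2_eq_square)
  also have "\<dots> \<le> real (Suc ?k) * real ?k * (mass e)\<^sup>2 * V ^ k"
    using V by (intro mult_right_mono) auto
  finally show ?case by (simp add: e_def)
qed

section \<open>The partition function as a power series in the activity\<close>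

text \<open>The activity \<open>z * m x\<close> is split into a complex scale \<open>z\<close> and a real profile \<open>m\<close>.\<close>

definition Z :: "complex \<Rightarrow> ('a \<Rightarrow> real) \<Rightarrow> complex" where
  "Z z m = (\<Sum>k. complex_of_real (W k m / fact k) * z ^ k)"

definition Z' :: "complex \<Rightarrow> ('a \<Rightarrow> real) \<Rightarrow> complex" where
  "Z' z m = (\<Sum>k. complex_of_real (W (Suc k) m / fact k) * z ^ k)"

lemma exp_series_sums: "(\<lambda>k. (x::real) ^ k / fact k) sums exp x"
  using exp_converges[of x] by (simp add: divide_inverse_commute)

lemma norm_suminf_le_exp:
  fixes f :: "nat \<Rightarrow> complex"
  assumes "\<And>k. cmod (f k) \<le> a * (x ^ k / fact k)"
  shows "cmod (suminf f) \<le> a * exp x"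
proof -
  have "cmod (suminf f) \<le> (\<Sum>k. a * (x ^ k / fact k))"
    by (rule norm_suminf_le[OF assms summable_mult[OF sums_summable[OF exp_series_sums]]])
  also have "\<dots> = a * exp x" by (rule sums_unique[OF sums_mult[OF exp_series_sums], symmetric])
  finally show ?thesis .
qed

lemma Z_term_bound:
  assumes "act m" "mass m \<le> V"
  shows "cmod (complex_of_real (W k m / fact k) * z ^ k) \<le> (cmod z * V) ^ k / fact k"
proof -
  have "W k m / fact k * cmod z ^ k \<le> V ^ k / fact k * cmod z ^ k"
    using W_le[OF assms] by (intro mult_right_mono divide_right_mono) auto
  moreover have "cmod (complex_of_real (W k m / fact k) * z ^ k) = W k m / fact k * cmod z ^ k"
    using assms(1) by (simp add: norm_mult norm_power del: of_real_divide)
  ultimately show ?thesis by (simp add: power_mult_distrib mult_ac)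
qed

lemma Z_summable:
  assumes "act m"
  shows "summable (\<lambda>k. complex_of_real (W k m / fact k) * z ^ k)"
  by (rule summable_comparison_test'[OF sums_summable[OF exp_series_sums] Z_term_bound[OF assms order_refl]])

lemma norm_Z_le:
  assumes "act m" "mass m \<le> V"
  shows "cmod (Z z m) \<le> exp (cmod z * V)"
  unfolding Z_def using norm_suminf_le_exp[of _ 1] Z_term_bound[OF assms] by simp

lemma Z_has_field_derivative:
  assumes "act m"
  shows "((\<lambda>z. Z z m) has_field_derivative Z' z m) (at z)"
proof -
  have "diffs (\<lambda>k. complex_of_real (W k m / fact k)) = (\<lambda>k. complex_of_real (W (Suc k) m / fact k))"
    by (rule ext) (simp add: diffs_def divide_simps fact_reduce flip: of_nat_Suc)
  with termdiffs_strong_converges_everywhere[OF Z_summable[OF assms], of z]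
  show ?thesis unfolding Z_def Z'_def by simp
qed

lemma Z_holomorphic [holomorphic_intros]: "act m \<Longrightarrow> (\<lambda>z. Z z m) holomorphic_on S"
  using Z_has_field_derivative by (meson holomorphic_on_def field_differentiable_def
      has_field_derivative_at_within)

lemma norm_Z'_le:
  assumes "act m" "mass m \<le> V"
  shows "cmod (Z' z m) \<le> V * exp (cmod z * V)"
proof -
  have "cmod (complex_of_real (W (Suc k) m / fact k) * z ^ k) \<le> V * ((cmod z * V) ^ k / fact k)" for k
  proof -
    have "W (Suc k) m / fact k * cmod z ^ k \<le> V ^ Suc k / fact k * cmod z ^ k"
      using W_le[OF assms, of "Suc k"] by (intro mult_right_mono divide_right_mono) auto
    moreover have "cmod (complex_of_real (W (Suc k) m / fact k) * z ^ k) = W (Suc k) m / fact k * cmod z ^ k"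
      using assms(1) by (simp add: norm_mult norm_power del: of_real_divide)
    ultimately show ?thesis by (simp add: power_mult_distrib mult_ac)
  qed
  then show ?thesis unfolding Z'_def by (rule norm_suminf_le_exp)
qed

lemma Z_lipschitz_activity:
  assumes "act m" "mass m \<le> V" "cmod z \<le> \<rho>" "cmod w \<le> \<rho>"
  shows "cmod (Z z m - Z w m) \<le> V * exp (\<rho> * V) * cmod (z - w)"
proof (rule field_differentiable_bound[where S="cball 0 \<rho>" and f'="\<lambda>z. Z' z m"])
  have V: "0 \<le> V" using mass_nonneg[OF assms(1)] assms(2) by simp
  show "((\<lambda>z. Z z m) has_field_derivative Z' z m) (at z within cball 0 \<rho>)" for z
    using Z_has_field_derivative[OF assms(1)] has_field_derivative_at_within by blast
  fix z :: complex assume "z \<in> cball 0 \<rho>"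
  then have "exp (cmod z * V) \<le> exp (\<rho> * V)" using V by (simp add: mult_right_mono)
  then have "V * exp (cmod z * V) \<le> V * exp (\<rho> * V)" using V by (rule mult_left_mono)
  with norm_Z'_le[OF assms(1,2), of z] show "cmod (Z' z m) \<le> V * exp (\<rho> * V)" by simp
qed (use assms in auto)

lemma Z_diff_sums:
  assumes "act m" "act m'"
  shows "(\<lambda>k. complex_of_real ((W (Suc k) m - W (Suc k) m') / fact (Suc k)) * z ^ Suc k) sums (Z z m - Z z m')"
proof -
  have "(\<lambda>k. complex_of_real ((W k m - W k m') / fact k) * z ^ k) sums (Z z m - Z z m')"
    using sums_diff[OF Z_summable[OF assms(1), THEN summable_sums] Z_summable[OF assms(2), THEN summable_sums], of z z]
    unfolding Z_def by (simp add: diff_divide_distrib left_diff_distrib)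
  then show ?thesis by (subst sums_Suc_iff) simp
qed

lemma Z_lipschitz_profile:
  assumes "act m" "act m'" "\<And>x. m' x \<le> m x" "mass m \<le> V"
  shows "cmod (Z z m - Z z m') \<le> cmod z * mass (\<lambda>x. m x - m' x) * exp (cmod z * V)"
proof -
  let ?e = "mass (\<lambda>x. m x - m' x)" and ?d = "\<lambda>k. W (Suc k) m - W (Suc k) m'"
  have bd: "cmod (complex_of_real (?d k / fact (Suc k)) * z ^ Suc k) \<le> cmod z * ?e * ((cmod z * V) ^ k / fact k)" for k
  proof -
    have "cmod (complex_of_real (?d k / fact (Suc k)) * z ^ Suc k) = \<bar>?d k\<bar> / fact (Suc k) * cmod z ^ Suc k"
      by (simp only: norm_mult norm_power norm_of_real abs_divide) simp
    also have "\<dots> \<le> real (Suc k) * ?e * V ^ k / fact (Suc k) * cmod z ^ Suc k"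
      using W_lipschitz[OF assms, of "Suc k"] W_mono[OF assms(1-3), of "Suc k"]
      by (intro mult_right_mono divide_right_mono) simp_all
    also have "\<dots> = cmod z * ?e * ((cmod z * V) ^ k / fact k)"
      by (simp add: divide_simps power_mult_distrib)
    finally show ?thesis .
  qed
  from norm_suminf_le_exp[OF bd] show ?thesis
    using sums_unique[OF Z_diff_sums[OF assms(1,2)]] by (simp only:)
qed

lemma Z_measurable [measurable (raw)]:
  assumes [measurable]: "case_prod f \<in> borel_measurable (N \<Otimes>\<^sub>M borel)"
  shows "(\<lambda>p. Z z (f p)) \<in> borel_measurable N"
  unfolding Z_def by measurable

lemma Z'_measurable [measurable (raw)]:
  assumes [measurable]: "case_prod f \<in> borel_measurable (N \<Otimes>\<^sub>M borel)"
  shows "(\<lambda>p. Z' z (f p)) \<in> borel_measurable N"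
  unfolding Z'_def by measurable

lemma Z_integral_sums:
  assumes m: "act m" and e: "act e"
  shows "(\<lambda>k. complex_of_real ((\<integral>y. e y * W k (tilt y m) \<partial>lborel) / fact k) * z ^ k) sums
    (\<integral>y. of_real (e y) * Z z (tilt y m) \<partial>lborel)"
proof -
  note [measurable] = m[THEN act_measurable] e[THEN act_measurable]
  let ?V = "mass m"
  let ?f = "\<lambda>k y. of_real (e y) * (complex_of_real (W k (tilt y m) / fact k) * z ^ k)"
  have bd: "cmod (complex_of_real (W k (tilt y m) / fact k) * z ^ k) \<le> (cmod z * ?V) ^ k / fact k" for k y
    by (rule Z_term_bound) (use m in \<open>auto intro: mass_tilt_le\<close>)
  have int: "integrable lborel (?f k)" for k
    by (rule act_cintegrable[OF e _ bd]) measurable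
  have smy: "summable (\<lambda>k. norm (?f k y))" for y
  proof (rule summable_comparison_test'[OF summable_mult[OF sums_summable[OF exp_series_sums]]])
    show "norm (norm (?f k y)) \<le> e y * ((cmod z * ?V) ^ k / fact k)" for k
      using mult_left_mono[OF bd[of k y] act_nonneg[OF e, of y]] act_nonneg[OF e, of y]
      by (simp only: norm_mult norm_of_real real_norm_def abs_of_nonneg abs_mult abs_norm_cancel)
  qed
  have smi: "summable (\<lambda>k. \<integral>y. norm (?f k y) \<partial>lborel)"
  proof (rule summable_comparison_test[OF _ summable_mult[OF sums_summable[OF exp_series_sums]]])
    have "(\<integral>y. norm (?f k y) \<partial>lborel) \<le> mass e * ((cmod z * ?V) ^ k / fact k)" for k
    proof -
      have "(\<integral>y. norm (?f k y) \<partial>lborel) \<le> (\<integral>y. e y * ((cmod z * ?V) ^ k / fact k) \<partial>lborel)"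
      proof (rule integral_mono)
        show "integrable lborel (\<lambda>y. norm (?f k y))" using int by (rule integrable_norm)
        show "integrable lborel (\<lambda>y. e y * ((cmod z * ?V) ^ k / fact k))" using e by simp
        show "norm (?f k y) \<le> e y * ((cmod z * ?V) ^ k / fact k)" for y
          using mult_left_mono[OF bd[of k y] act_nonneg[OF e, of y]] act_nonneg[OF e, of y]
          by (simp only: norm_mult norm_of_real abs_of_nonneg)
      qed
      then show ?thesis by (simp add: mass_def)
    qed
    then show "\<exists>N. \<forall>k\<ge>N. norm (\<integral>y. norm (?f k y) \<partial>lborel) \<le> mass e * ((cmod z * ?V) ^ k / fact k)"
      by simp
  qed
  have "(\<lambda>k. \<integral>y. ?f k y \<partial>lborel) sums (\<integral>y. (\<Sum>k. ?f k y) \<partial>lborel)"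
    by (rule sums_integral[OF int AE_I2[OF smy] smi])
  moreover have "(\<Sum>k. ?f k y) = of_real (e y) * Z z (tilt y m)" for y
    unfolding Z_def by (rule suminf_mult[OF Z_summable[OF act_tilt[OF m]]])
  moreover have "(\<integral>y. ?f k y \<partial>lborel) =
     complex_of_real ((\<integral>y. e y * W k (tilt y m) \<partial>lborel) / fact k) * z ^ k" for k
  proof -
    have "(\<integral>y. ?f k y \<partial>lborel) = (\<integral>y. complex_of_real (e y * W k (tilt y m)) * (z ^ k / fact k) \<partial>lborel)"
      by (simp add: mult_ac)
    also have "\<dots> = complex_of_real (\<integral>y. e y * W k (tilt y m) \<partial>lborel) * (z ^ k / fact k)"
      by (simp only: integral_mult_left_zero integral_complex_of_real)
    finally show ?thesis by simp
  qed
  ultimately show ?thesis by simp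
qed

text \<open>The derivative of \<open>Z\<close> in the direction of a density e is the partition
  function with one extra particle placed according to e. On summation, the factor (k + 2) (k + 1)
  of the remainder in \<open>W_quadratic\<close> cancels against (k + 2)!, which leaves an
  exponential series.\<close>

lemma Z_quadratic:
  assumes "act m" "act m'" "\<And>x. m' x \<le> m x" "mass m \<le> V"
  shows "cmod (Z z m - Z z m' - z * (\<integral>y. of_real (m y - m' y) * Z z (tilt y m') \<partial>lborel))
     \<le> (cmod z * mass (\<lambda>x. m x - m' x))\<^sup>2 * exp (cmod z * V)"
proof -
  define e where "e = (\<lambda>x. m x - m' x)"
  have e: "act e" unfolding e_def by (rule act_diff[OF assms(1-3)])
  have V: "0 \<le> V" using mass_nonneg[OF assms(1)] assms(4) by simp
  let ?I = "\<lambda>k. \<integral>y. e y * W k (tilt y m') \<partial>lborel"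
  let ?d = "\<lambda>k. W k m - W k m'"
  let ?g = "\<lambda>k. (cmod z * mass e)\<^sup>2 * ((cmod z * V) ^ k / fact k)"
  define t where "t = (\<lambda>k. complex_of_real (?d (Suc k) / fact (Suc k)) * z ^ Suc k - z * (complex_of_real (?I k / fact k) * z ^ k))"
  have s3: "t sums (Z z m - Z z m' - z * (\<integral>y. of_real (e y) * Z z (tilt y m') \<partial>lborel))"
    unfolding t_def by (rule sums_diff[OF Z_diff_sums[OF assms(1,2)] sums_mult[OF Z_integral_sums[OF assms(2) e]]])
  \<comment> \<open>The term of index 0 vanishes because \<open>W 1\<close> is linear in the
    profile; the shift exposes the factor z^2.\<close>
  have s4: "(\<lambda>k. t (Suc k)) sums (Z z m - Z z m' - z * (\<integral>y. of_real (e y) * Z z (tilt y m') \<partial>lborel))"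
  proof -
    have "t 0 = 0" using W_Suc(2)[OF assms(1), of 0] W_Suc(2)[OF assms(2), of 0] assms(1,2)
      by (simp add: t_def e_def)
    with s3 show ?thesis by (subst sums_Suc_iff) simp
  qed
  have bd: "cmod (t (Suc k)) \<le> ?g k" for k
  proof -
    let ?k = "Suc k"
    have "t ?k = complex_of_real ((?d (Suc ?k) - real (Suc ?k) * ?I ?k) / fact (Suc ?k)) * z ^ Suc ?k"
      by (simp add: t_def divide_simps del: of_nat_Suc) (simp add: algebra_simps del: of_nat_Suc)
    then have "cmod (t ?k) = \<bar>?d (Suc ?k) - real (Suc ?k) * ?I ?k\<bar> / fact (Suc ?k) * cmod z ^ Suc ?k"
      by (simp only: norm_mult norm_power norm_of_real abs_divide) simp
    also have "\<dots> \<le> real (Suc ?k) * real ?k * (mass e)\<^sup>2 * V ^ k / fact (Suc ?k) * cmod z ^ Suc ?k"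
      using W_quadratic[OF assms, of ?k] unfolding e_def
      by (intro mult_right_mono divide_right_mono) auto
    also have "\<dots> = ?g k"
      by (simp add: divide_simps power_mult_distrib power2_eq_square)
    finally show ?thesis .
  qed
  from norm_suminf_le_exp[OF bd] show ?thesis using sums_unique[OF s4] by (simp only: e_def)
qed

section \<open>Real activities\<close>

definition ZR :: "real \<Rightarrow> ('a \<Rightarrow> real) \<Rightarrow> real" where
  "ZR t m = (\<Sum>k. W k m / fact k * t ^ k)"

lemma ZR_summable: "act m \<Longrightarrow> summable (\<lambda>k. W k m / fact k * t ^ k)"
  using Z_summable[of m "of_real t"]
  by (subst summable_of_real_iff[where ?'a=complex, symmetric]) simp

lemma Z_of_real: "act m \<Longrightarrow> Z (of_real t) m = of_real (ZR t m)"
  unfolding Z_def ZR_def by (subst suminf_of_real[OF ZR_summable]) simp_all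

lemma ZR_ge_1:
  assumes "act m" "0 \<le> t"
  shows "1 \<le> ZR t m"
  using sum_le_suminf[OF ZR_summable[OF assms(1)], of "{0}" t] assms
  by (simp add: ZR_def)

lemma Z_zero_profile [simp]: "Z z (\<lambda>x. 0) = 1"
proof -
  have "W (Suc k) (\<lambda>x. 0) = 0" for k by (simp add: W_Suc(2) act_def)
  then have "(\<lambda>k. complex_of_real (W k (\<lambda>x. 0) / fact k) * z ^ k) = (\<lambda>k. if k = 0 then 1 else 0)"
    by (auto simp: fun_eq_iff gr0_conv_Suc)
  then have "(\<lambda>k. complex_of_real (W k (\<lambda>x. 0) / fact k) * z ^ k) sums 1"
    using sums_single[of 0 "\<lambda>k. 1::complex"] by simp
  then show ?thesis unfolding Z_def by (simp add: sums_iff)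
qed

end

section \<open>Exposing a point shell by shell\<close>

text \<open>Over n equal pieces the increments add up to at most n K (T/n)^2, which tends to
  0.\<close>

lemma quadratic_increments_imp_constant:
  fixes f :: "real \<Rightarrow> 'b::real_normed_vector"
  assumes T: "0 \<le> T"
    and f: "\<And>s t. 0 \<le> s \<Longrightarrow> s \<le> t \<Longrightarrow> t \<le> T \<Longrightarrow> norm (f t - f s) \<le> K * (t - s)\<^sup>2"
  shows "f T = f 0"
proof -
  have "norm (f T - f 0) \<le> K * T\<^sup>2 / real n" if n: "n \<ge> 1" for n
  proof -
    let ?p = "\<lambda>i. real i * T / real n"
    have "f T - f 0 = (\<Sum>i<n. f (?p (Suc i)) - f (?p i))"
      using n by (subst sum_lessThan_telescope) simp
    also have "norm \<dots> \<le> (\<Sum>i<n. K * (T / real n)\<^sup>2)"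
    proof (rule sum_norm_le)
      fix i assume "i \<in> {..<n}"
      then have i: "real (Suc i) \<le> real n" by simp
      have "norm (f (?p (Suc i)) - f (?p i)) \<le> K * (?p (Suc i) - ?p i)\<^sup>2"
      proof (rule f)
        show "?p i \<le> ?p (Suc i)" using T by (simp add: divide_right_mono mult_right_mono)
        show "?p (Suc i) \<le> T"
          using mult_right_mono[OF i T] n by (simp add: divide_le_eq mult_ac)
      qed (use T in simp)
      also have "?p (Suc i) - ?p i = T / real n"
        by (simp add: diff_divide_distrib[symmetric] algebra_simps)
      finally show "norm (f (?p (Suc i)) - f (?p i)) \<le> K * (T / real n)\<^sup>2" .
    qed
    also have "\<dots> = K * T\<^sup>2 / real n" using n by (simp add: power2_eq_square)
    finally show ?thesis .
  qed
  moreover have "(\<lambda>n. K * T\<^sup>2 / real n) \<longlonglongrightarrow> 0" by (rule lim_const_over_n)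
  ultimately have "norm (f T - f 0) \<le> 0"
    by (intro tendsto_lowerbound[of "\<lambda>n. K * T\<^sup>2 / real n" _ sequentially])
       (auto intro!: eventually_sequentiallyI[of 1])
  then show ?thesis by simp
qed

lemma power_increment_le:
  fixes s t T :: real
  assumes "0 \<le> s" "s \<le> t" "t \<le> T"
  shows "t ^ n - s ^ n \<le> real n * T ^ (n - 1) * (t - s)"
proof (induction n)
  case (Suc n)
  have "t ^ Suc n - s ^ Suc n = t * (t ^ n - s ^ n) + (t - s) * s ^ n" by (simp add: algebra_simps)
  also have "\<dots> \<le> T * (real n * T ^ (n - 1) * (t - s)) + (t - s) * T ^ n"
    using assms Suc by (intro add_mono mult_mono mult_left_mono power_mono) (auto simp: power_mono)
  also have "\<dots> = real (Suc n) * T ^ n * (t - s)" by (cases n) (auto simp: algebra_simps)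
  finally show ?case by simp
qed simp

text \<open>The comparison is strict, as in the indicator of d(v_j, v_i) < d(v_i, v_(i+1)) in
  V_k.\<close>

definition cut :: "('a::metric_space \<Rightarrow> real) \<Rightarrow> 'a \<Rightarrow> real \<Rightarrow> ('a \<Rightarrow> real) \<Rightarrow> 'a \<Rightarrow> real" where
  "cut \<eta> v t m = (\<lambda>x. m x * (if dist x v < t then \<eta> x else 1))"

lemma cut_measurable [measurable (raw)]:
  fixes x v :: "'p \<Rightarrow> 'a::euclidean_space"
  assumes [measurable]: "x \<in> borel_measurable N" "v \<in> borel_measurable N" "t \<in> borel_measurable N"
    "(\<lambda>p. m p (x p)) \<in> borel_measurable N" "(\<lambda>p. \<eta> p (x p)) \<in> borel_measurable N"
  shows "(\<lambda>p. cut (\<eta> p) (v p) (t p) (m p) (x p)) \<in> borel_measurable N"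
  unfolding cut_def by measurable

section \<open>Profiles on a region and the exposure identity\<close>

context boltzmann_factor
begin

text \<open>The class over which bounds are uniform: it contains the indicator of a Borel set
  \<open>B\<close> and is closed under tilting and cutting. For bounded \<open>B\<close> its members
  are integrable with mass at most the volume of \<open>B\<close>; \<open>B = UNIV\<close> is the
  setting of the walk bounds.\<close>

definition profile :: "'a set \<Rightarrow> ('a \<Rightarrow> real) \<Rightarrow> bool" where
  "profile B m \<longleftrightarrow> m \<in> borel_measurable borel \<and> (\<forall>x. 0 \<le> m x \<and> m x \<le> indicator B x)"

lemma profile_measurable: "profile B m \<Longrightarrow> m \<in> borel_measurable borel"
  by (simp add: profile_def)

lemma profile_nonneg: "profile B m \<Longrightarrow> 0 \<le> m x"
  and profile_le: "profile B m \<Longrightarrow> m x \<le> indicator B x"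
  by (simp_all add: profile_def)

lemma profile_le_1: "profile B m \<Longrightarrow> m x \<le> 1"
  using profile_le[of B m x] by (auto simp: indicator_def of_bool_def split: if_splits)

lemma profile_mult:
  assumes m: "profile B m" and [measurable]: "h \<in> borel_measurable borel"
    and h: "\<And>x. 0 \<le> h x" "\<And>x. h x \<le> 1"
  shows "profile B (\<lambda>x. m x * h x)"
  unfolding profile_def
proof (intro conjI allI)
  note [measurable] = profile_measurable[OF m]
  show "(\<lambda>x. m x * h x) \<in> borel_measurable borel" by measurable
  fix x
  show "0 \<le> m x * h x" using profile_nonneg[OF m] h by simp
  show "m x * h x \<le> indicator B x"
    using mult_left_le[OF h(2) profile_nonneg[OF m], of x x] profile_le[OF m, of x] by simp
qed

lemma profile_tilt: "profile B m \<Longrightarrow> profile B (tilt y m)"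
  unfolding tilt_def by (rule profile_mult) auto

lemma profile_cut:
  assumes "profile B m" and [measurable]: "\<eta> \<in> borel_measurable borel"
    and h: "\<And>x. 0 \<le> \<eta> x" "\<And>x. \<eta> x \<le> 1"
  shows "profile B (cut \<eta> v t m)"
  unfolding cut_def
proof (rule profile_mult[OF assms(1)])
  show "(\<lambda>x. if dist x v < t then \<eta> x else 1) \<in> borel_measurable borel" by measurable
qed (use h in auto)

lemma profile_bounded_act:
  assumes B: "B \<in> sets borel" "bounded B" and m: "profile B m"
  shows "act m" "mass m \<le> measure lborel B"
proof -
  have fin: "emeasure lborel B < \<infinity>" using emeasure_bounded_finite[OF B(2)] by simp
  have int: "integrable lborel (indicat_real B)"
    using B fin by (simp add: integrable_indicator_iff)
  have 1: "act (indicat_real B)" by (rule actI[OF int]) simp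
  show 2: "act m"
    by (rule act_bounded[OF 1 profile_measurable[OF m] profile_nonneg[OF m] profile_le[OF m]])
  have "mass m \<le> mass (indicat_real B)" by (rule mass_mono[OF 1 2 profile_le[OF m]])
  also have "\<dots> = measure lborel B" using B by (simp add: mass_def)
  finally show "mass m \<le> measure lborel B" .
qed

lemma cut_antimono:
  assumes "\<And>x. 0 \<le> m x" "\<And>x. 0 \<le> \<eta> x" "\<And>x. \<eta> x \<le> 1" "s \<le> t"
  shows "cut \<eta> v t m x \<le> cut \<eta> v s m x"
proof -
  have "(if dist x v < t then \<eta> x else 1) \<le> (if dist x v < s then \<eta> x else 1)"
    using assms(3)[of x] assms(4) by auto
  then show ?thesis unfolding cut_def using assms(1)[of x] by (intro mult_left_mono) auto
qed

text \<open>Moving a point \<open>v\<close> into the system by switching on its interaction in order of increasing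
  distance from \<open>v\<close>. Along the family \<open>cut \<eta> v t m\<close> the logarithmic derivative of \<open>Z\<close> in \<open>t\<close> is
  an integral over the sphere of radius \<open>t\<close>; instead of differentiating, one checks that
  \<open>Z z (cut \<eta> v t m)\<close> times the exponential of the integral over the ball has quadratic
  increments.\<close>

lemma Z_cut_exp:
  assumes B: "B \<in> sets borel" "bounded B" and m: "profile B m"
    and \<eta>m[measurable]: "\<eta> \<in> borel_measurable borel"
    and \<eta>: "\<And>x. 0 \<le> \<eta> x" "\<And>x. \<eta> x \<le> 1"
    and c: "0 < c" "\<And>t. c \<le> cmod (Z z (cut \<eta> v t m))"
  shows "Z z (\<lambda>x. m x * \<eta> x) = Z z m * exp (- z * (\<integral>x. of_real (m x * (1 - \<eta> x)) *
      (Z z (tilt x (cut \<eta> v (dist x v) m)) / Z z (cut \<eta> v (dist x v) m)) \<partial>lborel))"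
proof -
  define R where "R = (\<lambda>x. Z z (tilt x (cut \<eta> v (dist x v) m)) / Z z (cut \<eta> v (dist x v) m))"
  define V where "V = measure lborel B"
  define A where "A = cmod z"
  define E where "E = exp (A * V)"
  define a where "a = (\<lambda>t x. m x * (1 - \<eta> x) * (if dist x v < t then 1 else 0))"
  define I where "I = (\<lambda>t. z * (\<integral>x. of_real (a t x) * R x \<partial>lborel))"
  define Y where "Y = (\<lambda>t. Z z (cut \<eta> v t m))"
  define H where "H = (\<lambda>t. Y t * exp (I t))"
  note [measurable] = profile_measurable[OF m]
  have V: "0 \<le> V" by (simp add: V_def)
  have E: "0 < E" by (simp add: E_def)
  have A: "0 \<le> A" by (simp add: A_def)
  note [simp] = profile_nonneg[OF m]
  have pc: "profile B (cut \<eta> v t m)" for t by (rule profile_cut[OF m \<eta>m \<eta>])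
  note act_pc = profile_bounded_act[OF B pc]
  have pt: "profile B (tilt x (cut \<eta> v t m))" for x t by (rule profile_tilt[OF pc])
  note act_pt = profile_bounded_act[OF B pt]
  have Rm [measurable]: "R \<in> borel_measurable borel"
    unfolding R_def tilt_def by measurable
  have normZ: "cmod (Z z q) \<le> E" if "profile B q" for q
    using norm_Z_le[OF profile_bounded_act[OF B that]] by (simp add: E_def V_def A_def)
  have Rb: "cmod (R x) \<le> E / c" for x
    unfolding R_def norm_divide
    by (rule frac_le[OF _ normZ[OF pt] c]) (use E in auto)
  have pa: "profile B (a t)" for t
  proof -
    have "profile B (\<lambda>x. m x * ((1 - \<eta> x) * (if dist x v < t then 1 else 0)))"
      by (rule profile_mult[OF m]) (use \<eta> in \<open>auto simp: mult_le_one\<close>)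
    then show ?thesis by (simp add: a_def mult.assoc)
  qed
  note act_a = profile_bounded_act[OF B pa]
  have Ib: "cmod (I t) \<le> A * (V * (E / c))" for t
  proof -
    have "cmod (\<integral>x. of_real (a t x) * R x \<partial>lborel) \<le> mass (a t) * (E / c)"
      by (rule act_cintegral_norm_le[OF act_a(1) Rm Rb])
    also have "\<dots> \<le> V * (E / c)"
      using act_a(2)[of t] E c(1) by (intro mult_right_mono) (auto simp: V_def)
    finally show ?thesis unfolding I_def norm_mult A_def by (intro mult_left_mono) auto
  qed
  \<comment> \<open>Once the radius reaches \<open>T\<close>, all of \<open>B\<close> has been
    exposed and the family has arrived at m \<eta>.\<close>
  obtain T where T: "0 < T" "B \<subseteq> ball v T"
    using B(2) bounded_subset_ballD by blast
  \<comment> \<open>Lipschitz constant of the volume of a ball in its radius up to \<open>T\<close>: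
    the shell between s and t has volume at most L (t - s), which converts squared shell masses into
    (t - s)^2.\<close>
  define L where "L = unit_ball_vol (real DIM('a)) * (real DIM('a) * T ^ (DIM('a) - 1))"
  define J where "J = A * (V * (E / c))"
  \<comment> \<open>The three summands come from \<open>T1\<close> (second-order remainder of the
    exponential), \<open>T2\<close> (radius in \<open>R\<close> replaced by t) and \<open>T3\<close>
    (second-order remainder of \<open>Z\<close>); \<open>exp J\<close> bounds the exponential of
    \<open>I s\<close>.\<close>
  define K where "K = exp J * (E * (exp J * (A * (E / c))\<^sup>2) + A * (A * E * (E / c + 1)) + A\<^sup>2 * E)"
  have K: "0 \<le> K" unfolding K_def using A E c(1) by simp
  have incr: "cmod (H t - H s) \<le> (K * L\<^sup>2) * (t - s)\<^sup>2" if st: "0 \<le> s" "s \<le> t" "t \<le> T" for s t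
  proof -
    define e where "e = (\<lambda>x. cut \<eta> v s m x - cut \<eta> v t m x)"
    define N where "N = (\<lambda>x. Z z (tilt x (cut \<eta> v t m)))"
    have anti: "cut \<eta> v t' m x \<le> cut \<eta> v s' m x" if "s' \<le> t'" for s' t' x
      by (rule cut_antimono) (use \<eta> that in auto)
    have e_alt: "e x = m x * (1 - \<eta> x) * (if s \<le> dist x v \<and> dist x v < t then 1 else 0)" for x
      using st(2) by (auto simp: e_def cut_def algebra_simps)
    have e_diff: "e x = a t x - a s x" for x
      using st(2) by (auto simp: e_alt a_def)
    have acte: "act e"
      unfolding e_def by (rule act_diff[OF act_pc(1) act_pc(1) anti[OF st(2)]])
    note [measurable] = act_measurable[OF acte]
    have Nm [measurable]: "N \<in> borel_measurable borel"
      unfolding N_def tilt_def by measurable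
    have shell: "mass e \<le> L * (t - s)"
    proof -
      have "mass e \<le> mass (\<lambda>x. indicator (ball v t) x - indicator (ball v s) x)"
      proof (rule mass_mono[OF _ acte])
        have i: "integrable lborel (indicat_real (ball v r))" for r
          using emeasure_lborel_ball_finite[of v r] by (simp add: integrable_indicator_iff)
        show "act (\<lambda>x. indicator (ball v t) x - indicator (ball v s) x)"
          using st(2) by (intro actI Bochner_Integration.integrable_diff i) (auto simp: indicator_def)
        show "e x \<le> indicator (ball v t) x - indicator (ball v s) x" for x
          using mult_mono[OF profile_le_1[OF m, of x], of "1 - \<eta> x" 1] \<eta>[of x] st(2)
          by (auto simp: e_alt indicator_def dist_commute)
      qed
      also have "\<dots> = measure lborel (ball v t) - measure lborel (ball v s)"
        unfolding mass_def
        by (subst Bochner_Integration.integral_diff)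
           (use emeasure_lborel_ball_finite[of v] in \<open>auto simp: integrable_indicator_iff\<close>)
      also have "\<dots> = unit_ball_vol (real DIM('a)) * (t ^ DIM('a) - s ^ DIM('a))"
        using st by (simp add: content_ball algebra_simps)
      also have "\<dots> \<le> unit_ball_vol (real DIM('a)) * (real DIM('a) * T ^ (DIM('a) - 1) * (t - s))"
        using power_increment_le[OF st, of "DIM('a)"] by (intro mult_left_mono) auto
      finally show ?thesis by (simp add: L_def mult.assoc)
    qed
    let ?\<mu> = "mass e"
    have \<mu>: "0 \<le> ?\<mu>" using acte by simp
    have massc: "mass (\<lambda>x. cut \<eta> v r m x - cut \<eta> v t m x) \<le> ?\<mu>" if "s \<le> r" "r \<le> t" for r
      unfolding mass_diff[OF act_pc(1) act_pc(1)] e_def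
      using mass_mono[OF act_pc(1) act_pc(1) anti[OF that(1)]] by simp
    have Ylip: "cmod (Y r - Y t) \<le> A * ?\<mu> * E" if r: "s \<le> r" "r \<le> t" for r
    proof -
      have "cmod (Y r - Y t) \<le> A * mass (\<lambda>x. cut \<eta> v r m x - cut \<eta> v t m x) * E"
        unfolding Y_def A_def E_def
        by (rule Z_lipschitz_profile[OF act_pc(1) act_pc(1) anti[OF r(2)] act_pc(2)[folded V_def]])
      also have "\<dots> \<le> A * ?\<mu> * E"
        using massc[OF r] A E by (intro mult_right_mono mult_left_mono) auto
      finally show ?thesis .
    qed
    have Nlip: "cmod (Z z (tilt x (cut \<eta> v r m)) - N x) \<le> A * ?\<mu> * E" if r: "s \<le> r" "r \<le> t" for r x
    proof -
      have "cmod (Z z (tilt x (cut \<eta> v r m)) - N x) \<le>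
          A * mass (\<lambda>y. tilt x (cut \<eta> v r m) y - tilt x (cut \<eta> v t m) y) * E"
        unfolding N_def A_def E_def
        by (rule Z_lipschitz_profile[OF act_pt(1) act_pt(1) tilt_mono[OF anti[OF r(2)]] act_pt(2)[folded V_def]])
      also have "mass (\<lambda>y. tilt x (cut \<eta> v r m) y - tilt x (cut \<eta> v t m) y) \<le>
         mass (\<lambda>x. cut \<eta> v r m x - cut \<eta> v t m x)"
        using mass_tilt_le[OF act_diff[OF act_pc(1) act_pc(1) anti[OF r(2)]]] by (simp add: tilt_diff)
      also note massc[OF r]
      finally show ?thesis using A E by (simp add: mult_left_mono mult_right_mono)
    qed
    have Yb: "cmod (Y r) \<le> E" for r unfolding Y_def by (rule normZ[OF pc])
    define \<Delta> where "\<Delta> = z * (\<integral>x. of_real (e x) * R x \<partial>lborel)"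
    have I_diff: "I t = I s + \<Delta>"
    proof -
      have i: "integrable lborel (\<lambda>x. of_real (a r x) * R x)" for r
        by (rule act_cintegrable[OF act_a(1) Rm Rb])
      have "(\<integral>x. of_real (e x) * R x \<partial>lborel) =
         (\<integral>x. of_real (a t x) * R x - of_real (a s x) * R x \<partial>lborel)"
        by (simp add: e_diff algebra_simps)
      also have "\<dots> = (\<integral>x. of_real (a t x) * R x \<partial>lborel) - (\<integral>x. of_real (a s x) * R x \<partial>lborel)"
        by (rule Bochner_Integration.integral_diff[OF i i])
      finally show ?thesis by (simp add: \<Delta>_def I_def right_diff_distrib)
    qed
    have \<Delta>b: "cmod \<Delta> \<le> A * (?\<mu> * (E / c))"
      unfolding \<Delta>_def norm_mult A_def
      by (rule mult_left_mono[OF act_cintegral_norm_le[OF acte Rm Rb]]) simp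
    have "?\<mu> \<le> V"
    proof -
      have "?\<mu> \<le> mass (cut \<eta> v s m)"
        unfolding e_def mass_diff[OF act_pc(1) act_pc(1)] using mass_nonneg[OF act_pc(1)] by simp
      then show ?thesis using act_pc(2)[of s] by (simp add: V_def)
    qed
    then have \<Delta>J: "cmod \<Delta> \<le> J"
      unfolding J_def using \<Delta>b A E c(1)
      by (elim order_trans) (intro mult_left_mono mult_right_mono, auto)
    have T1: "cmod (exp \<Delta> - 1 - \<Delta>) \<le> exp J * (A * (E / c))\<^sup>2 * ?\<mu>\<^sup>2"
    proof -
      have "cmod (exp \<Delta> - 1 - \<Delta>) \<le> exp (cmod \<Delta>) * (cmod \<Delta>)\<^sup>2"
        using Taylor_exp_field[of \<Delta> 1] by (simp add: algebra_simps power2_eq_square)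
      also have "\<dots> \<le> exp J * (A * (?\<mu> * (E / c)))\<^sup>2"
        using \<Delta>J \<Delta>b by (intro mult_mono power_mono) auto
      also have "\<dots> = exp J * (A * (E / c))\<^sup>2 * ?\<mu>\<^sup>2" by (simp add: power2_eq_square)
      finally show ?thesis .
    qed
    have T2: "cmod (Y t * \<Delta> - z * (\<integral>x. of_real (e x) * N x \<partial>lborel)) \<le> A * (A * E * (E / c + 1)) * ?\<mu>\<^sup>2"
    proof -
      \<comment> \<open>On the shell \<open>R x\<close> is evaluated at the radius
        \<open>dist x v\<close>, which lies between s and t. Moving it to t costs one factor of the
        shell mass; integrating against \<open>e\<close> gives the second.\<close>
      have pw: "cmod (Y t * R x - N x) \<le> A * ?\<mu> * E * (E / c + 1)" if "e x \<noteq> 0" for x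
      proof -
        define r where "r = dist x v"
        have r: "s \<le> r" "r \<le> t" using that by (auto simp: e_alt r_def split: if_splits)
        define P where "P = Z z (tilt x (cut \<eta> v r m))"
        have Yr: "c \<le> cmod (Y r)" unfolding Y_def by (rule c(2))
        then have "Y r \<noteq> 0" using c(1) by auto
        have RP: "R x = P / Y r" by (simp add: R_def P_def Y_def r_def)
        have "Y t * R x - N x = (Y t - Y r) * R x + (P - N x)"
          using \<open>Y r \<noteq> 0\<close> by (simp add: RP divide_simps) (simp add: algebra_simps)
        also have "cmod \<dots> \<le> cmod (Y r - Y t) * cmod (R x) + cmod (P - N x)"
          by (metis norm_triangle_ineq norm_mult norm_minus_commute)
        also have "\<dots> \<le> (A * ?\<mu> * E) * (E / c) + A * ?\<mu> * E"
          unfolding P_def using A \<mu> E by (intro add_mono mult_mono Ylip[OF r] Nlip[OF r] Rb) auto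
        finally show ?thesis by (simp add: algebra_simps)
      qed
      have i1: "integrable lborel (\<lambda>x. of_real (e x) * R x)"
        by (rule act_cintegrable[OF acte Rm Rb])
      have i2: "integrable lborel (\<lambda>x. of_real (e x) * N x)"
        unfolding N_def
        by (rule act_cintegrable[OF acte Nm[unfolded N_def] normZ[OF pt]])
      have "Y t * \<Delta> - z * (\<integral>x. of_real (e x) * N x \<partial>lborel) =
         z * ((\<integral>x. Y t * (of_real (e x) * R x) \<partial>lborel) - (\<integral>x. of_real (e x) * N x \<partial>lborel))"
        unfolding integral_mult_right_zero \<Delta>_def
        by (simp only: right_diff_distrib mult.left_commute)
      also have "\<dots> = z * (\<integral>x. Y t * (of_real (e x) * R x) - of_real (e x) * N x \<partial>lborel)"
        by (subst Bochner_Integration.integral_diff[OF _ i2]) (use i1 in auto)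
      also have "\<dots> = z * (\<integral>x. of_real (e x) * (Y t * R x - N x) \<partial>lborel)"
        by (simp add: algebra_simps)
      finally have "cmod (Y t * \<Delta> - z * (\<integral>x. of_real (e x) * N x \<partial>lborel)) =
         A * cmod (\<integral>x. of_real (e x) * (Y t * R x - N x) \<partial>lborel)"
        by (simp add: norm_mult A_def)
      also have "\<dots> \<le> A * (?\<mu> * (A * ?\<mu> * E * (E / c + 1)))"
        by (rule mult_left_mono[OF act_cintegral_norm_le[OF acte _ pw] A]) auto
      finally show ?thesis by (simp add: power2_eq_square mult_ac)
    qed
    have T3: "cmod (Y s - Y t - z * (\<integral>x. of_real (e x) * N x \<partial>lborel)) \<le> A\<^sup>2 * E * ?\<mu>\<^sup>2"
      using Z_quadratic[OF act_pc(1) act_pc(1) anti[OF st(2)] act_pc(2)[folded V_def], of z]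
      by (simp add: Y_def N_def e_def A_def E_def power_mult_distrib mult_ac)
    have "H t - H s = exp (I s) * (Y t * (exp \<Delta> - 1 - \<Delta>)
        + (Y t * \<Delta> - z * (\<integral>x. of_real (e x) * N x \<partial>lborel))
        - (Y s - Y t - z * (\<integral>x. of_real (e x) * N x \<partial>lborel)))"
      by (simp add: H_def I_diff exp_add algebra_simps)
    moreover have "cmod (w * (p * q + r - u)) \<le> cmod w * (cmod p * cmod q + cmod r + cmod u)" for w p q r u
      unfolding norm_mult
      using norm_triangle_ineq4[of "p * q + r" u] norm_triangle_ineq[of "p * q" r]
      by (intro mult_left_mono) (auto simp: norm_mult)
    ultimately have "cmod (H t - H s) \<le> cmod (exp (I s)) * (cmod (Y t) * cmod (exp \<Delta> - 1 - \<Delta>)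
        + cmod (Y t * \<Delta> - z * (\<integral>x. of_real (e x) * N x \<partial>lborel))
        + cmod (Y s - Y t - z * (\<integral>x. of_real (e x) * N x \<partial>lborel)))"
      by (simp only:)
    also have "\<dots> \<le> exp J * (E * (exp J * (A * (E / c))\<^sup>2 * ?\<mu>\<^sup>2)
        + A * (A * E * (E / c + 1)) * ?\<mu>\<^sup>2 + A\<^sup>2 * E * ?\<mu>\<^sup>2)"
    proof (intro mult_mono add_mono T1 T2 T3 Yb)
      show "cmod (exp (I s)) \<le> exp J"
        using Ib[of s] abs_Re_le_cmod[of "I s"] by (simp add: norm_exp_eq_Re J_def)
    qed (use E in auto)
    also have "\<dots> = K * ?\<mu>\<^sup>2" by (simp add: K_def algebra_simps)
    also have "\<dots> \<le> K * (L * (t - s))\<^sup>2"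
      using shell \<mu> K by (intro mult_left_mono power_mono) auto
    finally show ?thesis by (simp add: power_mult_distrib mult_ac)
  qed
  have "H T = H 0"
    by (rule quadratic_increments_imp_constant[OF _ incr]) (use T in auto)
  moreover have "a 0 = (\<lambda>x. 0)" by (auto simp: a_def)
  then have "H 0 = Z z m" by (simp add: H_def Y_def I_def cut_def)
  moreover have "H T = Z z (\<lambda>x. m x * \<eta> x) * exp (z * (\<integral>x. of_real (m x * (1 - \<eta> x)) * R x \<partial>lborel))"
  proof -
    have m0: "m x = 0" if "\<not> dist x v < T" for x
    proof -
      have "x \<notin> B" using that T(2) by (auto simp: dist_commute)
      then show ?thesis using profile_le[OF m, of x] profile_nonneg[OF m, of x] by simp
    qed
    have "cut \<eta> v T m = (\<lambda>x. m x * \<eta> x)"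
      by (auto simp: cut_def fun_eq_iff m0)
    moreover have "a T = (\<lambda>x. m x * (1 - \<eta> x))"
      by (auto simp: a_def fun_eq_iff m0)
    ultimately show ?thesis by (simp add: H_def Y_def I_def)
  qed
  ultimately have "Z z (\<lambda>x. m x * \<eta> x) * exp (z * (\<integral>x. of_real (m x * (1 - \<eta> x)) * R x \<partial>lborel)) = Z z m"
    by simp
  then show ?thesis
    by (simp add: R_def exp_minus field_simps)
qed

section \<open>The recursion for ratios of partition functions\<close>

text \<open>The Lipschitz bound, uniform in x, dominates the difference quotients by the integrable
  function a L.\<close>

lemma has_field_derivative_act_integral:
  fixes f :: "complex \<Rightarrow> 'a \<Rightarrow> complex"
  assumes a: "act a" and r: "0 < r"
    and [measurable]: "\<And>z. f z \<in> borel_measurable borel" "f' \<in> borel_measurable borel"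
    and der: "\<And>x. ((\<lambda>z. f z x) has_field_derivative f' x) (at z0)"
    and bd: "\<And>z x. z \<in> ball z0 r \<Longrightarrow> cmod (f z x) \<le> M"
    and lip: "\<And>z x. z \<in> ball z0 r \<Longrightarrow> cmod (f z x - f z0 x) \<le> L * cmod (z - z0)"
  shows "((\<lambda>z. \<integral>x. of_real (a x) * f z x \<partial>lborel) has_field_derivative
      (\<integral>x. of_real (a x) * f' x \<partial>lborel)) (at z0)"
proof -
  note [measurable] = act_measurable[OF a]
  let ?F = "\<lambda>z. \<integral>x. of_real (a x) * f z x \<partial>lborel"
  have int: "integrable lborel (\<lambda>x. of_real (a x) * f z x)" if "z \<in> ball z0 r" for z
    by (rule act_cintegrable[OF a _ bd[OF that]]) measurable
  have z0: "z0 \<in> ball z0 r" using r by simp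
  have "((\<lambda>z. (?F z - ?F z0) / (z - z0)) \<longlongrightarrow> (\<integral>x. of_real (a x) * f' x \<partial>lborel)) (at z0 within ball z0 r)"
  proof (subst tendsto_at_iff_sequentially, intro allI impI)
    fix X assume X: "\<forall>i. X i \<in> ball z0 r - {z0}" and lim: "X \<longlonglongrightarrow> z0"
    let ?s = "\<lambda>i x. of_real (a x) * ((f (X i) x - f z0 x) / (X i - z0))"
    have "(\<lambda>i. \<integral>x. ?s i x \<partial>lborel) \<longlonglongrightarrow> (\<integral>x. of_real (a x) * f' x \<partial>lborel)"
    proof (rule integral_dominated_convergence)
      show "integrable lborel (\<lambda>x. a x * L)" using a by simp
      show "AE x in lborel. (\<lambda>i. ?s i x) \<longlonglongrightarrow> of_real (a x) * f' x"
      proof (rule AE_I2, rule tendsto_mult_left)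
        fix x
        have "((\<lambda>z. (f z x - f z0 x) / (z - z0)) \<longlongrightarrow> f' x) (at z0)"
          using der[of x] by (simp add: has_field_derivative_iff)
        from this[unfolded tendsto_at_iff_sequentially, rule_format, of X]
        show "(\<lambda>i. (f (X i) x - f z0 x) / (X i - z0)) \<longlonglongrightarrow> f' x"
          using X lim by (simp add: comp_def)
      qed
      show "AE x in lborel. norm (?s i x) \<le> a x * L" for i
      proof (rule AE_I2)
        fix x
        have "X i \<in> ball z0 r" "X i - z0 \<noteq> 0" using X by auto
        then have "cmod ((f (X i) x - f z0 x) / (X i - z0)) \<le> L"
          using lip[of "X i" x] by (simp add: norm_divide divide_le_eq)
        from mult_left_mono[OF this act_nonneg[OF a, of x]]
        show "norm (?s i x) \<le> a x * L"
          using act_nonneg[OF a, of x] by (simp only: norm_mult norm_of_real abs_of_nonneg)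
      qed
    qed measurable
    moreover have "(\<integral>x. ?s i x \<partial>lborel) = (?F (X i) - ?F z0) / (X i - z0)" for i
    proof -
      have "X i \<in> ball z0 r" using X by auto
      then have "?F (X i) - ?F z0 = (\<integral>x. of_real (a x) * f (X i) x - of_real (a x) * f z0 x \<partial>lborel)"
        by (intro Bochner_Integration.integral_diff[symmetric] int z0)
      also have "\<dots> / (X i - z0) = (\<integral>x. (of_real (a x) * f (X i) x - of_real (a x) * f z0 x) / (X i - z0) \<partial>lborel)"
        by simp
      finally have "(?F (X i) - ?F z0) / (X i - z0) =
        (\<integral>x. (of_real (a x) * f (X i) x - of_real (a x) * f z0 x) / (X i - z0) \<partial>lborel)" .
      then show ?thesis by (simp only: right_diff_distrib times_divide_eq_right)
    qed
    ultimately show "((\<lambda>z. (?F z - ?F z0) / (z - z0)) \<circ> X) \<longlonglongrightarrow> (\<integral>x. of_real (a x) * f' x \<partial>lborel)"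
      by (simp only: comp_def)
  qed
  then have "(?F has_field_derivative (\<integral>x. of_real (a x) * f' x \<partial>lborel)) (at z0 within ball z0 r)"
    by (simp add: has_field_derivative_iff)
  then show ?thesis using at_within_open[OF z0 open_ball] by simp
qed

text \<open>\<open>after v w m\<close> is the profile seen by \<open>w\<close> once the points closer to \<open>v\<close> than \<open>w\<close> have
  been exposed to \<open>v\<close>.\<close>

definition after :: "'a \<Rightarrow> 'a \<Rightarrow> ('a \<Rightarrow> real) \<Rightarrow> 'a \<Rightarrow> real" where
  "after v w m = cut (\<lambda>x. b x v) v (dist w v) m"

definition ratio :: "complex \<Rightarrow> 'a \<Rightarrow> ('a \<Rightarrow> real) \<Rightarrow> complex" where
  "ratio z v m = Z z (tilt v m) / Z z m"

text \<open>Minus the Mayer function, weighted by the profile: the density of one step of the walk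
  out of \<open>v\<close>.\<close>

definition nbr :: "'a \<Rightarrow> ('a \<Rightarrow> real) \<Rightarrow> 'a \<Rightarrow> real" where
  "nbr v m = (\<lambda>x. m x * (1 - b x v))"

text \<open>A logarithm of 1/ratio given by an explicit integral instead of a branch;
  \<open>ratio_eq_exp\<close> justifies this on zero-free regions.\<close>

definition u :: "complex \<Rightarrow> 'a \<Rightarrow> ('a \<Rightarrow> real) \<Rightarrow> complex" where
  "u z v m = z * (\<integral>x. of_real (nbr v m x) * ratio z x (after v x m) \<partial>lborel)"

text \<open>The logarithmic derivative in z of 1/ratio, hence the derivative of \<open>u\<close>. As
  an explicit quotient it is measurable in its parameters and bounded directly by bounds on
  \<open>Z'\<close> and on 1/Z.\<close>

definition du :: "complex \<Rightarrow> 'a \<Rightarrow> ('a \<Rightarrow> real) \<Rightarrow> complex" where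
  "du z v m = Z' z m / Z z m - Z' z (tilt v m) / Z z (tilt v m)"

lemma after_measurable [measurable (raw)]:
  assumes [measurable]: "x \<in> borel_measurable N" "v \<in> borel_measurable N" "w \<in> borel_measurable N"
    "(\<lambda>p. m p (x p)) \<in> borel_measurable N"
  shows "(\<lambda>p. after (v p) (w p) (m p) (x p)) \<in> borel_measurable N"
  unfolding after_def by measurable

lemma tilt_measurable [measurable (raw)]:
  assumes [measurable]: "x \<in> borel_measurable N" "v \<in> borel_measurable N"
    "(\<lambda>p. m p (x p)) \<in> borel_measurable N"
  shows "(\<lambda>p. tilt (v p) (m p) (x p)) \<in> borel_measurable N"
  unfolding tilt_def by measurable

lemma nbr_measurable [measurable (raw)]:
  assumes [measurable]: "x \<in> borel_measurable N" "v \<in> borel_measurable N"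
    "(\<lambda>p. m p (x p)) \<in> borel_measurable N"
  shows "(\<lambda>p. nbr (v p) (m p) (x p)) \<in> borel_measurable N"
  unfolding nbr_def by measurable

lemma ratio_measurable [measurable (raw)]:
  assumes [measurable]: "v \<in> borel_measurable N" "case_prod m \<in> borel_measurable (N \<Otimes>\<^sub>M borel)"
  shows "(\<lambda>p. ratio z (v p) (m p)) \<in> borel_measurable N"
  unfolding ratio_def tilt_def by measurable

lemma du_measurable [measurable (raw)]:
  assumes [measurable]: "v \<in> borel_measurable N" "case_prod m \<in> borel_measurable (N \<Otimes>\<^sub>M borel)"
  shows "(\<lambda>p. du z (v p) (m p)) \<in> borel_measurable N"
  unfolding du_def tilt_def by measurable

lemma profile_after: "profile B m \<Longrightarrow> profile B (after v w m)"
  unfolding after_def by (rule profile_cut) auto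

lemma profile_nbr: "profile B m \<Longrightarrow> profile B (nbr v m)"
  unfolding nbr_def by (rule profile_mult) auto

end

section \<open>The recursion on a region where partition functions stay away from zero\<close>

locale bounded_region = boltzmann_factor b for b :: "'a::euclidean_space \<Rightarrow> 'a \<Rightarrow> real" +
  fixes B :: "'a set"
  assumes B_borel: "B \<in> sets borel" and B_bounded: "bounded B"
begin

abbreviation "prof \<equiv> profile B"

definition V :: real where "V = measure lborel B"

lemma V_nonneg [simp]: "0 \<le> V" by (simp add: V_def)

lemma act_prof: "prof m \<Longrightarrow> act m"
  and mass_prof: "prof m \<Longrightarrow> mass m \<le> V"
  using profile_bounded_act[OF B_borel B_bounded] by (auto simp: V_def)

text \<open>All profiles are included because \<open>u\<close> at one profile involves ratios at all
  its partial exposures, and so on recursively.\<close>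

definition lower :: "complex \<Rightarrow> real \<Rightarrow> bool" where
  "lower z c \<longleftrightarrow> (\<forall>m. prof m \<longrightarrow> c \<le> cmod (Z z m))"

lemma lowerD: "lower z c \<Longrightarrow> prof m \<Longrightarrow> c \<le> cmod (Z z m)"
  by (simp add: lower_def)

lemma Z_nonzero: "lower z c \<Longrightarrow> 0 < c \<Longrightarrow> prof m \<Longrightarrow> Z z m \<noteq> 0"
  using lowerD[of z c m] by auto

lemma Z_tilt_eq:
  assumes "lower z c" "0 < c" "prof m"
  shows "Z z (tilt v m) = Z z m * exp (- u z v m)"
proof -
  have "Z z (\<lambda>x. m x * b x v) = Z z m * exp (- z * (\<integral>x. of_real (m x * (1 - b x v)) *
      (Z z (tilt x (cut (\<lambda>x. b x v) v (dist x v) m)) / Z z (cut (\<lambda>x. b x v) v (dist x v) m)) \<partial>lborel))"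
  proof (rule Z_cut_exp[OF B_borel B_bounded assms(3) _ _ _ assms(2)])
    show "c \<le> cmod (Z z (cut (\<lambda>x. b x v) v t m))" for t
      by (rule lowerD[OF assms(1)]) (rule profile_cut, use assms in auto)
  qed auto
  then show ?thesis by (simp add: u_def nbr_def ratio_def after_def tilt_def)
qed

lemma ratio_eq_exp:
  assumes "lower z c" "0 < c" "prof m"
  shows "ratio z v m = exp (- u z v m)"
  using Z_tilt_eq[OF assms] Z_nonzero[OF assms] by (simp add: ratio_def)

text \<open>Cutting with \<open>\<eta> = 0\<close> removes all particles, so that \<open>1 / Z\<close> is an exponential of densities.\<close>

lemma Z_lower_bound:
  assumes "lower z c" "0 < c" and M: "\<And>m v. prof m \<Longrightarrow> cmod (ratio z v m) \<le> M" and m: "prof m"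
  shows "exp (- cmod z * V * M) \<le> cmod (Z z m)"
proof -
  let ?q = "\<lambda>x. cut (\<lambda>x. 0) 0 (dist x 0) m"
  let ?I = "\<integral>x. of_real (m x) * ratio z x (?q x) \<partial>lborel"
  note [measurable] = profile_measurable[OF m]
  have q: "prof (cut (\<lambda>x. 0) 0 t m)" for t by (rule profile_cut[OF m]) auto
  have "0 \<le> M" using M[OF m, of 0] norm_ge_zero order_trans by blast
  have "Z z (\<lambda>x. m x * 0) = Z z m * exp (- z * (\<integral>x. of_real (m x * (1 - 0)) *
      (Z z (tilt x (?q x)) / Z z (?q x)) \<partial>lborel))"
    by (rule Z_cut_exp[OF B_borel B_bounded m _ _ _ assms(2) lowerD[OF assms(1) q]]) auto
  then have "1 = Z z m * exp (- z * ?I)" by (simp add: ratio_def)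
  then have "Z z m = exp (z * ?I)" by (simp add: exp_minus field_simps)
  moreover have "cmod ?I \<le> V * M"
  proof -
    have "cmod ?I \<le> mass m * M"
      by (rule act_cintegral_norm_le[OF act_prof[OF m] _ M[OF q]]) measurable
    also have "\<dots> \<le> V * M" using mass_prof[OF m] \<open>0 \<le> M\<close> by (rule mult_right_mono)
    finally show ?thesis .
  qed
  then have "cmod (z * ?I) \<le> cmod z * (V * M)" by (simp add: norm_mult mult_left_mono)
  then have "- (cmod z * V * M) \<le> Re (z * ?I)"
    using abs_Re_le_cmod[of "z * ?I"] by linarith
  ultimately show ?thesis by (simp add: norm_exp_eq_Re)
qed

lemma norm_Z_prof_le: "prof m \<Longrightarrow> cmod z \<le> \<rho> \<Longrightarrow> cmod (Z z m) \<le> exp (\<rho> * V)"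
  using norm_Z_le[OF act_prof mass_prof, of m z] mult_right_mono[of "cmod z" \<rho> V]
  by (meson exp_le_cancel_iff order_trans V_nonneg)

lemma norm_ratio_le:
  assumes "lower z c" "0 < c" "prof m" "cmod z \<le> \<rho>"
  shows "cmod (ratio z v m) \<le> exp (\<rho> * V) / c"
  unfolding ratio_def norm_divide
  by (rule frac_le[OF _ norm_Z_prof_le[OF profile_tilt]]) (use assms lowerD in auto)

lemma norm_du_le:
  assumes "lower z c" "0 < c" "prof m" "cmod z \<le> \<rho>"
  shows "cmod (du z v m) \<le> 2 * (V * exp (\<rho> * V) / c)"
proof -
  have 1: "cmod (Z' z q / Z z q) \<le> V * exp (\<rho> * V) / c" if q: "prof q" for q
  proof -
    have "cmod (Z' z q) \<le> V * exp (cmod z * V)" by (rule norm_Z'_le[OF act_prof[OF q] mass_prof[OF q]])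
    also have "\<dots> \<le> V * exp (\<rho> * V)" using assms(4) by (simp add: mult_left_mono mult_right_mono)
    finally show ?thesis
      unfolding norm_divide using lowerD[OF assms(1) q] assms(2) by (intro frac_le) auto
  qed
  show ?thesis
    unfolding du_def using norm_triangle_ineq4[of "Z' z m / Z z m" "Z' z (tilt v m) / Z z (tilt v m)"]
      1[OF assms(3)] 1[OF profile_tilt[OF assms(3)], of v] by linarith
qed

lemma Z_prof_lipschitz:
  assumes "prof m" "cmod z \<le> \<rho>" "cmod w \<le> \<rho>"
  shows "cmod (Z z m - Z w m) \<le> V * exp (\<rho> * V) * cmod (z - w)"
  by (rule Z_lipschitz_activity[OF act_prof[OF assms(1)] mass_prof[OF assms(1)] assms(2,3)])

lemma ratio_has_field_derivative:
  assumes "lower z c" "0 < c" "prof m"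
  shows "((\<lambda>z. ratio z v m) has_field_derivative (- ratio z v m * du z v m)) (at z)"
proof -
  have t: "prof (tilt v m)" by (rule profile_tilt[OF assms(3)])
  note nz = Z_nonzero[OF assms] Z_nonzero[OF assms(1,2) t]
  have "((\<lambda>z. Z z (tilt v m) / Z z m) has_field_derivative
      (Z' z (tilt v m) * Z z m - Z z (tilt v m) * Z' z m) / (Z z m * Z z m)) (at z)"
    by (rule DERIV_divide Z_has_field_derivative act_prof t assms nz)+
  moreover have "(Z' z (tilt v m) * Z z m - Z z (tilt v m) * Z' z m) / (Z z m * Z z m) =
      - ratio z v m * du z v m"
    using nz by (simp add: ratio_def du_def divide_simps)
  ultimately show ?thesis by (simp add: ratio_def)
qed

text \<open>The integral for \<open>u\<close> is differentiated under the integral sign.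
  Differentiating exp(-u) = ratio on the disc gives a second expression for the same derivative, and
  uniqueness identifies it with \<open>du\<close>. The integral form is the linear recursion that is
  iterated later.\<close>

lemma u_has_field_derivative:
  assumes r: "0 < r" and c: "0 < c" and low: "\<And>w. w \<in> ball z r \<Longrightarrow> lower w c" and m: "prof m"
  shows "((\<lambda>w. u w v m) has_field_derivative du z v m) (at z)"
    and "du z v m = (\<integral>x. of_real (nbr v m x) *
       (ratio z x (after v x m) * (1 - z * du z x (after v x m))) \<partial>lborel)"
proof -
  define \<rho> where "\<rho> = cmod z + r"
  have \<rho>: "cmod w \<le> \<rho>" if "w \<in> ball z r" for w
    using that norm_triangle_ineq2[of w z] by (simp add: \<rho>_def dist_norm norm_minus_commute)
  have z: "z \<in> ball z r" using r by simp
  note [measurable] = profile_measurable[OF m]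
  note pa = profile_after[OF m, of v]
  let ?a = "nbr v m"
  have a: "act ?a" by (rule act_prof[OF profile_nbr[OF m]])
  note [measurable] = act_measurable[OF a]
  let ?f = "\<lambda>z x. ratio z x (after v x m)"
  let ?f' = "\<lambda>x. - ratio z x (after v x m) * du z x (after v x m)"
  let ?F = "\<lambda>z. \<integral>x. of_real (?a x) * ?f z x \<partial>lborel"
  let ?F' = "\<integral>x. of_real (?a x) * ?f' x \<partial>lborel"
  let ?K = "exp (\<rho> * V) / c * (2 * (V * exp (\<rho> * V) / c))"
  have prod_bound: "cmod (- ratio w x (after v x m) * du w x (after v x m)) \<le> ?K" if w: "w \<in> ball z r" for w x
    unfolding norm_mult norm_minus_cancel
    using norm_ratio_le[OF low[OF w] c pa \<rho>[OF w]] norm_du_le[OF low[OF w] c pa \<rho>[OF w]] c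
    by (intro mult_mono) auto
  have derF: "(?F has_field_derivative ?F') (at z)"
  proof (rule has_field_derivative_act_integral[OF a r])
    show "((\<lambda>z. ?f z x) has_field_derivative ?f' x) (at z)" for x
      by (rule ratio_has_field_derivative[OF low[OF z] c pa])
    show "cmod (?f w x) \<le> exp (\<rho> * V) / c" if "w \<in> ball z r" for w x
      by (rule norm_ratio_le[OF low[OF that] c pa \<rho>[OF that]])
    show "cmod (?f w x - ?f z x) \<le> ?K * cmod (w - z)" if w: "w \<in> ball z r" for w x
    proof (rule field_differentiable_bound[OF convex_ball _ _ w z])
      fix w assume w: "w \<in> ball z r"
      show "((\<lambda>z. ?f z x) has_field_derivative (- ratio w x (after v x m) * du w x (after v x m))) (at w within ball z r)"
        by (rule has_field_derivative_at_within[OF ratio_has_field_derivative[OF low[OF w] c pa]])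
      show "cmod (- ratio w x (after v x m) * du w x (after v x m)) \<le> ?K" by (rule prod_bound[OF w])
    qed
  qed measurable
  have deru: "((\<lambda>w. u w v m) has_field_derivative (?F z + ?F' * z)) (at z)"
    unfolding u_def using DERIV_mult[OF DERIV_ident derF] by (simp add: mult_ac)
  have "((\<lambda>w. exp (- u w v m)) has_field_derivative (exp (- u z v m) * - (?F z + ?F' * z))) (at z)"
    by (rule DERIV_chain2[OF DERIV_exp DERIV_minus[OF deru]])
  moreover have "((\<lambda>w. exp (- u w v m)) has_field_derivative (- ratio z v m * du z v m)) (at z)"
  proof (rule has_field_derivative_transform_within_open[OF ratio_has_field_derivative[OF low[OF z] c m] open_ball z])
    show "ratio w v m = exp (- u w v m)" if "w \<in> ball z r" for w
      by (rule ratio_eq_exp[OF low[OF that] c m])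
  qed
  ultimately have e1: "exp (- u z v m) * - (?F z + ?F' * z) = - exp (- u z v m) * du z v m"
    unfolding ratio_eq_exp[OF low[OF z] c m, symmetric] by (rule DERIV_unique)
  have aux: "X = Y" if "exp w * - X = - exp w * Y" for w X Y :: complex
    using that by simp
  have eq: "?F z + ?F' * z = du z v m" by (rule aux[OF e1])
  from deru eq show "((\<lambda>w. u w v m) has_field_derivative du z v m) (at z)" by simp
  have i1: "integrable lborel (\<lambda>x. of_real (?a x) * ?f z x)"
    by (rule act_cintegrable[OF a _ norm_ratio_le[OF low[OF z] c pa \<rho>[OF z]]]) measurable
  have i2: "integrable lborel (\<lambda>x. of_real (?a x) * ?f' x)"
    by (rule act_cintegrable[OF a _ prod_bound[OF z]]) measurable
  have "?F z + ?F' * z = (\<integral>x. of_real (?a x) * ?f z x + of_real (?a x) * ?f' x * z \<partial>lborel)"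
    using i1 i2 by (subst Bochner_Integration.integral_add) auto
  also have "\<dots> = (\<integral>x. of_real (?a x) * (?f z x * (1 - z * du z x (after v x m))) \<partial>lborel)"
    by (simp add: algebra_simps)
  finally show "du z v m = (\<integral>x. of_real (?a x) * (?f z x * (1 - z * du z x (after v x m))) \<partial>lborel)"
    unfolding eq .
qed

end

section \<open>Walks\<close>

context boltzmann_factor
begin

text \<open>The iterated kernel \<open>nbr\<close>, with the profile updated by \<open>after\<close>
  at each step. For the profile 1 it is the integral in V_k started at \<open>v\<close>.\<close>

primrec walk :: "nat \<Rightarrow> 'a \<Rightarrow> ('a \<Rightarrow> real) \<Rightarrow> ennreal" where
  "walk 0 v m = 1"
| "walk (Suc k) v m = (\<integral>\<^sup>+w. ennreal (nbr v m w) * walk k w (after v w m) \<partial>lborel)"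

definition exposure :: "'a \<Rightarrow> 'a \<Rightarrow> 'a \<Rightarrow> real" where
  "exposure v w x = (if dist x v < dist w v then b x v else 1)"

lemma after_eq: "after v w m x = m x * exposure v w x"
  by (simp add: after_def cut_def exposure_def)

lemma exposure_nonneg [simp]: "0 \<le> exposure v w x"
  by (simp add: exposure_def)

lemma exposure_measurable [measurable (raw)]:
  assumes [measurable]: "v \<in> borel_measurable N" "w \<in> borel_measurable N" "x \<in> borel_measurable N"
  shows "(\<lambda>p. exposure (v p) (w p) (x p)) \<in> borel_measurable N"
  unfolding exposure_def by measurable

text \<open>The closed form of \<open>walk\<close>: position j has been exposed to all earlier
  positions except its predecessor, which enters through 1 - b.\<close>

definition walk_integrand :: "nat \<Rightarrow> nat \<Rightarrow> (nat \<Rightarrow> 'a) \<Rightarrow> ('a \<Rightarrow> real) \<Rightarrow> ennreal" where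
  "walk_integrand n k x m = (\<Prod>j\<in>{Suc n..n + k}. ennreal (m (x j) *
      (\<Prod>i\<in>{n..<j - 1}. exposure (x i) (x (Suc i)) (x j)) * (1 - b (x j) (x (j - 1)))))"

lemma walk_integrand_Suc:
  assumes "\<And>x. 0 \<le> m x"
  shows "walk_integrand n (Suc k) x m =
    ennreal (nbr (x n) m (x (Suc n))) * walk_integrand (Suc n) k x (after (x n) (x (Suc n)) m)"
proof -
  have "{Suc n..n + Suc k} = insert (Suc n) {Suc (Suc n)..Suc n + k}" by auto
  then have "walk_integrand n (Suc k) x m = ennreal (nbr (x n) m (x (Suc n))) *
      (\<Prod>j\<in>{Suc (Suc n)..Suc n + k}. ennreal (m (x j) *
      (\<Prod>i\<in>{n..<j - 1}. exposure (x i) (x (Suc i)) (x j)) * (1 - b (x j) (x (j - 1)))))"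
    by (simp add: walk_integrand_def nbr_def)
  also have "(\<Prod>j\<in>{Suc (Suc n)..Suc n + k}. ennreal (m (x j) *
      (\<Prod>i\<in>{n..<j - 1}. exposure (x i) (x (Suc i)) (x j)) * (1 - b (x j) (x (j - 1))))) =
      walk_integrand (Suc n) k x (after (x n) (x (Suc n)) m)"
    unfolding walk_integrand_def
  proof (intro prod.cong refl)
    fix j assume "j \<in> {Suc (Suc n)..Suc n + k}"
    then have "{n..<j - 1} = insert n {Suc n..<j - 1}" by auto
    then show "ennreal (m (x j) *
      (\<Prod>i\<in>{n..<j - 1}. exposure (x i) (x (Suc i)) (x j)) * (1 - b (x j) (x (j - 1)))) =
      ennreal (after (x n) (x (Suc n)) m (x j) *
      (\<Prod>i\<in>{Suc n..<j - 1}. exposure (x i) (x (Suc i)) (x j)) * (1 - b (x j) (x (j - 1))))"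
      by (simp add: after_eq mult_ac)
  qed
  finally show ?thesis .
qed

lemma walk_integrand_measurable:
  assumes X: "\<And>i. i \<in> {n..n + k} \<Longrightarrow> (\<lambda>p. X p i) \<in> borel_measurable N"
    and m: "\<And>j. j \<in> {Suc n..n + k} \<Longrightarrow> (\<lambda>p. m p (X p j)) \<in> borel_measurable N"
  shows "(\<lambda>p. walk_integrand n k (X p) (m p)) \<in> borel_measurable N"
  unfolding walk_integrand_def
proof (rule borel_measurable_prod_ennreal)
  fix j assume j: "j \<in> {Suc n..n + k}"
  have [measurable]: "(\<lambda>p. X p j) \<in> borel_measurable N" "(\<lambda>p. X p (j - 1)) \<in> borel_measurable N"
    using j by (auto intro!: X)
  have [measurable]: "(\<lambda>p. m p (X p j)) \<in> borel_measurable N" by (rule m[OF j])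
  have [measurable]: "(\<lambda>p. \<Prod>i\<in>{n..<j - 1}. exposure (X p i) (X p (Suc i)) (X p j)) \<in> borel_measurable N"
  proof (rule borel_measurable_prod)
    fix i assume i: "i \<in> {n..<j - 1}"
    have [measurable]: "(\<lambda>p. X p i) \<in> borel_measurable N" "(\<lambda>p. X p (Suc i)) \<in> borel_measurable N"
      using i j by (auto intro!: X)
    show "(\<lambda>p. exposure (X p i) (X p (Suc i)) (X p j)) \<in> borel_measurable N" by measurable
  qed
  show "(\<lambda>p. ennreal (m p (X p j) * (\<Prod>i\<in>{n..<j - 1}. exposure (X p i) (X p (Suc i)) (X p j)) *
      (1 - b (X p j) (X p (j - 1))))) \<in> borel_measurable N"
    by measurable
qed

lemma fun_upd_component_measurable:
  assumes [measurable]: "X \<in> N \<rightarrow>\<^sub>M Pi\<^sub>M J (\<lambda>_. lborel)" "v \<in> borel_measurable N" and "i \<in> insert n J"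
  shows "(\<lambda>p. ((X p)(n := v p)) i) \<in> borel_measurable N"
proof (cases "i = n")
  case False
  then have "(\<lambda>x. x i) \<in> Pi\<^sub>M J (\<lambda>_. lborel) \<rightarrow>\<^sub>M lborel"
    using assms(3) by (intro measurable_component_singleton) simp
  from measurable_compose[OF assms(1) this] show ?thesis using False by simp
qed simp

text \<open>Positions are numbered from an arbitrary \<open>n\<close>, so that the induction can split off the first
  step without renumbering the others.\<close>

lemma walk_eq_nn_integral:
  assumes "m \<in> borel_measurable borel" "\<And>x. 0 \<le> m x"
  shows "walk k v m = (\<integral>\<^sup>+x. walk_integrand n k (x(n := v)) m \<partial>Pi\<^sub>M {Suc n..n + k} (\<lambda>_. lborel))"
  using assms
proof (induction k arbitrary: n v m)
  case 0
  then show ?case by (simp add: walk_integrand_def PiM_empty)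
next
  case (Suc k)
  interpret product_sigma_finite "\<lambda>_::nat. lborel :: 'a measure" by (rule lborel_product_sigma_finite)
  note [measurable] = Suc.prems(1)
  let ?J = "{Suc (Suc n)..Suc n + k}"
  have J: "{Suc n..n + Suc k} = insert (Suc n) ?J" by auto
  let ?M = "Pi\<^sub>M ?J (\<lambda>_. lborel :: 'a measure)" and ?N = "Pi\<^sub>M (insert (Suc n) ?J) (\<lambda>_. lborel :: 'a measure)"
  have comp: "(\<lambda>x. (x(n := v)) i) \<in> borel_measurable ?N"
    if "i \<in> {n..n + Suc k}" for i
    using that by (intro fun_upd_component_measurable[where J="insert (Suc n) ?J"]) auto
  have mI: "(\<lambda>x. walk_integrand n (Suc k) (x(n := v)) m) \<in> borel_measurable ?N"
  proof (rule walk_integrand_measurable)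
    fix j assume "j \<in> {Suc n..n + Suc k}"
    then have j: "j \<in> {n..n + Suc k}" by simp
    show "(\<lambda>x. m ((x(n := v)) j)) \<in> borel_measurable ?N"
      by (rule measurable_compose[OF comp[OF j] Suc.prems(1)])
  qed (rule comp)
  have "(\<integral>\<^sup>+x. walk_integrand n (Suc k) (x(n := v)) m \<partial>Pi\<^sub>M {Suc n..n + Suc k} (\<lambda>_. lborel)) =
     (\<integral>\<^sup>+w. (\<integral>\<^sup>+x. walk_integrand n (Suc k) ((x(Suc n := w))(n := v)) m \<partial>?M) \<partial>lborel)"
    unfolding J by (rule product_nn_integral_insert_rev[OF _ _ mI]) auto
  also have "\<dots> = (\<integral>\<^sup>+w. ennreal (nbr v m w) * walk k w (after v w m) \<partial>lborel)"
  proof (rule nn_integral_cong)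
    fix w :: 'a
    have am: "after v w m \<in> borel_measurable borel" by measurable
    have an: "0 \<le> after v w m x" for x using Suc.prems(2) by (simp add: after_eq)
    have upd: "walk_integrand (Suc n) k ((x(Suc n := w))(n := v)) q = walk_integrand (Suc n) k (x(Suc n := w)) q" for x q
      unfolding walk_integrand_def
      by (intro prod.cong refl arg_cong[where f=ennreal] arg_cong2[where f="(*)"] arg_cong2[where f="(-)"]) auto
    have "walk_integrand n (Suc k) ((x(Suc n := w))(n := v)) m =
       ennreal (nbr v m w) * walk_integrand (Suc n) k (x(Suc n := w)) (after v w m)" for x
      using walk_integrand_Suc[of m n k "(x(Suc n := w))(n := v)"] Suc.prems(2) by (simp add: upd)
    then have "(\<integral>\<^sup>+x. walk_integrand n (Suc k) ((x(Suc n := w))(n := v)) m \<partial>?M) =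
      (\<integral>\<^sup>+x. ennreal (nbr v m w) * walk_integrand (Suc n) k (x(Suc n := w)) (after v w m) \<partial>?M)"
      by (simp only:)
    also have "\<dots> = ennreal (nbr v m w) *
       (\<integral>\<^sup>+x. walk_integrand (Suc n) k (x(Suc n := w)) (after v w m) \<partial>?M)"
    proof (rule nn_integral_cmult, rule walk_integrand_measurable)
      have c: "(\<lambda>x. (x(Suc n := w)) i) \<in> borel_measurable ?M"
        if "i \<in> {Suc n..Suc n + k}" for i
        using that by (intro fun_upd_component_measurable[where J="?J"]) auto
      show "(\<lambda>x. (x(Suc n := w)) i) \<in> borel_measurable ?M"
        if "i \<in> {Suc n..Suc n + k}" for i by (rule c[OF that])
      show "(\<lambda>x. after v w m ((x(Suc n := w)) j)) \<in> borel_measurable ?M"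
        if "j \<in> {Suc (Suc n)..Suc n + k}" for j
        using that by (intro measurable_compose[OF c am]) auto
    qed
    also have "\<dots> = ennreal (nbr v m w) * walk k w (after v w m)"
      unfolding Suc.IH[OF am an, of w "Suc n"] ..
    finally show "(\<integral>\<^sup>+x. walk_integrand n (Suc k) ((x(Suc n := w))(n := v)) m \<partial>?M) =
       ennreal (nbr v m w) * walk k w (after v w m)" .
  qed
  finally show ?case by (simp only: walk.simps(2))
qed

lemma walk_measurable [measurable (raw)]:
  assumes [measurable]: "v \<in> borel_measurable N" "case_prod m \<in> borel_measurable (N \<Otimes>\<^sub>M borel)"
    and nn: "\<And>p x. 0 \<le> m p x"
  shows "(\<lambda>p. walk k (v p) (m p)) \<in> borel_measurable N"
proof -
  interpret product_sigma_finite "\<lambda>_::nat. lborel :: 'a measure" by (rule lborel_product_sigma_finite)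
  let ?P = "Pi\<^sub>M {Suc 0..0 + k} (\<lambda>_. lborel :: 'a measure)"
  interpret P: sigma_finite_measure ?P by (rule sigma_finite) simp
  let ?X = "\<lambda>q. (snd q)(0 := v (fst q))"
  have X: "(\<lambda>q. ?X q i) \<in> borel_measurable (N \<Otimes>\<^sub>M ?P)" if "i \<in> {0..0 + k}" for i
    using that by (intro fun_upd_component_measurable[where J="{Suc 0..0 + k}"]) auto
  have mI: "(\<lambda>q. walk_integrand 0 k (?X q) (m (fst q))) \<in> borel_measurable (N \<Otimes>\<^sub>M ?P)"
  proof (rule walk_integrand_measurable[OF X])
    fix j assume "j \<in> {Suc 0..0 + k}"
    then have "(\<lambda>q. (fst q, ?X q j)) \<in> N \<Otimes>\<^sub>M ?P \<rightarrow>\<^sub>M N \<Otimes>\<^sub>M borel"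
      by (intro measurable_Pair measurable_fst X) auto
    from measurable_compose[OF this assms(2)]
    show "(\<lambda>q. m (fst q) (?X q j)) \<in> borel_measurable (N \<Otimes>\<^sub>M ?P)" by simp
  qed
  have "(\<lambda>p. \<integral>\<^sup>+x. walk_integrand 0 k (x(0 := v p)) (m p) \<partial>?P) \<in> borel_measurable N"
    by (rule P.borel_measurable_nn_integral) (use mI in \<open>simp add: split_beta'\<close>)
  then show ?thesis
  proof (rule measurable_cong[THEN iffD1, rotated])
    fix p assume p: "p \<in> space N"
    have "m p \<in> borel_measurable borel"
      using measurable_compose[OF measurable_Pair1'[OF p] assms(2)] by simp
    from walk_eq_nn_integral[OF this nn, of k "v p" 0]
    show "(\<integral>\<^sup>+x. walk_integrand 0 k (x(0 := v p)) (m p) \<partial>?P) = walk k (v p) (m p)" by simp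
  qed
qed

lemma walk_mono:
  assumes "\<And>x. 0 \<le> m x" "\<And>x. m x \<le> m' x"
  shows "walk k v m \<le> walk k v m'"
  using assms
proof (induction k arbitrary: v m m')
  case (Suc k)
  have "walk k w (after v w m) \<le> walk k w (after v w m')" for w
    by (rule Suc.IH) (use Suc.prems in \<open>auto simp: after_eq mult_right_mono\<close>)
  moreover have "nbr v m w \<le> nbr v m' w" for w
    using Suc.prems(2)[of w] by (simp add: nbr_def mult_right_mono)
  ultimately show ?case
    by (auto intro!: nn_integral_mono mult_mono ennreal_leI)
qed simp

text \<open>After j steps the profile is still at most 1, so the uniform bound \<open>S\<close>
  applies to the other k steps. This is the source of V_(j+k) \<le> V_j V_k.\<close>

lemma walk_add_le:
  assumes S: "\<And>v m. profile UNIV m \<Longrightarrow> walk k v m \<le> S" and m: "profile UNIV m"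
  shows "walk (j + k) v m \<le> walk j v m * S"
  using m
proof (induction j arbitrary: v m)
  case 0
  then show ?case using S by simp
next
  case (Suc j)
  note [measurable] = profile_measurable[OF Suc.prems]
  have [measurable]: "(\<lambda>w. walk j w (after v w m)) \<in> borel_measurable lborel"
  proof (rule walk_measurable)
    show "0 \<le> after v p m x" for p x
      by (rule profile_nonneg[OF profile_after[OF Suc.prems]])
  qed measurable
  have "walk (Suc j + k) v m \<le> (\<integral>\<^sup>+w. ennreal (nbr v m w) * (walk j w (after v w m) * S) \<partial>lborel)"
    using Suc.IH[OF profile_after[OF Suc.prems]] by (auto intro!: nn_integral_mono mult_left_mono)
  also have "\<dots> = (\<integral>\<^sup>+w. ennreal (nbr v m w) * walk j w (after v w m) * S \<partial>lborel)"
    by (simp add: mult.assoc)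
  also have "\<dots> = walk (Suc j) v m * S"
    by (simp add: nn_integral_multc)
  finally show ?case .
qed

end

section \<open>Contraction and zero-free discs\<close>

lemma cauchy_schwarz_weighted:
  fixes p h :: "'b \<Rightarrow> real"
  assumes p: "\<And>x. 0 \<le> p x"
    and i: "integrable M p" "integrable M (\<lambda>x. p x * h x)" "integrable M (\<lambda>x. p x * (h x)\<^sup>2)"
  shows "(\<integral>x. p x * h x \<partial>M)\<^sup>2 \<le> (\<integral>x. p x \<partial>M) * (\<integral>x. p x * (h x)\<^sup>2 \<partial>M)"
proof -
  let ?U = "\<integral>x. p x \<partial>M" and ?D = "\<integral>x. p x * h x \<partial>M" and ?Q = "\<integral>x. p x * (h x)\<^sup>2 \<partial>M"
  have key: "0 \<le> ?Q - 2 * t * ?D + t\<^sup>2 * ?U" for t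
  proof -
    have "0 \<le> (\<integral>x. p x * (h x - t)\<^sup>2 \<partial>M)" using p by (intro integral_nonneg_AE AE_I2) auto
    also have "\<dots> = (\<integral>x. p x * (h x)\<^sup>2 - 2 * t * (p x * h x) + t\<^sup>2 * p x \<partial>M)"
      by (simp add: power2_diff algebra_simps)
    also have "\<dots> = ?Q - 2 * t * ?D + t\<^sup>2 * ?U" using i by simp
    finally show ?thesis .
  qed
  have U: "0 \<le> ?U" using p by (intro integral_nonneg_AE AE_I2) auto
  show ?thesis
  proof (cases "?U = 0")
    case True
    have "?D = 0"
    proof (rule ccontr)
      assume D: "?D \<noteq> 0"
      \<comment> \<open>If \<open>?U\<close> vanishes the quadratic is affine in t, and at this t
        its value is -1.\<close>
      from key[of "(?Q + 1) / (2 * ?D)"] True D show False by simp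
    qed
    with True show ?thesis by simp
  next
    case False
    with key[of "?D / ?U"] U show ?thesis
      by (simp add: power2_eq_square divide_simps mult.commute)
  qed
qed

text \<open>The large factor 1 + 1/\<delta> will fall on the inhomogeneous term of the recursion,
  while only 1 + \<delta> enters the contraction factor.\<close>

lemma weighted_sum_squared_le:
  fixes x y \<delta> :: real
  assumes "0 < \<delta>"
  shows "(x + y)\<^sup>2 \<le> (1 + 1 / \<delta>) * x\<^sup>2 + (1 + \<delta>) * y\<^sup>2"
proof -
  have "0 \<le> (x - \<delta> * y)\<^sup>2 / \<delta>" using assms by simp
  also have "\<dots> = (1 + 1 / \<delta>) * x\<^sup>2 + (1 + \<delta>) * y\<^sup>2 - (x + y)\<^sup>2"
    using assms by (simp add: power2_eq_square field_simps)
  finally show ?thesis by simp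
qed

lemma mult_exp_neg_le:
  fixes x :: real
  shows "x * exp (- x) \<le> exp (- 1)"
proof -
  have "x \<le> exp (x - 1)" using exp_ge_add_one_self[of "x - 1"] by simp
  then have "x * exp (- x) \<le> exp (x - 1) * exp (- x)" by (rule mult_right_mono) simp
  also have "\<dots> = exp (- 1)" by (simp add: exp_add[symmetric])
  finally show ?thesis .
qed

section \<open>Absolute values along the recursion and real activities\<close>

context bounded_region
begin

definition absnbr :: "complex \<Rightarrow> 'a \<Rightarrow> ('a \<Rightarrow> real) \<Rightarrow> 'a \<Rightarrow> real" where
  "absnbr z v m = (\<lambda>x. nbr v m x * cmod (ratio z x (after v x m)))"

text \<open>The integral of \<open>u\<close> with moduli inside and the factor z removed; at a real
  activity t \<ge> 0 one has u = t U.\<close>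

definition U :: "complex \<Rightarrow> 'a \<Rightarrow> ('a \<Rightarrow> real) \<Rightarrow> real" where
  "U z v m = (\<integral>x. absnbr z v m x \<partial>lborel)"

lemma absnbr_measurable [measurable (raw)]:
  assumes [measurable]: "x \<in> borel_measurable N" "v \<in> borel_measurable N"
    "case_prod m \<in> borel_measurable (N \<Otimes>\<^sub>M borel)"
  shows "(\<lambda>p. absnbr z (v p) (m p) (x p)) \<in> borel_measurable N"
proof -
  have [measurable]: "(\<lambda>p. m p (x p)) \<in> borel_measurable N"
    using measurable_compose[OF measurable_Pair[OF measurable_ident assms(1)] assms(3)] by simp
  show ?thesis unfolding absnbr_def by measurable
qed

lemma U_measurable [measurable (raw)]:
  assumes [measurable]: "v \<in> borel_measurable N" "case_prod m \<in> borel_measurable (N \<Otimes>\<^sub>M borel)"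
  shows "(\<lambda>p. U z (v p) (m p)) \<in> borel_measurable N"
  unfolding U_def by measurable

lemma act_absnbr:
  assumes "lower z c" "0 < c" "prof m"
  shows "act (absnbr z v m)"
proof -
  note [measurable] = profile_measurable[OF assms(3)]
  have n: "0 \<le> nbr v m x" for x using profile_nonneg[OF profile_nbr[OF assms(3)]] .
  have a: "act (nbr v m)" by (rule act_prof[OF profile_nbr[OF assms(3)]])
  have "integrable lborel (\<lambda>x. nbr v m x * cmod (ratio z x (after v x m)))"
  proof (rule act_integrable_mult[OF a])
    show "\<bar>cmod (ratio z x (after v x m))\<bar> \<le> exp (cmod z * V) / c" for x
      using norm_ratio_le[OF assms(1,2) profile_after[OF assms(3)] order_refl] by simp
  qed measurable
  then show ?thesis using n by (intro actI) (simp_all add: absnbr_def)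
qed

lemma U_nonneg: "lower z c \<Longrightarrow> 0 < c \<Longrightarrow> prof m \<Longrightarrow> 0 \<le> U z v m"
  unfolding U_def using act_absnbr by (intro integral_nonneg_AE AE_I2) auto

lemma lower_real: "0 \<le> t \<Longrightarrow> lower (of_real t) 1"
  unfolding lower_def
proof (intro allI impI)
  fix m assume "0 \<le> t" "prof m"
  then show "1 \<le> cmod (Z (of_real t) m)"
    using ZR_ge_1[OF act_prof[OF \<open>prof m\<close>] \<open>0 \<le> t\<close>] by (simp add: Z_of_real act_prof)
qed

lemma ratio_real:
  assumes "0 \<le> t" "prof m"
  shows "ratio (of_real t) v m = of_real (cmod (ratio (of_real t) v m))"
proof -
  have "act m" "act (tilt v m)" using act_prof assms(2) profile_tilt by auto
  then show ?thesis
    using ZR_ge_1[of m t] ZR_ge_1[of "tilt v m" t] assms(1)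
    by (simp add: ratio_def Z_of_real norm_divide)
qed

lemma u_real:
  assumes "0 \<le> t" "prof m"
  shows "u (of_real t) v m = of_real (t * U (of_real t) v m)"
proof -
  have "(\<integral>x. of_real (nbr v m x) * ratio (of_real t) x (after v x m) \<partial>lborel) =
     (\<integral>x. complex_of_real (absnbr (of_real t) v m x) \<partial>lborel)"
    unfolding absnbr_def of_real_mult by (subst ratio_real[OF assms(1) profile_after[OF assms(2)]]) (rule refl)
  then show ?thesis by (simp add: u_def U_def)
qed

lemma norm_ratio_real:
  assumes "0 \<le> t" "prof m"
  shows "cmod (ratio (of_real t) v m) = exp (- (t * U (of_real t) v m))"
  unfolding ratio_eq_exp[OF lower_real[OF assms(1)] zero_less_one assms(2)] u_real[OF assms]
  by simp

end

section \<open>Estimates under temperedness\<close>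

locale tempered_region = bounded_region b B for b :: "'a::euclidean_space \<Rightarrow> 'a \<Rightarrow> real" and B +
  fixes C :: real
  assumes C: "(\<integral>\<^sup>+x. ennreal (1 - b x v) \<partial>lborel) \<le> ennreal C" and C_nonneg: "0 \<le> C"
begin

lemma mass_nbr_le:
  assumes "prof m"
  shows "mass (nbr v m) \<le> C"
proof -
  note n = profile_nbr[OF assms, of v]
  have "ennreal (mass (nbr v m)) = (\<integral>\<^sup>+x. ennreal (nbr v m x) \<partial>lborel)"
    unfolding mass_def
    by (rule nn_integral_eq_integral[symmetric]) (use act_prof[OF n] in auto)
  also have "\<dots> \<le> (\<integral>\<^sup>+x. ennreal (1 - b x v) \<partial>lborel)"
    using profile_le_1[OF assms] profile_nonneg[OF assms]
    by (intro nn_integral_mono ennreal_leI) (simp add: nbr_def mult_left_le_one_le)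
  also note C[of v]
  finally show ?thesis using C_nonneg by simp
qed

lemma U_le:
  assumes "lower z c" "0 < c" "prof m" and M: "\<And>m v. prof m \<Longrightarrow> cmod (ratio z v m) \<le> M" "0 \<le> M"
  shows "U z v m \<le> M * C"
proof -
  note n = profile_nbr[OF assms(3), of v]
  have "U z v m \<le> (\<integral>x. nbr v m x * M \<partial>lborel)"
    unfolding U_def
  proof (rule integral_mono)
    show "integrable lborel (absnbr z v m)" using act_absnbr[OF assms(1-3)] by simp
    show "integrable lborel (\<lambda>x. nbr v m x * M)" using act_prof[OF n] by simp
    show "absnbr z v m x \<le> nbr v m x * M" for x
      unfolding absnbr_def by (rule mult_left_mono[OF M(1)[OF profile_after[OF assms(3)]] profile_nonneg[OF n]])
  qed
  also have "\<dots> = mass (nbr v m) * M" by (simp add: mass_def)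
  also have "\<dots> \<le> C * M" by (rule mult_right_mono[OF mass_nbr_le[OF assms(3)] M(2)])
  finally show ?thesis by (simp add: mult.commute)
qed

lemma U_real_le: "0 \<le> t \<Longrightarrow> prof m \<Longrightarrow> U (of_real t) v m \<le> C"
  using U_le[OF lower_real[of t] zero_less_one, of m 1] norm_ratio_real[of t] U_nonneg[OF lower_real zero_less_one]
  by simp

text \<open>Near a real activity \<open>t\<close>, all moduli are compared with their values at \<open>t\<close>; the bound
  on \<open>\<bar>z\<bar> * \<bar>ratio\<bar> * U\<close> is where \<open>x * exp (- x) \<le> 1 / e\<close>, and hence the constant \<open>e\<close> of the theorem,
  comes from.\<close>

lemma near_real:
  assumes t: "0 \<le> t" and c: "0 < c" "lower z c" and \<epsilon>: "cmod (z - of_real t) \<le> \<epsilon>"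
    and close: "\<And>v m. prof m \<Longrightarrow> cmod (u z v m - u (of_real t) v m) \<le> \<theta>"
    and m: "prof m"
  shows "cmod (ratio z v m) \<le> exp \<theta>"
    and "U z v m \<le> exp \<theta> * C"
    and "cmod z * cmod (ratio z v m) * U z v m \<le> exp (2 * \<theta>) * (exp (- 1) + \<epsilon> * C)"
proof -
  let ?t = "complex_of_real t"
  \<comment> \<open>Ratios are exp(-u), so a displacement of \<open>u\<close> by at most \<theta>
    changes their moduli by at most the factor exp \<theta>.\<close>
  have R: "cmod (ratio z w q) \<le> exp \<theta> * cmod (ratio ?t w q)" if q: "prof q" for w q
  proof -
    have "Re (u ?t w q) - Re (u z w q) \<le> \<theta>"
      using close[OF q, of w] abs_Re_le_cmod[of "u z w q - u ?t w q"] by simp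
    then have "- Re (u z w q) \<le> \<theta> + - Re (u ?t w q)" by simp
    then have "exp (- Re (u z w q)) \<le> exp (\<theta> + - Re (u ?t w q))" by (simp only: exp_le_cancel_iff)
    then show ?thesis
      unfolding ratio_eq_exp[OF c(2,1) q] ratio_eq_exp[OF lower_real[OF t] zero_less_one q]
      by (simp only: norm_exp_eq_Re uminus_complex.sel exp_add)
  qed
  have U0: "0 \<le> U ?t w q" if "prof q" for w q
    by (rule U_nonneg[OF lower_real[OF t] zero_less_one that])
  have rt: "cmod (ratio ?t w q) \<le> 1" if "prof q" for w q
    using norm_ratio_real[OF t that, of w] U0[OF that, of w] t by simp
  have R1: "cmod (ratio z w q) \<le> exp \<theta>" if q: "prof q" for w q
    using order_trans[OF R[OF q, of w] mult_left_mono[OF rt[OF q, of w], of "exp \<theta>"]] by simp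
  then show "cmod (ratio z v m) \<le> exp \<theta>" using m .
  show "U z v m \<le> exp \<theta> * C"
    by (rule U_le[OF c(2,1) m R1]) simp_all
  have UU: "U z v m \<le> exp \<theta> * U ?t v m"
  proof -
    have "U z v m \<le> (\<integral>x. exp \<theta> * absnbr ?t v m x \<partial>lborel)"
      unfolding U_def
    proof (rule integral_mono)
      show "integrable lborel (absnbr z v m)" using act_absnbr[OF c(2,1) m] by simp
      show "integrable lborel (\<lambda>x. exp \<theta> * absnbr ?t v m x)"
        using act_absnbr[OF lower_real[OF t] zero_less_one m] by simp
      show "absnbr z v m x \<le> exp \<theta> * absnbr ?t v m x" for x
        using mult_left_mono[OF R[OF profile_after[OF m, of v x], of x] profile_nonneg[OF profile_nbr[OF m, of v], of x]]
        by (simp add: absnbr_def mult_ac)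
    qed
    then show ?thesis by (simp add: U_def)
  qed
  have zt: "cmod z \<le> t + \<epsilon>" using norm_triangle_sub[of z ?t] \<epsilon> t by simp
  have \<epsilon>0: "0 \<le> \<epsilon>" using \<epsilon> norm_ge_zero order_trans by blast
  have "cmod z * cmod (ratio z v m) * U z v m \<le>
     (t + \<epsilon>) * (exp \<theta> * cmod (ratio ?t v m)) * (exp \<theta> * U ?t v m)"
    using zt R[OF m] UU t \<epsilon>0 U_nonneg[OF c(2,1) m] by (intro mult_mono) simp_all
  \<comment> \<open>The part with t has the form x exp(-x) for x = t U; the surplus \<epsilon> costs
    at most \<epsilon> C.\<close>
  also have "\<dots> = exp (2 * \<theta>) * (t * U ?t v m * exp (- (t * U ?t v m)) + \<epsilon> * (U ?t v m * cmod (ratio ?t v m)))"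
    unfolding norm_ratio_real[OF t m] mult_2 exp_add by (simp add: algebra_simps)
  also have "\<dots> \<le> exp (2 * \<theta>) * (exp (- 1) + \<epsilon> * (C * 1))"
    using mult_exp_neg_le[of "t * U ?t v m"] U_real_le[OF t m] rt[OF m] U0[OF m] \<epsilon>0 C_nonneg
    by (intro mult_left_mono add_mono mult_mono) simp_all
  finally show "cmod z * cmod (ratio z v m) * U z v m \<le> exp (2 * \<theta>) * (exp (- 1) + \<epsilon> * C)" by simp
qed

lemma walk_profile_UNIV: "prof m \<Longrightarrow> profile UNIV m"
  using profile_le_1 by (auto simp: profile_def)

text \<open>For \<open>E = \<bar>du\<bar>\<^sup>2 / U\<close> (which is \<open>0\<close> where \<open>U = 0\<close>) the Cauchy--Schwarz inequality gives the linear
  inequality \<open>E \<le> K + \<kappa> * \<integral> nbr * E\<close>, whose \<open>k\<close>-fold iterate contracts since \<open>\<kappa> ^ k * Vk \<le> 1 / 2\<close>.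
  The resulting bound does not depend on the region.\<close>

lemma du_contraction:
  assumes t: "0 \<le> t" and \<delta>: "0 < \<delta>" and r: "0 < r" and c: "0 < c" "\<And>w. w \<in> ball z r \<Longrightarrow> lower w c"
    and \<epsilon>: "cmod (z - of_real t) \<le> \<epsilon>"
    and close: "\<And>v m. prof m \<Longrightarrow> cmod (u z v m - u (of_real t) v m) \<le> \<theta>"
    and \<kappa>: "\<kappa> = (1 + \<delta>) * (t + \<epsilon>) * (exp (2 * \<theta>) * (exp (- 1) + \<epsilon> * C))"
    and Vk: "\<And>v m. profile UNIV m \<Longrightarrow> walk k v m \<le> ennreal Vk" "0 \<le> Vk" "\<kappa> ^ k * Vk \<le> 1 / 2"
    and m: "prof m"
  shows "(cmod (du z v m))\<^sup>2 \<le>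
    2 * ((1 + 1 / \<delta>) * (exp \<theta> * C) * (\<Sum>i<k. (\<kappa> * C) ^ i)) * (exp \<theta> * C)"
proof -
  have z: "z \<in> ball z r" using r by simp
  note low = c(2)[OF z]
  note ab = act_absnbr[OF low c(1)]
  note abn = act_nonneg[OF ab]
  note nr = near_real[OF t c(1) low \<epsilon> close]
  \<comment> \<open>This bound depends on the region. It provides integrability and, through
    \<open>S0\<close>, the finiteness of the supremum of \<open>E\<close>; it does not appear in the
    result.\<close>
  define \<beta> where "\<beta> = 2 * (V * exp (cmod z * V) / c)"
  have \<beta>: "cmod (du z w q) \<le> \<beta>" if "prof q" for w q
    unfolding \<beta>_def by (rule norm_du_le[OF low c(1) that order_refl])
  note \<beta>a = \<beta>[OF profile_after]
  have \<epsilon>0: "0 \<le> \<epsilon>" using \<epsilon> norm_ge_zero order_trans by blast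
  have zt: "cmod z \<le> t + \<epsilon>" using norm_triangle_sub[of z "of_real t"] \<epsilon> t by simp
  have \<kappa>0: "0 \<le> \<kappa>" unfolding \<kappa> using t \<delta> \<epsilon>0 C_nonneg by simp
  define E where "E = (\<lambda>w q. (cmod (du z w q))\<^sup>2 / U z w q)"
  define K where "K = (1 + 1 / \<delta>) * (exp \<theta> * C)"
  have K0: "0 \<le> K" unfolding K_def using \<delta> C_nonneg by simp
  have Unn: "0 \<le> U z w q" if "prof q" for w q by (rule U_nonneg[OF low c(1) that])
  have En: "0 \<le> E w q" if "prof q" for w q unfolding E_def using Unn[OF that] by simp
  note Ea = En[OF profile_after]
  let ?h = "\<lambda>w q x. cmod (du z x (after w x q))" and ?e = "\<lambda>w q x. nbr w q x * E x (after w x q)"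
  define D where "D = (\<lambda>w q. \<integral>x. absnbr z w q x * ?h w q x \<partial>lborel)"
  have intD: "integrable lborel (\<lambda>x. absnbr z w q x * ?h w q x)" if q: "prof q" for w q
  proof (rule act_integrable_mult[OF ab[OF q]])
    note [measurable] = profile_measurable[OF q]
    show "(\<lambda>x. ?h w q x) \<in> borel_measurable borel" by measurable
    show "\<bar>?h w q x\<bar> \<le> \<beta>" for x using \<beta>a[OF q] by simp
  qed
  have intQ: "integrable lborel (\<lambda>x. absnbr z w q x * (?h w q x)\<^sup>2)" if q: "prof q" for w q
  proof (rule act_integrable_mult[OF ab[OF q]])
    note [measurable] = profile_measurable[OF q]
    show "(\<lambda>x. (?h w q x)\<^sup>2) \<in> borel_measurable borel" by measurable
    show "\<bar>(?h w q x)\<^sup>2\<bar> \<le> \<beta>\<^sup>2" for x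
      using power_mono[OF \<beta>a[OF q] norm_ge_zero, where n=2] by simp
  qed
  have rec1: "cmod (du z w q) \<le> U z w q + cmod z * D w q" if q: "prof q" for w q
  proof -
    note [measurable] = profile_measurable[OF q]
    note nn = profile_nonneg[OF profile_nbr[OF q]]
    have iU: "integrable lborel (absnbr z w q)" using ab[OF q] by simp
    have "cmod (du z w q) = cmod (\<integral>x. of_real (nbr w q x) *
       (ratio z x (after w x q) * (1 - z * du z x (after w x q))) \<partial>lborel)"
      by (rule arg_cong[OF u_has_field_derivative(2)[OF r c q]])
    also have "\<dots> \<le> (\<integral>x. cmod (of_real (nbr w q x) *
       (ratio z x (after w x q) * (1 - z * du z x (after w x q)))) \<partial>lborel)"
      by (rule integral_norm_bound)
    also have "\<dots> \<le> (\<integral>x. absnbr z w q x + cmod z * (absnbr z w q x * ?h w q x) \<partial>lborel)"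
    proof (rule integral_mono')
      show "integrable lborel (\<lambda>x. absnbr z w q x + cmod z * (absnbr z w q x * ?h w q x))"
        using iU intD[OF q] by simp
      fix x
      have "cmod (1 - z * du z x (after w x q)) \<le> 1 + cmod z * ?h w q x"
        using norm_triangle_ineq4[of 1 "z * du z x (after w x q)"] by (simp add: norm_mult)
      from mult_left_mono[OF this abn[OF q, of w x]]
      show "cmod (of_real (nbr w q x) * (ratio z x (after w x q) * (1 - z * du z x (after w x q)))) \<le>
         absnbr z w q x + cmod z * (absnbr z w q x * ?h w q x)"
        unfolding norm_mult norm_of_real abs_of_nonneg[OF nn] by (simp add: absnbr_def algebra_simps)
      show "0 \<le> absnbr z w q x + cmod z * (absnbr z w q x * ?h w q x)"
        using abn[OF q, of w x] by simp
    qed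
    also have "\<dots> = U z w q + cmod z * D w q"
      unfolding U_def D_def using iU intD[OF q] by simp
    finally show ?thesis .
  qed
  have Dle: "D w q \<le> U z w q * \<beta>" if q: "prof q" for w q
  proof -
    have "D w q \<le> (\<integral>x. absnbr z w q x * \<beta> \<partial>lborel)"
      unfolding D_def
    proof (rule integral_mono[OF intD[OF q]])
      show "integrable lborel (\<lambda>x. absnbr z w q x * \<beta>)" using ab[OF q] by simp
      show "absnbr z w q x * ?h w q x \<le> absnbr z w q x * \<beta>" for x
        by (rule mult_left_mono[OF \<beta>a[OF q] abn[OF q]])
    qed
    then show ?thesis by (simp add: U_def)
  qed
  have duU: "cmod (du z w q) \<le> U z w q * (1 + cmod z * \<beta>)" if q: "prof q" for w q
  proof -
    have "cmod z * D w q \<le> cmod z * (U z w q * \<beta>)" by (rule mult_left_mono[OF Dle[OF q]]) simp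
    with rec1[OF q, of w] show ?thesis by (simp add: algebra_simps)
  qed
  \<comment> \<open>Where \<open>U\<close> vanishes, \<open>duU\<close> forces \<open>du\<close> to
    vanish too, so the default value 0 of the quotient is the right one.\<close>
  have EU: "E w q * U z w q = (cmod (du z w q))\<^sup>2" if q: "prof q" for w q
    using duU[OF q, of w] by (cases "U z w q = 0") (simp_all add: E_def)
  define S0 where "S0 = exp \<theta> * C * (1 + cmod z * \<beta>)\<^sup>2"
  have ES0: "E w q \<le> S0" if q: "prof q" for w q
  proof (cases "U z w q = 0")
    case True
    then show ?thesis using C_nonneg by (simp add: E_def S0_def)
  next
    case False
    then have pos: "0 < U z w q" using Unn[OF q, of w] by simp
    have "(cmod (du z w q))\<^sup>2 \<le> (U z w q * (1 + cmod z * \<beta>))\<^sup>2"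
      using duU[OF q, of w] by (intro power_mono) simp_all
    then have "E w q \<le> U z w q * (1 + cmod z * \<beta>)\<^sup>2"
      using pos by (simp add: E_def divide_le_eq power2_eq_square mult_ac)
    also have "\<dots> \<le> S0" unfolding S0_def by (rule mult_right_mono[OF nr(2)[OF _ q]]) simp_all
    finally show ?thesis .
  qed
  have intE: "integrable lborel (\<lambda>x. ?e w q x)" if q: "prof q" for w q
  proof (rule act_integrable_mult[OF act_prof[OF profile_nbr[OF q]]])
    note [measurable] = profile_measurable[OF q]
    show "(\<lambda>x. E x (after w x q)) \<in> borel_measurable borel" unfolding E_def by measurable
    show "\<bar>E x (after w x q)\<bar> \<le> S0" for x
      using ES0[OF profile_after[OF q]] Ea[OF q] by simp
  qed
  have rec2: "E w q \<le> K + \<kappa> * (\<integral>x. ?e w q x \<partial>lborel)" if q: "prof q" for w q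
  proof -
    let ?Q = "\<integral>x. absnbr z w q x * (?h w q x)\<^sup>2 \<partial>lborel"
    let ?I = "\<integral>x. ?e w q x \<partial>lborel"
    note nn = profile_nonneg[OF profile_nbr[OF q]]
    have I0: "0 \<le> ?I" using nn Ea[OF q] by (intro integral_nonneg_AE AE_I2) simp
    have CS: "(D w q)\<^sup>2 \<le> U z w q * ?Q"
      unfolding D_def U_def
      using ab[OF q, of w] intD[OF q] intQ[OF q]
      by (intro cauchy_schwarz_weighted) simp_all
    have QI: "(1 + \<delta>) * (cmod z)\<^sup>2 * ?Q \<le> \<kappa> * ?I"
    proof -
      have "(1 + \<delta>) * (cmod z)\<^sup>2 * ?Q =
        (\<integral>x. (1 + \<delta>) * (cmod z)\<^sup>2 * (absnbr z w q x * (?h w q x)\<^sup>2) \<partial>lborel)"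
        by simp
      also have "\<dots> \<le> (\<integral>x. \<kappa> * (?e w q x) \<partial>lborel)"
      proof (rule integral_mono)
        show "integrable lborel (\<lambda>x. (1 + \<delta>) * (cmod z)\<^sup>2 * (absnbr z w q x * (?h w q x)\<^sup>2))"
          using intQ[OF q] by simp
        show "integrable lborel (\<lambda>x. \<kappa> * (?e w q x))"
          using intE[OF q] by simp
        fix x
        let ?q = "after w x q"
        have pq: "prof ?q" by (rule profile_after[OF q])
        have "(1 + \<delta>) * (cmod z)\<^sup>2 * (absnbr z w q x * (cmod (du z x ?q))\<^sup>2) =
           (1 + \<delta>) * cmod z * (cmod z * cmod (ratio z x ?q) * U z x ?q) * (nbr w q x * E x ?q)"
          unfolding EU[OF pq, symmetric] by (simp add: absnbr_def power2_eq_square mult_ac)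
        also have "\<dots> \<le> \<kappa> * (nbr w q x * E x ?q)"
        proof (rule mult_right_mono)
          show "(1 + \<delta>) * cmod z * (cmod z * cmod (ratio z x ?q) * U z x ?q) \<le> \<kappa>"
            unfolding \<kappa>
          proof (rule mult_mono)
            show "(1 + \<delta>) * cmod z \<le> (1 + \<delta>) * (t + \<epsilon>)"
              using zt \<delta> by (intro mult_left_mono) simp_all
            show "cmod z * cmod (ratio z x ?q) * U z x ?q \<le> exp (2 * \<theta>) * (exp (- 1) + \<epsilon> * C)"
              by (rule nr(3)[OF _ pq])
          qed (use \<delta> t \<epsilon>0 Unn[OF pq] in simp_all)
        qed (use nn En[OF pq] in simp)
        finally show "(1 + \<delta>) * (cmod z)\<^sup>2 * (absnbr z w q x * (cmod (du z x ?q))\<^sup>2) \<le> \<kappa> * (nbr w q x * E x ?q)" .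
      qed
      finally show ?thesis by simp
    qed
    show ?thesis
    proof (cases "U z w q = 0")
      case True
      then show ?thesis using K0 \<kappa>0 I0 by (simp add: E_def)
    next
      case False
      then have pos: "0 < U z w q" using Unn[OF q, of w] by simp
      have "(cmod (du z w q))\<^sup>2 \<le> (U z w q + cmod z * D w q)\<^sup>2"
        using rec1[OF q] by (intro power_mono) simp_all
      also have "\<dots> \<le> (1 + 1 / \<delta>) * (U z w q)\<^sup>2 + (1 + \<delta>) * (cmod z * D w q)\<^sup>2"
        by (rule weighted_sum_squared_le[OF \<delta>])
      also have "(1 + \<delta>) * (cmod z * D w q)\<^sup>2 \<le> (1 + \<delta>) * ((cmod z)\<^sup>2 * (U z w q * ?Q))"
        using CS \<delta> by (intro mult_left_mono) (simp_all add: power_mult_distrib mult_left_mono)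
      finally have "(cmod (du z w q))\<^sup>2 \<le> U z w q * ((1 + 1 / \<delta>) * U z w q + (1 + \<delta>) * (cmod z)\<^sup>2 * ?Q)"
        by (simp add: power2_eq_square algebra_simps)
      then have "E w q \<le> (1 + 1 / \<delta>) * U z w q + (1 + \<delta>) * (cmod z)\<^sup>2 * ?Q"
        unfolding E_def using pos by (simp add: divide_le_eq mult.commute)
      also have "\<dots> \<le> K + \<kappa> * ?I"
        unfolding K_def using nr(2)[OF _ q] QI \<delta> by (intro add_mono mult_left_mono) simp_all
      finally show ?thesis .
    qed
  qed
  \<comment> \<open>Every step collects the inhomogeneity \<open>K\<close> again, multiplied by
    \<kappa> and by the mass of the kernel, at most C. The resulting powers of \<kappa> C may be
    large; contraction comes from the walk term alone.\<close>
  have iter: "ennreal (E w q) \<le> ennreal (K * (\<Sum>i<j. (\<kappa> * C) ^ i)) + ennreal (\<kappa> ^ j * S) * walk j w q"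
    if S: "\<And>w q. prof q \<Longrightarrow> E w q \<le> S" and q: "prof q" for S j w q
    using q
  proof (induction j arbitrary: w q)
    case 0
    then show ?case using S by (simp add: ennreal_leI)
  next
    case (Suc j)
    note q = Suc.prems
    note [measurable] = profile_measurable[OF q]
    note nn = profile_nonneg[OF profile_nbr[OF q]]
    note nbr_act = act_prof[OF profile_nbr[OF q, of w]]
    have S0: "0 \<le> S" using order_trans[OF En S, OF q q] .
    let ?s = "K * (\<Sum>i<j. (\<kappa> * C) ^ i)"
    have s0: "0 \<le> ?s" using K0 \<kappa>0 C_nonneg by (intro mult_nonneg_nonneg sum_nonneg) simp_all
    have [measurable]: "(\<lambda>x. walk j x (after w x q)) \<in> borel_measurable lborel"
    proof (rule walk_measurable)
      show "0 \<le> after w p q x" for p x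
        by (rule profile_nonneg[OF profile_after[OF q]])
    qed measurable
    have "ennreal (\<integral>x. ?e w q x \<partial>lborel) =
        (\<integral>\<^sup>+x. ennreal (?e w q x) \<partial>lborel)"
      by (rule nn_integral_eq_integral[symmetric, OF intE[OF q]])
         (use nn Ea[OF q] in simp)
    also have "\<dots> \<le> (\<integral>\<^sup>+x. ennreal ?s * ennreal (nbr w q x) +
        ennreal (\<kappa> ^ j * S) * (ennreal (nbr w q x) * walk j x (after w x q)) \<partial>lborel)"
    proof (rule nn_integral_mono)
      fix x
      have "ennreal (?e w q x) = ennreal (nbr w q x) * ennreal (E x (after w x q))"
        using nn Ea[OF q] by (simp add: ennreal_mult)
      also have "\<dots> \<le> ennreal (nbr w q x) * (ennreal ?s + ennreal (\<kappa> ^ j * S) * walk j x (after w x q))"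
        by (rule mult_left_mono[OF Suc.IH[OF profile_after[OF q]]]) simp
      also have "\<dots> = ennreal ?s * ennreal (nbr w q x) +
          ennreal (\<kappa> ^ j * S) * (ennreal (nbr w q x) * walk j x (after w x q))"
        by (simp add: distrib_left mult_ac)
      finally show "ennreal (?e w q x) \<le> \<dots>" .
    qed
    also have "\<dots> = ennreal ?s * (\<integral>\<^sup>+x. ennreal (nbr w q x) \<partial>lborel) + ennreal (\<kappa> ^ j * S) * walk (Suc j) w q"
      by (subst nn_integral_add) (auto simp: nn_integral_cmult)
    also have "(\<integral>\<^sup>+x. ennreal (nbr w q x) \<partial>lborel) = ennreal (mass (nbr w q))"
      unfolding mass_def by (rule nn_integral_eq_integral) (use nbr_act nn in simp_all)
    also have "ennreal ?s * \<dots> \<le> ennreal ?s * ennreal C"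
      by (intro mult_left_mono ennreal_leI mass_nbr_le[OF q]) simp
    finally have 1: "ennreal (\<integral>x. ?e w q x \<partial>lborel) \<le>
       ennreal ?s * ennreal C + ennreal (\<kappa> ^ j * S) * walk (Suc j) w q" by simp
    have I0: "0 \<le> (\<integral>x. ?e w q x \<partial>lborel)"
      using nn Ea[OF q] by (intro integral_nonneg_AE AE_I2) simp
    have "ennreal (E w q) \<le> ennreal (K + \<kappa> * (\<integral>x. ?e w q x \<partial>lborel))"
      by (rule ennreal_leI[OF rec2[OF q]])
    also have "\<dots> = ennreal K + ennreal \<kappa> * ennreal (\<integral>x. ?e w q x \<partial>lborel)"
      using K0 \<kappa>0 I0 by (simp add: ennreal_plus ennreal_mult)
    also have "\<dots> \<le> ennreal K + ennreal \<kappa> * (ennreal ?s * ennreal C + ennreal (\<kappa> ^ j * S) * walk (Suc j) w q)"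
      by (intro add_left_mono mult_left_mono 1) simp
    also have "\<dots> = (ennreal K + ennreal \<kappa> * (ennreal ?s * ennreal C)) + ennreal \<kappa> * ennreal (\<kappa> ^ j * S) * walk (Suc j) w q"
      by (simp only: distrib_left add.assoc mult.assoc)
    also have "ennreal K + ennreal \<kappa> * (ennreal ?s * ennreal C) = ennreal (K * (\<Sum>i<Suc j. (\<kappa> * C) ^ i))"
    proof -
      have "K + \<kappa> * (?s * C) = K * (1 + (\<Sum>i<j. (\<kappa> * C) * (\<kappa> * C) ^ i))"
        by (simp add: sum_distrib_left[symmetric] algebra_simps)
      also have "\<dots> = K * (\<Sum>i<Suc j. (\<kappa> * C) ^ i)"
        by (subst sum.lessThan_Suc_shift) simp
      finally show ?thesis
        using K0 \<kappa>0 s0 C_nonneg by (simp only: ennreal_mult[symmetric] ennreal_plus[symmetric] mult_nonneg_nonneg)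
    qed
    also have "ennreal \<kappa> * ennreal (\<kappa> ^ j * S) = ennreal (\<kappa> ^ Suc j * S)"
      using \<kappa>0 S0 by (simp add: ennreal_mult[symmetric] mult.assoc)
    finally show ?case .
  qed
  define G where "G = K * (\<Sum>i<k. (\<kappa> * C) ^ i)"
  have G0: "0 \<le> G" unfolding G_def using K0 \<kappa>0 C_nonneg by (intro mult_nonneg_nonneg sum_nonneg) simp_all
  have half: "E w q \<le> G + S / 2" if S: "\<And>w q. prof q \<Longrightarrow> E w q \<le> S" and q: "prof q" for S w q
  proof -
    have S0: "0 \<le> S" using order_trans[OF En S, OF q q] .
    have "ennreal (E w q) \<le> ennreal G + ennreal (\<kappa> ^ k * S) * walk k w q"
      unfolding G_def by (rule iter[OF S q])
    also have "\<dots> \<le> ennreal G + ennreal (\<kappa> ^ k * S) * ennreal Vk"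
      by (intro add_left_mono mult_left_mono Vk(1)[OF walk_profile_UNIV[OF q]]) simp
    also have "\<dots> = ennreal (G + \<kappa> ^ k * S * Vk)"
      using G0 \<kappa>0 S0 Vk(2) by (simp add: ennreal_mult[symmetric])
    finally have "E w q \<le> G + \<kappa> ^ k * S * Vk"
      using G0 \<kappa>0 S0 Vk(2) by (subst (asm) ennreal_le_iff) simp_all
    also have "\<kappa> ^ k * S * Vk \<le> S / 2"
      using mult_right_mono[OF Vk(3) S0] by (simp add: mult_ac)
    finally show ?thesis by simp
  qed
  \<comment> \<open>The supremum is finite by \<open>ES0\<close>, so S \<le> G + S/2 can be solved
    for S.\<close>
  define S where "S = Sup {E w q |w q. prof q}"
  have bdd: "bdd_above {E w q |w q. prof q}" using ES0 by (auto intro!: bdd_aboveI[of _ S0])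
  have ES: "E w q \<le> S" if "prof q" for w q
    unfolding S_def by (rule cSup_upper[OF _ bdd]) (use that in auto)
  have "S \<le> G + S / 2"
    unfolding S_def by (rule cSup_least) (use m half[OF ES] in \<open>auto simp: S_def\<close>)
  then have "S \<le> 2 * G" by simp
  then have "E v m \<le> 2 * G" using ES[OF m, of v] by simp
  then have "(cmod (du z v m))\<^sup>2 \<le> 2 * G * U z v m"
    unfolding EU[OF m, symmetric] by (rule mult_right_mono[OF _ Unn[OF m]])
  also have "\<dots> \<le> 2 * G * (exp \<theta> * C)"
    using nr(2)[OF _ m] G0 by (intro mult_left_mono) simp_all
  finally show ?thesis by (simp add: G_def K_def)
qed

end

lemma mult_divide_twice:
  fixes x y :: real
  assumes "0 \<le> x"
  shows "(x + 1) * (y / (2 * (x + 1))) = y / 2"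
  using assms by (simp add: divide_simps)

context tempered_region
begin

text \<open>The disc of radius \<open>\<epsilon>\<close> is exhausted in steps of length \<open>d\<close>. The step length depends on the
  region, whereas \<open>\<theta>\<close> and \<open>\<epsilon>\<close> do not.\<close>

lemma Z_zero_free:
  assumes t: "0 \<le> t" and \<delta>: "0 < \<delta>" and \<theta>: "0 < \<theta>" and \<epsilon>: "0 \<le> \<epsilon>"
    and \<kappa>: "\<kappa> = (1 + \<delta>) * (t + \<epsilon>) * (exp (2 * \<theta>) * (exp (- 1) + \<epsilon> * C))"
    and Vk: "\<And>v m. profile UNIV m \<Longrightarrow> walk k v m \<le> ennreal Vk" "0 \<le> Vk" "\<kappa> ^ k * Vk \<le> 1 / 2"
    and K: "K = 2 * ((1 + 1 / \<delta>) * (exp \<theta> * C) * (\<Sum>i<k. (\<kappa> * C) ^ i)) * (exp \<theta> * C)"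
    and small: "sqrt K * \<epsilon> \<le> \<theta> / 2"
    and z: "cmod (z - of_real t) \<le> \<epsilon>" and m: "prof m"
  shows "Z z m \<noteq> 0"
proof -
  let ?t = "complex_of_real t"
  \<comment> \<open>What \<open>Z_lower_bound\<close> yields for |z| \<le> t + \<epsilon> and ratios
    bounded by exp \<theta>; the induction therefore reproduces the same constant.\<close>
  define c where "c = exp (- ((t + \<epsilon>) * V * exp \<theta>))"
  define \<rho> where "\<rho> = t + \<epsilon> + 2"
  define L1 where "L1 = 2 * (V * exp (\<rho> * V))"
  define L2 where "L2 = 2 * (V * exp (\<rho> * V) / (c / 2))"
  \<comment> \<open>The condition on \<open>L1\<close> keeps |Z| \<ge> c/2 up to distance 2d outside
    a good disc, the one on \<open>L2\<close> lets \<open>u\<close> drift by at most \<theta>/2 in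
    one step, and d \<le> 1 keeps moduli below \<rho>.\<close>
  define d where "d = min 1 (min (c / (2 * (L1 + 1))) (\<theta> / (2 * (L2 + 1))))"
  define good where "good = (\<lambda>z. lower z c \<and> (\<forall>m v. prof m \<longrightarrow> cmod (u z v m - u ?t v m) \<le> \<theta>))"
  have c: "0 < c" "0 < c / 2" "c \<le> 1" using t \<epsilon> by (simp_all add: c_def)
  have \<rho>: "0 \<le> \<rho>" using t \<epsilon> by (simp add: \<rho>_def)
  have L1: "0 \<le> L1" by (simp add: L1_def)
  have L2: "0 \<le> L2" using c by (simp add: L2_def)
  have d: "0 < d" unfolding d_def using c \<theta> L1 L2 by simp
  have L1d: "L1 * d \<le> c / 2"
  proof -
    have "L1 * d \<le> (L1 + 1) * (c / (2 * (L1 + 1)))"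
      using L1 d by (intro mult_mono) (simp_all add: d_def)
    then show ?thesis by (simp only: mult_divide_twice[OF L1])
  qed
  have L2d: "L2 * d \<le> \<theta> / 2"
  proof -
    have "L2 * d \<le> (L2 + 1) * (\<theta> / (2 * (L2 + 1)))"
      using L2 d by (intro mult_mono) (simp_all add: d_def)
    then show ?thesis by (simp only: mult_divide_twice[OF L2])
  qed
  have good_t: "good ?t"
    unfolding good_def lower_def using lowerD[OF lower_real[OF t]] c(3) \<theta> by (auto intro: order_trans)
  have all: "good z" if "cmod (z - ?t) \<le> \<epsilon>" "cmod (z - ?t) \<le> real n * d" for n z
    using that
  proof (induction n arbitrary: z)
    case 0
    then show ?case using good_t by simp
  next
    case (Suc n)
    define s where "s = min \<epsilon> (real n * d)"
    have s: "0 \<le> s" "s \<le> \<epsilon>" using \<epsilon> d by (simp_all add: s_def)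
    have G: "good w" if "cmod (w - ?t) \<le> s" for w
      using Suc.IH[of w] that by (simp add: s_def)
    have near: "\<exists>w1. cmod (w1 - ?t) \<le> s \<and> cmod (w - w1) \<le> e" if "cmod (w - ?t) \<le> s + e" "0 \<le> e" for w e
    proof (cases "cmod (w - ?t) \<le> s")
      case True
      then show ?thesis using that by (intro exI[of _ w]) simp
    next
      case False
      then have pos: "0 < cmod (w - ?t)" using s by linarith
      define a where "a = s / cmod (w - ?t)"
      have a: "0 \<le> a" "a \<le> 1" "a * cmod (w - ?t) = s" using False s pos by (simp_all add: a_def)
      let ?w1 = "?t + of_real a * (w - ?t)"
      have "cmod (?w1 - ?t) = s" using a by (simp add: norm_mult)
      moreover have "cmod (w - ?w1) \<le> e"
      proof -
        have "w - ?w1 = of_real (1 - a) * (w - ?t)" by (simp add: algebra_simps)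
        then have "cmod (w - ?w1) = (1 - a) * cmod (w - ?t)"
          using a by (simp add: norm_mult del: of_real_diff)
        also have "\<dots> = cmod (w - ?t) - s" using a by (simp add: algebra_simps)
        finally show ?thesis using that by simp
      qed
      ultimately show ?thesis by (intro exI[of _ ?w1]) simp
    qed
    have bnd: "cmod w \<le> \<rho>" if "cmod (w - ?t) \<le> s + 2 * d" for w
      using norm_triangle_sub[of w ?t] that s t by (simp add: \<rho>_def d_def)
    \<comment> \<open>The margin is 2d because each point of the enlarged disc of radius s + d still
      needs a disc of radius d around it in which \<open>u\<close> can be differentiated.\<close>
    have low2: "lower w (c / 2)" if w: "cmod (w - ?t) \<le> s + 2 * d" for w
      unfolding lower_def
    proof (intro allI impI)
      fix q assume q: "prof q"
      obtain w1 where w1: "cmod (w1 - ?t) \<le> s" "cmod (w - w1) \<le> 2 * d" using near[OF w] d by auto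
      have w1': "cmod (w1 - ?t) \<le> s + 2 * d" using w1 d by simp
      have "cmod (Z w1 q - Z w q) \<le> V * exp (\<rho> * V) * cmod (w1 - w)"
        by (rule Z_prof_lipschitz[OF q bnd[OF w1'] bnd[OF w]])
      also have "\<dots> \<le> V * exp (\<rho> * V) * (2 * d)"
        using w1 by (intro mult_left_mono) (simp_all add: norm_minus_commute)
      also have "\<dots> = L1 * d" by (simp add: L1_def)
      finally have "cmod (Z w1 q - Z w q) \<le> c / 2" using L1d by simp
      moreover have "c \<le> cmod (Z w1 q)" using G[OF w1(1)] q by (simp add: good_def lowerD)
      ultimately show "c / 2 \<le> cmod (Z w q)" using norm_triangle_ineq2[of "Z w1 q" "Z w q"] by linarith
    qed
    have ball_low: "lower w' (c / 2)" if "cmod (w - ?t) \<le> s + d" "w' \<in> ball w d" for w w'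
    proof (rule low2)
      have "cmod (w' - ?t) \<le> cmod (w' - w) + cmod (w - ?t)" by (metis diff_add_cancel add_diff_eq norm_triangle_ineq)
      then show "cmod (w' - ?t) \<le> s + 2 * d" using that by (simp add: dist_norm norm_minus_commute)
    qed
    \<comment> \<open>Inside the good disc the contraction bounds the derivative by sqrt K,
      independently of the region, and uses up only half of \<theta>. The other half pays for the
      outer layer, where only the bound \<open>L2\<close> is available.\<close>
    have inner: "cmod (u w v q - u ?t v q) \<le> \<theta> / 2" if w: "cmod (w - ?t) \<le> s" and q: "prof q" for w v q
    proof -
      have "cmod (u w v q - u ?t v q) \<le> sqrt K * cmod (w - ?t)"
      proof (rule field_differentiable_bound[where S="cball ?t s" and f'="\<lambda>w. du w v q"])
        fix w' assume "w' \<in> cball ?t s"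
        then have w': "cmod (w' - ?t) \<le> s" by (simp add: dist_norm norm_minus_commute)
        then have w'': "cmod (w' - ?t) \<le> s + d" using d by simp
        show "((\<lambda>w. u w v q) has_field_derivative du w' v q) (at w' within cball ?t s)"
          using u_has_field_derivative(1)[OF d c(2) ball_low[OF w''] q] has_field_derivative_at_within by blast
        have "(cmod (du w' v q))\<^sup>2 \<le> K"
          unfolding K
        proof (rule du_contraction[OF t \<delta> d c(2) ball_low[OF w''] _ _ \<kappa> Vk q])
          show "cmod (w' - ?t) \<le> \<epsilon>" using w' s by simp
          show "cmod (u w' v m - u ?t v m) \<le> \<theta>" if "prof m" for v m
            using G[OF w'] that by (simp add: good_def)
        qed
        then show "cmod (du w' v q) \<le> sqrt K" by (rule real_le_rsqrt)
      qed (use w s in \<open>auto simp: dist_norm norm_minus_commute\<close>)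
      also have "\<dots> \<le> sqrt K * \<epsilon>"
      proof (rule mult_left_mono)
        have "0 \<le> \<kappa>" unfolding \<kappa> using t \<delta> \<epsilon> C_nonneg by simp
        then have "0 \<le> K" unfolding K using \<delta> C_nonneg by (intro mult_nonneg_nonneg sum_nonneg) simp_all
        then show "0 \<le> sqrt K" by simp
      qed (use w s in simp)
      finally show ?thesis using small by simp
    qed
    have zs: "cmod (z - ?t) \<le> s + d" using Suc.prems d by (auto simp: s_def algebra_simps)
    then have zs': "cmod (z - ?t) \<le> s + 2 * d" using d by simp
    obtain z1 where z1: "cmod (z1 - ?t) \<le> s" "cmod (z - z1) \<le> d" using near[OF zs] d by auto
    have close: "cmod (u z v q - u ?t v q) \<le> \<theta>" if q: "prof q" for v q
    proof -
      have "cmod (u z v q - u z1 v q) \<le> L2 * cmod (z - z1)"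
      proof (rule field_differentiable_bound[where S="cball ?t (s + d)" and f'="\<lambda>w. du w v q"])
        fix w assume "w \<in> cball ?t (s + d)"
        then have w: "cmod (w - ?t) \<le> s + d" by (simp add: dist_norm norm_minus_commute)
        then have w': "cmod (w - ?t) \<le> s + 2 * d" using d by simp
        show "((\<lambda>w. u w v q) has_field_derivative du w v q) (at w within cball ?t (s + d))"
          using u_has_field_derivative(1)[OF d c(2) ball_low[OF w] q] has_field_derivative_at_within by blast
        show "cmod (du w v q) \<le> L2"
          unfolding L2_def by (rule norm_du_le[OF low2[OF w'] c(2) q bnd[OF w']])
      qed (use zs z1 d in \<open>auto simp: dist_norm norm_minus_commute\<close>)
      also have "\<dots> \<le> L2 * d" using z1 L2 by (intro mult_left_mono) simp_all
      finally have "cmod (u z v q - u z1 v q) \<le> \<theta> / 2" using L2d by simp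
      then show ?thesis
        using inner[OF z1(1) q, of v] norm_triangle_ineq[of "u z v q - u z1 v q" "u z1 v q - u ?t v q"] by simp
    qed
    have R: "cmod (ratio z v q) \<le> exp \<theta>" if q: "prof q" for v q
      by (rule near_real(1)[OF t c(2) low2[OF zs'] Suc.prems(1) close q])
    \<comment> \<open>Here c/2 is raised to c again: the conclusion of \<open>Z_lower_bound\<close>
      involves the bound on ratios, not the lower bound that was assumed.\<close>
    have "lower z c"
      unfolding lower_def
    proof (intro allI impI)
      fix q assume q: "prof q"
      have "cmod z \<le> t + \<epsilon>" using norm_triangle_sub[of z ?t] Suc.prems(1) t by simp
      then have "cmod z * (V * exp \<theta>) \<le> (t + \<epsilon>) * (V * exp \<theta>)" by (intro mult_right_mono) simp_all
      then have "c \<le> exp (- cmod z * V * exp \<theta>)" by (simp add: c_def mult.assoc)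
      also have "\<dots> \<le> cmod (Z z q)" by (rule Z_lower_bound[OF low2[OF zs'] c(2) R q])
      finally show "c \<le> cmod (Z z q)" .
    qed
    then show ?case using close by (simp add: good_def)
  qed
  obtain n where "\<epsilon> / d < real n" using reals_Archimedean2 by blast
  then have "\<epsilon> \<le> real n * d" using d by (simp add: field_simps)
  then have "good z" using all[OF z, of n] z by simp
  then show ?thesis using Z_nonzero[OF _ c(1) m] by (simp add: good_def)
qed

end

section \<open>A zero-free disc common to all regions\<close>

context boltzmann_factor
begin

text \<open>The radius is fixed before the region. A single small s serves as \<delta>, as \<theta>
  and as an upper limit for \<epsilon>, since the perturbed contraction factor is continuous in s
  with value t/e < \<kappa>0 at 0.\<close>

lemma exists_zero_free_radius:
  assumes C: "\<And>v. (\<integral>\<^sup>+x. ennreal (1 - b x v) \<partial>lborel) \<le> ennreal C" "0 \<le> C"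
    and t: "0 \<le> t" and \<kappa>0: "t * exp (- 1) < \<kappa>0"
    and Vk: "\<And>v m. profile UNIV m \<Longrightarrow> walk k v m \<le> ennreal Vk" "0 \<le> Vk" "\<kappa>0 ^ k * Vk \<le> 1 / 2"
  shows "\<exists>\<epsilon>>0. \<forall>B m z. B \<in> sets borel \<longrightarrow> bounded B \<longrightarrow> profile B m \<longrightarrow>
    cmod (z - of_real t) \<le> \<epsilon> \<longrightarrow> Z z m \<noteq> 0"
proof -
  let ?g = "\<lambda>s. (1 + s) * (t + s) * (exp (2 * s) * (exp (- 1) + s * C))"
  have "(?g \<longlongrightarrow> ?g 0) (at_right 0)" by (intro tendsto_intros)
  moreover have "?g 0 < \<kappa>0" using \<kappa>0 by simp
  ultimately have "\<forall>\<^sub>F s in at_right 0. ?g s < \<kappa>0" by (rule order_tendstoD(2))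
  moreover have "\<forall>\<^sub>F s::real in at_right 0. 0 < s" by (simp add: eventually_at_right_less)
  ultimately obtain s where s: "?g s < \<kappa>0" "0 < s"
    using eventually_happens'[OF _ eventually_conj] trivial_limit_at_right_real by blast
  \<comment> \<open>Formed with \<kappa>0 because the actual \<kappa> depends on \<epsilon>, which
    is about to be chosen in terms of this constant.\<close>
  define K0 where "K0 = 2 * ((1 + 1 / s) * (exp s * C) * (\<Sum>i<k. (\<kappa>0 * C) ^ i)) * (exp s * C)"
  have \<kappa>00: "0 \<le> \<kappa>0" using \<kappa>0 t by (meson exp_ge_zero less_imp_le mult_nonneg_nonneg order_trans)
  have K0: "0 \<le> K0" unfolding K0_def using s C(2) \<kappa>00 by (intro mult_nonneg_nonneg sum_nonneg) simp_all
  define \<epsilon> where "\<epsilon> = min s (s / (2 * (sqrt K0 + 1)))"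
  have \<epsilon>: "0 < \<epsilon>" "\<epsilon> \<le> s" using s K0 by (simp_all add: \<epsilon>_def add_nonneg_pos)
  define \<kappa> where "\<kappa> = (1 + s) * (t + \<epsilon>) * (exp (2 * s) * (exp (- 1) + \<epsilon> * C))"
  have "\<kappa> \<le> ?g s"
    unfolding \<kappa>_def using \<epsilon> s t C(2) by (intro mult_mono add_mono) simp_all
  then have "\<kappa> \<le> \<kappa>0" using s(1) by linarith
  moreover have "0 \<le> \<kappa>" unfolding \<kappa>_def using s(2) \<epsilon> t C(2) by simp
  ultimately have \<kappa>: "0 \<le> \<kappa>" "\<kappa> \<le> \<kappa>0" by simp_all
  define K where "K = 2 * ((1 + 1 / s) * (exp s * C) * (\<Sum>i<k. (\<kappa> * C) ^ i)) * (exp s * C)"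
  have "K \<le> K0"
    unfolding K_def K0_def using \<kappa> C(2) s
    by (intro mult_right_mono mult_left_mono sum_mono power_mono) simp_all
  then have "sqrt K \<le> sqrt K0 + 1" using real_sqrt_le_mono[of K K0] by linarith
  then have "sqrt K * \<epsilon> \<le> (sqrt K0 + 1) * (s / (2 * (sqrt K0 + 1)))"
    using \<epsilon> K0 by (intro mult_mono) (simp_all add: \<epsilon>_def)
  also have "\<dots> = s / 2" by (rule mult_divide_twice[OF real_sqrt_ge_zero[OF K0]])
  finally have small: "sqrt K * \<epsilon> \<le> s / 2" .
  have Vk3: "\<kappa> ^ k * Vk \<le> 1 / 2"
    using mult_right_mono[OF power_mono[OF \<kappa>(2,1), of k] Vk(2)] Vk(3) by simp
  show ?thesis
  proof (intro exI[of _ \<epsilon>] conjI allI impI)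
    fix B m z
    assume B: "B \<in> sets borel" "bounded B" and m: "profile B m" and z: "cmod (z - of_real t) \<le> \<epsilon>"
    interpret tempered_region b B C
      by unfold_locales (use B C in auto)
    show "Z z m \<noteq> 0"
      by (rule Z_zero_free[OF t s(2) s(2) less_imp_le[OF \<epsilon>(1)] \<kappa>_def Vk(1,2) Vk3 K_def small z m])
  qed (rule \<epsilon>(1))
qed

end

section \<open>Thermodynamic limit\<close>

text \<open>The common core of Fekete's argument for V_k and for the pressure: every single value a
  k bounds the whole sequence from above, up to an error that disappears in the limit.\<close>

lemma tendsto_Inf_of_bounds:
  fixes a :: "nat \<Rightarrow> real"
  assumes nn: "\<And>n. 1 \<le> n \<Longrightarrow> 0 \<le> a n"
    and bd: "\<And>k x. 1 \<le> k \<Longrightarrow> a k < x \<Longrightarrow> \<exists>c. c \<longlonglongrightarrow> x \<and> (\<forall>n\<ge>1. a n \<le> c n)"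
  shows "a \<longlonglongrightarrow> Inf (a ` {1..})"
proof (rule order_tendstoI)
  have bdd: "bdd_below (a ` {1..})" using nn by (auto intro!: bdd_belowI[of _ 0])
  fix y
  show "\<forall>\<^sub>F n in sequentially. y < a n" if "y < Inf (a ` {1..})"
  proof (rule eventually_sequentiallyI[of 1])
    fix n :: nat assume "1 \<le> n"
    then have "Inf (a ` {1..}) \<le> a n" by (intro cInf_lower[OF _ bdd]) auto
    with that show "y < a n" by simp
  qed
  show "\<forall>\<^sub>F n in sequentially. a n < y" if y: "Inf (a ` {1..}) < y"
  proof -
    obtain x where x: "Inf (a ` {1..}) < x" "x < y" using dense[OF y] by blast
    obtain k where k: "1 \<le> k" "a k < x" using x(1) cInf_less_iff[OF _ bdd, of x] by auto
    obtain c where c: "c \<longlonglongrightarrow> x" "\<forall>n\<ge>1. a n \<le> c n" using bd[OF k] by blast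
    have "\<forall>\<^sub>F n in sequentially. c n < y" by (rule order_tendstoD(2)[OF c(1) x(2)])
    moreover have "\<forall>\<^sub>F n in sequentially. 1 \<le> n" by (rule eventually_ge_at_top)
    ultimately show ?thesis
    proof eventually_elim
      case (elim n)
      then show ?case using c(2)[rule_format, of n] by linarith
    qed
  qed
qed

text \<open>Division of n by k with remainder gives v n \<le> x^n D, where D absorbs the finitely
  many remainders and its n-th root tends to 1. The summand 1 keeps D positive.\<close>

lemma submultiplicative_root_convergent:
  fixes v :: "nat \<Rightarrow> real"
  assumes nn: "\<And>n. 0 \<le> v n" and sub: "\<And>j k. v (j + k) \<le> v j * v k"
  shows "convergent (\<lambda>n. root n (v n))"
proof -
  have "(\<lambda>n. root n (v n)) \<longlonglongrightarrow> Inf ((\<lambda>n. root n (v n)) ` {1..})"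
  proof (rule tendsto_Inf_of_bounds)
    show "0 \<le> root n (v n)" for n using nn by (simp add: real_root_ge_zero)
    fix k :: nat and x :: real
    assume k: "1 \<le> k" and x: "root k (v k) < x"
    have x0: "0 < x" using x real_root_ge_zero[OF nn[of k], of k] by linarith
    have vk: "v k \<le> x ^ k"
    proof -
      have "v k = root k (v k) ^ k" using k nn by simp
      also have "\<dots> \<le> x ^ k" using x nn by (intro power_mono real_root_ge_zero) simp_all
      finally show ?thesis .
    qed
    define D where "D = 1 + (\<Sum>r<k. v r / x ^ r)"
    have D1: "1 \<le> D" unfolding D_def using nn x0 by (simp add: sum_nonneg)
    have qk: "v (q * k + r) \<le> x ^ (q * k) * v r" for q r
    proof (induction q)
      case (Suc q)
      have "v (Suc q * k + r) \<le> v k * v (q * k + r)" using sub[of k "q * k + r"] by (simp add: add.assoc)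
      also have "\<dots> \<le> x ^ k * (x ^ (q * k) * v r)" using vk Suc nn x0 by (intro mult_mono) simp_all
      finally show ?case by (simp add: power_add mult.assoc)
    qed simp
    have bound: "root n (v n) \<le> x * root n D" if n: "1 \<le> n" for n
    proof -
      let ?r = "n mod k"
      have r: "?r < k" using k by simp
      have "v ?r / x ^ ?r \<le> (\<Sum>r<k. v r / x ^ r)"
        using r nn x0 by (intro member_le_sum[where f="\<lambda>r. v r / x ^ r"]) simp_all
      then have "v ?r / x ^ ?r \<le> D" by (simp add: D_def)
      then have "v ?r \<le> x ^ ?r * D" using x0 by (simp add: divide_le_eq mult.commute)
      then have "x ^ (n div k * k) * v ?r \<le> x ^ (n div k * k) * (x ^ ?r * D)" using x0 by (intro mult_left_mono) simp_all
      also have "\<dots> = x ^ n * D" by (simp add: mult.assoc[symmetric] power_add[symmetric])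
      finally have "v n \<le> x ^ n * D" using qk[of "n div k" ?r] by simp
      then have "root n (v n) \<le> root n (x ^ n * D)" using n by (intro real_root_le_mono) simp_all
      also have "\<dots> = x * root n D" using n x0 by (simp add: real_root_mult real_root_power_cancel)
      finally show ?thesis .
    qed
    have "0 < D" using D1 by linarith
    from tendsto_mult_left[OF LIMSEQ_root_const[OF this], of x]
    have "(\<lambda>n. x * root n D) \<longlonglongrightarrow> x" by (simp only: mult_1_right)
    with bound show "\<exists>c. c \<longlonglongrightarrow> x \<and> (\<forall>n\<ge>1. root n (v n) \<le> c n)"
      by blast
  qed
  then show ?thesis by (rule convergentI)
qed

section \<open>Subadditivity and translation invariance\<close>

context boltzmann_factor
begin

lemma tilt_add: "tilt y (\<lambda>x. m x + m' x) = (\<lambda>x. tilt y m x + tilt y m' x)"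
  by (simp add: tilt_def algebra_simps)

lemma act_add: "act m \<Longrightarrow> act m' \<Longrightarrow> act (\<lambda>x. m x + m' x)"
  by (rule actI) simp_all

text \<open>Each particle belongs to \<open>m\<close> or to \<open>m'\<close>, and dropping the
  repulsion between the two groups only increases the integral. In the induction, the tilt caused by
  the integrated point is kept in its own group and estimated by 1 in the other.\<close>

lemma W_convolution:
  assumes "act m" "act m'"
  shows "W k (\<lambda>x. m x + m' x) / fact k \<le> (\<Sum>j\<le>k. (W j m / fact j) * (W (k - j) m' / fact (k - j)))"
  using assms
proof (induction k arbitrary: m m')
  case (Suc k)
  note m = Suc.prems
  note [measurable] = m[THEN act_measurable]
  define w where "w = (\<lambda>j m. W j m / fact j)"
  have w0: "0 \<le> w j m" if "act m" for j m unfolding w_def using that by simp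
  have wS: "(\<integral>y. m y * w j (tilt y m) \<partial>lborel) = real (Suc j) * w (Suc j) m" if "act m" for j m
    using W_Suc(2)[OF that, of j] by (simp add: w_def del: of_nat_Suc)
  have iS: "integrable lborel (\<lambda>y. m y * w j (tilt y m))" if "act m" for j m
    using W_Suc(1)[OF that, of j] by (simp add: w_def)
  have mono: "w j (tilt y m) \<le> w j m" if "act m" for j m y
    unfolding w_def by (intro divide_right_mono W_mono act_tilt that tilt_le) simp
  have [measurable]: "(\<lambda>y. w j (tilt y m)) \<in> borel_measurable borel" if [measurable]: "m \<in> borel_measurable borel" for j m
    unfolding w_def by measurable
  have wb: "\<bar>w j (tilt y m)\<bar> \<le> w j m" if "act m" for j m y
    using mono[OF that] w0[OF act_tilt[OF that]] by simp
  have wwb: "\<bar>w j (tilt y m) * w i (tilt y m')\<bar> \<le> w j m * w i m'" for i j y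
    unfolding abs_mult using wb[OF m(1)] wb[OF m(2)] w0[OF m(1)] by (intro mult_mono) simp_all
  have i1: "integrable lborel (\<lambda>y. m y * (w j (tilt y m) * w i (tilt y m')))" for i j
    by (rule act_integrable_mult[OF m(1) _ wwb]) measurable
  have i2: "integrable lborel (\<lambda>y. m' y * (w j (tilt y m) * w i (tilt y m')))" for i j
    by (rule act_integrable_mult[OF m(2) _ wwb]) measurable
  let ?p = "\<lambda>j y. w j (tilt y m) * w (k - j) (tilt y m')"
  have sum_act: "act (\<lambda>x. m x + m' x)" by (rule act_add[OF m])
  have "real (Suc k) * w (Suc k) (\<lambda>x. m x + m' x) =
     (\<integral>y. (m y + m' y) * w k (tilt y (\<lambda>x. m x + m' x)) \<partial>lborel)"
    by (rule wS[OF sum_act, symmetric])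
  also have "\<dots> \<le> (\<integral>y. (\<Sum>j\<le>k. m y * ?p j y
       + m' y * ?p j y) \<partial>lborel)"
  proof (rule integral_mono[OF iS[OF sum_act]])
    show "integrable lborel (\<lambda>y. \<Sum>j\<le>k. m y * ?p j y
       + m' y * ?p j y)"
      using i1 i2 by (intro Bochner_Integration.integrable_sum Bochner_Integration.integrable_add)
    fix y
    have "w k (tilt y (\<lambda>x. m x + m' x)) \<le> (\<Sum>j\<le>k. ?p j y)"
      unfolding w_def tilt_add by (rule Suc.IH) (use m in simp_all)
    then have "(m y + m' y) * w k (tilt y (\<lambda>x. m x + m' x)) \<le>
        (m y + m' y) * (\<Sum>j\<le>k. ?p j y)"
      using act_nonneg[OF m(1), of y] act_nonneg[OF m(2), of y] by (intro mult_left_mono) simp_all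
    also have "\<dots> = (\<Sum>j\<le>k. m y * ?p j y
       + m' y * ?p j y)"
      by (simp add: sum_distrib_left distrib_right)
    finally show "(m y + m' y) * w k (tilt y (\<lambda>x. m x + m' x)) \<le> \<dots>" .
  qed
  also have "\<dots> = (\<Sum>j\<le>k. (\<integral>y. m y * ?p j y \<partial>lborel)
       + (\<integral>y. m' y * ?p j y \<partial>lborel))"
    using i1 i2 by (simp add: Bochner_Integration.integral_sum)
  also have "\<dots> \<le> (\<Sum>j\<le>k. real (Suc j) * (w (Suc j) m * w (k - j) m') + real (Suc k - j) * (w j m * w (Suc k - j) m'))"
  proof (intro sum_mono add_mono)
    fix j assume j: "j \<in> {..k}"
    have "(\<integral>y. m y * ?p j y \<partial>lborel) \<le>
        (\<integral>y. (m y * w j (tilt y m)) * w (k - j) m' \<partial>lborel)"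
    proof (rule integral_mono[OF i1])
      show "integrable lborel (\<lambda>y. (m y * w j (tilt y m)) * w (k - j) m')" using iS[OF m(1)] by simp
      show "m y * ?p j y \<le> (m y * w j (tilt y m)) * w (k - j) m'" for y
        unfolding mult.assoc[symmetric] using m w0 mono[OF m(2)] by (intro mult_left_mono) simp_all
    qed
    also have "\<dots> = real (Suc j) * (w (Suc j) m * w (k - j) m')"
      using wS[OF m(1), of j] by simp
    finally show "(\<integral>y. m y * ?p j y \<partial>lborel) \<le> \<dots>" .
    have "(\<integral>y. m' y * ?p j y \<partial>lborel) \<le>
        (\<integral>y. w j m * (m' y * w (k - j) (tilt y m')) \<partial>lborel)"
    proof (rule integral_mono[OF i2])
      show "integrable lborel (\<lambda>y. w j m * (m' y * w (k - j) (tilt y m')))" using iS[OF m(2)] by simp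
      show "m' y * ?p j y \<le> w j m * (m' y * w (k - j) (tilt y m'))" for y
        using mult_right_mono[OF mono[OF m(1), of j y], of "m' y * w (k - j) (tilt y m')"] m w0
        by (simp add: mult_ac)
    qed
    also have "\<dots> = w j m * (\<integral>y. m' y * w (k - j) (tilt y m') \<partial>lborel)"
      by (rule integral_mult_right_zero)
    also have "\<dots> = real (Suc k - j) * (w j m * w (Suc k - j) m')"
      unfolding wS[OF m(2), of "k - j"] using j by (simp add: Suc_diff_le mult_ac)
    finally show "(\<integral>y. m' y * ?p j y \<partial>lborel) \<le> \<dots>" .
  qed
  \<comment> \<open>The weights j and Suc k - j count the choices of the integrated point in the two
    groups; they sum to \<open>Suc k\<close>, which then cancels.\<close>
  also have "\<dots> = (\<Sum>j\<le>Suc k. real j * (w j m * w (Suc k - j) m')) + (\<Sum>j\<le>Suc k. real (Suc k - j) * (w j m * w (Suc k - j) m'))"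
  proof -
    have "(\<Sum>j\<le>Suc k. real j * (w j m * w (Suc k - j) m')) = (\<Sum>j\<le>k. real (Suc j) * (w (Suc j) m * w (k - j) m'))"
      by (subst sum.atMost_Suc_shift) simp
    then show ?thesis by (simp add: sum.distrib)
  qed
  also have "\<dots> = (\<Sum>j\<le>Suc k. real (Suc k) * (w j m * w (Suc k - j) m'))"
    unfolding sum.distrib[symmetric] distrib_right[symmetric]
    by (intro sum.cong refl arg_cong2[where f="(*)"]) (simp flip: of_nat_add)
  also have "\<dots> = real (Suc k) * (\<Sum>j\<le>Suc k. w j m * w (Suc k - j) m')"
    by (rule sum_distrib_left[symmetric])
  finally have "w (Suc k) (\<lambda>x. m x + m' x) \<le> (\<Sum>j\<le>Suc k. w j m * w (Suc k - j) m')"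
    by (rule mult_left_le_imp_le) simp
  then show ?case by (simp only: w_def)
qed simp

lemma ZR_mono:
  assumes "act m" "act m'" "\<And>x. m' x \<le> m x" "0 \<le> t"
  shows "ZR t m' \<le> ZR t m"
  unfolding ZR_def
  by (intro suminf_le ZR_summable mult_right_mono divide_right_mono W_mono assms) (use assms in simp_all)

text \<open>The Cauchy product of the two series dominates the series of the sum. The supports of
  the profiles may overlap.\<close>

lemma ZR_add_le:
  assumes m: "act m" "act m'" and t: "0 \<le> t"
  shows "ZR t (\<lambda>x. m x + m' x) \<le> ZR t m * ZR t m'"
proof -
  let ?a = "\<lambda>m k. W k m / fact k * t ^ k"
  have s: "summable (\<lambda>k. norm (?a m k))" if "act m" for m
    using ZR_summable[OF that, of t] that t by simp
  have "ZR t m * ZR t m' = (\<Sum>k. \<Sum>j\<le>k. ?a m j * ?a m' (k - j))"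
    unfolding ZR_def by (rule Cauchy_product[OF s[OF m(1)] s[OF m(2)]])
  moreover have "ZR t (\<lambda>x. m x + m' x) \<le> (\<Sum>k. \<Sum>j\<le>k. ?a m j * ?a m' (k - j))"
    unfolding ZR_def
  proof (rule suminf_le[OF _ ZR_summable[OF act_add[OF m]] summable_Cauchy_product[OF s[OF m(1)] s[OF m(2)]]])
    fix k
    have "?a (\<lambda>x. m x + m' x) k \<le> (\<Sum>j\<le>k. (W j m / fact j) * (W (k - j) m' / fact (k - j))) * t ^ k"
      using W_convolution[OF m] t by (intro mult_right_mono) simp_all
    also have "\<dots> = (\<Sum>j\<le>k. ?a m j * ?a m' (k - j))"
      unfolding sum_distrib_right
    proof (intro sum.cong refl)
      fix j assume "j \<in> {..k}"
      then have "t ^ k = t ^ j * t ^ (k - j)" by (simp add: power_add[symmetric])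
      then show "(W j m / fact j) * (W (k - j) m' / fact (k - j)) * t ^ k = ?a m j * ?a m' (k - j)"
        by simp
    qed
    finally show "?a (\<lambda>x. m x + m' x) k \<le> (\<Sum>j\<le>k. ?a m j * ?a m' (k - j))" .
  qed
  ultimately show ?thesis by simp
qed

lemma ZR_sum_le:
  assumes "finite I" "\<And>i. i \<in> I \<Longrightarrow> act (m i)" "0 \<le> t"
  shows "act (\<lambda>x. \<Sum>i\<in>I. m i x) \<and> ZR t (\<lambda>x. \<Sum>i\<in>I. m i x) \<le> (\<Prod>i\<in>I. ZR t (m i))"
  using assms(1,2)
proof (induction I)
  case empty
  have "act (\<lambda>x. 0)" by (rule actI) simp_all
  moreover have "ZR t (\<lambda>x. 0) = 1"
    using Z_of_real[OF \<open>act (\<lambda>x. 0)\<close>, of t] by simp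
  ultimately show ?case by simp
next
  case (insert i I)
  then have IH: "act (\<lambda>x. \<Sum>i\<in>I. m i x)" "ZR t (\<lambda>x. \<Sum>i\<in>I. m i x) \<le> (\<Prod>i\<in>I. ZR t (m i))" by auto
  have mi: "act (m i)" using insert by simp
  have "ZR t (\<lambda>x. m i x + (\<Sum>i\<in>I. m i x)) \<le> ZR t (m i) * ZR t (\<lambda>x. \<Sum>i\<in>I. m i x)"
    by (rule ZR_add_le[OF mi IH(1) assms(3)])
  also have "\<dots> \<le> ZR t (m i) * (\<Prod>i\<in>I. ZR t (m i))"
    using IH(2) ZR_ge_1[OF mi assms(3)] by (intro mult_left_mono) simp_all
  finally show ?case using insert act_add[OF mi IH(1)] by simp
qed

lemma W_translate:
  assumes inv: "\<And>x y a. b (x + a) (y + a) = b x y" and m: "act m"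
  shows "act (\<lambda>x. m (x + a)) \<and> W k (\<lambda>x. m (x + a)) = W k m"
proof -
  have tr: "act (\<lambda>x. m (x + a))" if "act m" for m
  proof -
    note [measurable] = act_measurable[OF that]
    have "integrable (distr lborel borel ((+) a)) m" unfolding lborel_distr_plus using that by simp
    then have "integrable lborel (\<lambda>x. m (a + x))" by (subst (asm) integrable_distr_eq) auto
    then have "integrable lborel (\<lambda>x. m (x + a))" by (simp only: add.commute)
    then show ?thesis by (rule actI) (rule act_nonneg[OF that])
  qed
  have tri: "(\<integral>y. h (y + a) \<partial>lborel) = (\<integral>y. h y \<partial>lborel)" if [measurable]: "h \<in> borel_measurable borel" for h :: "'a \<Rightarrow> real"
    using integral_distr[of "(+) a" lborel borel h] by (simp add: lborel_distr_plus add.commute)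
  have "W k (\<lambda>x. m (x + a)) = W k m"
    using m
  proof (induction k arbitrary: m)
    case (Suc k)
    note [measurable] = act_measurable[OF Suc.prems]
    have tl: "tilt y (\<lambda>x. m (x + a)) = (\<lambda>x. tilt (y + a) m (x + a))" for y
      by (simp add: tilt_def inv)
    have "W (Suc k) (\<lambda>x. m (x + a)) = (\<integral>y. m (y + a) * W k (tilt (y + a) m) \<partial>lborel)"
      unfolding W_Suc(2)[OF tr[OF Suc.prems]] tl
      using Suc.IH[OF act_tilt[OF Suc.prems]] by simp
    also have "\<dots> = (\<integral>y. m y * W k (tilt y m) \<partial>lborel)" by (rule tri) measurable
    finally show ?case using W_Suc(2)[OF Suc.prems, of k] by simp
  qed simp
  with tr[OF m] show ?thesis by simp
qed

lemma ZR_translate: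
  assumes inv: "\<And>x y a. b (x + a) (y + a) = b x y" and m: "act m"
  shows "ZR t (\<lambda>x. m (x + a)) = ZR t m"
  unfolding ZR_def using W_translate[OF assms] by simp

end

section \<open>Cubes and the limit of the finite-volume pressures\<close>

definition cube :: "real \<Rightarrow> 'a::euclidean_space set" where
  "cube s = cbox (- (s / 2) *\<^sub>R One) ((s / 2) *\<^sub>R One)"

lemma mem_cube: "x \<in> cube s \<longleftrightarrow> (\<forall>i\<in>Basis. - (s / 2) \<le> x \<bullet> i \<and> x \<bullet> i \<le> s / 2)"
  by (simp add: cube_def mem_box)

lemma cube_borel [measurable]: "cube s \<in> sets borel"
  and cube_bounded: "bounded (cube s)"
  by (simp_all add: cube_def bounded_cbox)

lemma measure_cube: "0 \<le> s \<Longrightarrow> measure lborel (cube s :: 'a::euclidean_space set) = s ^ DIM('a)"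
  by (simp add: cube_def content_cbox_if box_eq_empty inner_diff_left)

lemma interval_cell:
  fixes y s :: real
  assumes s: "0 < s" and N: "0 < N" and y: "- (real N * s / 2) \<le> y" "y \<le> real N * s / 2"
  shows "\<exists>k<N. \<bar>y - ((real k + 1 / 2) * s - real N * s / 2)\<bar> \<le> s / 2"
proof -
  define q where "q = (y + real N * s / 2) / s"
  have q: "0 \<le> q" "q \<le> real N" "y = q * s - real N * s / 2"
    using s y by (simp_all add: q_def field_simps)
  \<comment> \<open>The minimum assigns the right end point q = N to the last cell.\<close>
  define k where "k = min (nat \<lfloor>q\<rfloor>) (N - 1)"
  have k: "real k \<le> q" "q \<le> real k + 1"
  proof -
    have f: "real (nat \<lfloor>q\<rfloor>) \<le> q" "q \<le> real (nat \<lfloor>q\<rfloor>) + 1" using q(1) by linarith+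
    show "real k \<le> q" using f(1) by (simp add: k_def min_def)
    show "q \<le> real k + 1"
      using f(2) q(2) N by (auto simp: k_def min_def of_nat_diff)
  qed
  have "\<bar>q - (real k + 1 / 2)\<bar> \<le> 1 / 2" using k by linarith
  then have "\<bar>q - (real k + 1 / 2)\<bar> * s \<le> 1 / 2 * s" using s by (intro mult_right_mono) simp_all
  then have "\<bar>(q - (real k + 1 / 2)) * s\<bar> \<le> s / 2" using s by (simp add: abs_mult)
  moreover have "y - ((real k + 1 / 2) * s - real N * s / 2) = (q - (real k + 1 / 2)) * s"
    unfolding q(3) by (simp add: algebra_simps)
  moreover have "k < N" using N by (simp add: k_def)
  ultimately show ?thesis by auto
qed

context boltzmann_factor
begin

lemma act_indicator:
  assumes "S \<in> sets borel" "bounded S"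
  shows "act (indicat_real S)"
  by (rule profile_bounded_act(1)[OF assms]) (use assms(1) in \<open>simp add: profile_def\<close>)

text \<open>The closed cells share faces and may stick out of the large cube. Monotonicity and
  subadditivity for sums of profiles ask only that the indicators of the cells add up to at least
  that of the cube.\<close>

lemma ZR_cube_le:
  assumes inv: "\<And>x y a. b (x + a) (y + a) = b x y" and s: "0 < s" and N: "0 < N" "r \<le> real N * s" and t: "0 \<le> t"
  shows "ZR t (indicator (cube r)) \<le> ZR t (indicator (cube s)) ^ (N ^ DIM('a))"
proof -
  let ?I = "Pi\<^sub>E (Basis :: 'a set) (\<lambda>_. {..<N})"
  let ?y = "\<lambda>k. (real k + 1 / 2) * s - real N * s / 2"
  define c where "c = (\<lambda>k. \<Sum>i\<in>(Basis :: 'a set). ?y (k i) *\<^sub>R i)"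
  let ?m = "\<lambda>k x. indicat_real (cube s) (x + - c k)"
  have fin: "finite ?I" by (intro finite_PiE) simp_all
  have a0: "act (indicat_real (cube s'))" for s' by (rule act_indicator[OF cube_borel cube_bounded])
  have am: "act (?m k)" for k using W_translate[OF inv a0] by blast
  have cover: "indicat_real (cube r) x \<le> (\<Sum>k\<in>?I. ?m k x)" for x :: 'a
  proof (cases "x \<in> cube r")
    case True
    have "\<exists>k<N. \<bar>x \<bullet> i - ?y k\<bar> \<le> s / 2" if "i \<in> Basis" for i
    proof (rule interval_cell[OF s N(1)])
      have "- (r / 2) \<le> x \<bullet> i" "x \<bullet> i \<le> r / 2" using True that by (auto simp: mem_cube)
      then show "- (real N * s / 2) \<le> x \<bullet> i" "x \<bullet> i \<le> real N * s / 2" using N(2) by linarith+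
    qed
    then obtain k where k: "\<And>i. i \<in> Basis \<Longrightarrow> k i < N \<and> \<bar>x \<bullet> i - ?y (k i)\<bar> \<le> s / 2"
      by metis
    define k' where "k' = restrict k Basis"
    have k': "k' \<in> ?I" using k by (auto simp: k'_def)
    have "x + - c k' \<in> cube s"
      unfolding mem_cube
    proof
      fix i :: 'a assume i: "i \<in> Basis"
      have "c k' \<bullet> i = ?y (k i)"
        using i by (simp add: c_def k'_def inner_sum_left_Basis)
      then show "- (s / 2) \<le> (x + - c k') \<bullet> i \<and> (x + - c k') \<bullet> i \<le> s / 2"
        using k[OF i] unfolding abs_le_iff inner_add_left inner_minus_left by linarith
    qed
    then have "1 = ?m k' x" by simp
    also have "\<dots> \<le> (\<Sum>k\<in>?I. ?m k x)"
      by (rule member_le_sum[OF k' _ fin]) simp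
    finally show ?thesis using True by simp
  qed (simp add: sum_nonneg)
  have S: "act (\<lambda>x. \<Sum>k\<in>?I. ?m k x)" "ZR t (\<lambda>x. \<Sum>k\<in>?I. ?m k x) \<le> (\<Prod>k\<in>?I. ZR t (?m k))"
    using ZR_sum_le[OF fin am t] by auto
  have "ZR t (indicator (cube r)) \<le> ZR t (\<lambda>x. \<Sum>k\<in>?I. ?m k x)"
    by (rule ZR_mono[OF S(1) a0 cover t])
  also note S(2)
  also have "(\<Prod>k\<in>?I. ZR t (?m k)) = (\<Prod>k\<in>?I. ZR t (indicator (cube s)))"
    by (simp only: ZR_translate[OF inv a0])
  also have "\<dots> = ZR t (indicator (cube s)) ^ (N ^ DIM('a))"
    by (simp add: card_PiE)
  finally show ?thesis .
qed

lemma pressure_convergent: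
  assumes inv: "\<And>x y a. b (x + a) (y + a) = b x y" and t: "0 \<le> t"
  shows "convergent (\<lambda>n. ln (ZR t (indicator (cube (root DIM('a) (real n))))) / real n)"
proof -
  let ?d = "DIM('a)"
  let ?s = "\<lambda>n. root ?d (real n)"
  let ?L = "\<lambda>n. ln (ZR t (indicator (cube (?s n))))"
  let ?a = "\<lambda>n. ?L n / real n"
  have Z1: "1 \<le> ZR t (indicator (cube r))" for r
    by (rule ZR_ge_1[OF act_indicator[OF cube_borel cube_bounded] t])
  have L0: "0 \<le> ?L n" for n using Z1 by (simp add: ln_ge_zero)
  have "?a \<longlonglongrightarrow> Inf (?a ` {1..})"
  proof (rule tendsto_Inf_of_bounds)
    show "0 \<le> ?a n" for n using L0 by simp
    fix k :: nat and x :: real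
    assume k: "1 \<le> k" and x: "?a k < x"
    let ?q = "\<lambda>n. root ?d (real k / real n)"
    \<comment> \<open>Covering a cube of volume n by cubes of volume k takes at most s_n/s_k + 1 of
      them along each axis, with s_n the side length. This gives a_n \<le> (1 + s_k/s_n)^d a_k; the
      added constant moves the limit from a_k to x.\<close>
    let ?c = "\<lambda>n. (1 + ?q n) ^ ?d * ?a k + (x - ?a k)"
    have "(\<lambda>n. ?q n) \<longlonglongrightarrow> root ?d 0"
      by (intro tendsto_real_root lim_const_over_n)
    then have "?c \<longlonglongrightarrow> (1 + root ?d 0) ^ ?d * ?a k + (x - ?a k)" by (intro tendsto_intros)
    then have lim: "?c \<longlonglongrightarrow> x" by simp
    have "?a n \<le> ?c n" if n: "1 \<le> n" for n
    proof -
      have sk: "0 < ?s k" using k by simp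
      define N where "N = nat \<lceil>?s n / ?s k\<rceil>"
      have pos: "0 < ?s n / ?s k" using n k by simp
      have N: "0 < N" "?s n / ?s k \<le> real N" "real N \<le> ?s n / ?s k + 1"
        using pos unfolding N_def by linarith+
      have "?s n \<le> real N * ?s k" using N(2) sk by (simp add: divide_le_eq)
      from ZR_cube_le[OF inv sk N(1) this t]
      have "?L n \<le> ln (ZR t (indicator (cube (?s k))) ^ (N ^ ?d))"
        using Z1[of "?s n"] by (subst ln_le_cancel_iff) (use Z1[of "?s k"] in simp_all)
      also have "\<dots> = real N ^ ?d * ?L k" using Z1[of "?s k"] by (simp add: ln_realpow)
      finally have "?a n \<le> real N ^ ?d * ?L k / real n" by (rule divide_right_mono) simp
      also have "\<dots> = (real N * ?q n) ^ ?d * ?a k"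
        using n k by (simp add: power_mult_distrib)
      also have "\<dots> \<le> (1 + ?q n) ^ ?d * ?a k"
      proof (intro mult_right_mono power_mono)
        have "0 < ?s n" using n by simp
        then have q1: "?s n / ?s k * ?q n = 1" using sk by (simp add: real_root_divide)
        have "real N * ?q n \<le> (?s n / ?s k + 1) * ?q n" using N(3) by (intro mult_right_mono) simp_all
        also have "(?s n / ?s k + 1) * ?q n = 1 + ?q n" by (simp only: distrib_right q1 mult_1_left)
        finally show "real N * ?q n \<le> 1 + ?q n" .
      qed (use L0 in simp_all)
      finally show ?thesis using x by simp
    qed
    with lim show "\<exists>c. c \<longlonglongrightarrow> x \<and> (\<forall>n\<ge>1. ?a n \<le> c n)" by blast
  qed
  then show ?thesis by (rule convergentI)
qed

end

section \<open>Analyticity of the pressure\<close>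

lemma exp_neg_measurable [measurable]: "exp_neg \<in> borel_measurable borel"
  unfolding exp_neg_def by measurable

lemma exp_neg_nonneg [simp]: "0 \<le> exp_neg t"
  by (simp add: exp_neg_def)

lemma exp_neg_le_1: "0 \<le> t \<Longrightarrow> exp_neg t \<le> 1"
  by (simp add: exp_neg_def real_of_ereal_pos)

lemma exp_neg_0 [simp]: "exp_neg 0 = 1"
  by (simp add: exp_neg_def)

lemma exp_neg_add: "0 \<le> s \<Longrightarrow> 0 \<le> t \<Longrightarrow> exp_neg (s + t) = exp_neg s * exp_neg t"
  by (cases s; cases t) (auto simp: exp_neg_def exp_add[symmetric])

lemma exp_neg_sum:
  assumes "\<And>i. i \<in> A \<Longrightarrow> 0 \<le> f i"
  shows "exp_neg (\<Sum>i\<in>A. f i) = (\<Prod>i\<in>A. exp_neg (f i))"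
  using assms
  by (induction A rule: infinite_finite_induct) (simp_all add: exp_neg_add sum_nonneg)

text \<open>Two overlapping discs with real centres share a real interval between the centres. There
  both functions equal \<open>p\<close>, since a \<ge> 0 keeps the interval nonnegative. The
  intersection is convex, so the identity theorem extends the agreement to all of it.\<close>

lemma overlapping_balls_agree:
  assumes f: "f holomorphic_on ball (of_real a) r" "g holomorphic_on ball (of_real c) s"
    and r: "0 < r" "0 < s" and a: "0 \<le> a" "a < c"
    and fp: "\<And>x. 0 \<le> x \<Longrightarrow> \<bar>x - a\<bar> < r \<Longrightarrow> f (of_real x) = complex_of_real (p x)"
    and gp: "\<And>x. 0 \<le> x \<Longrightarrow> \<bar>x - c\<bar> < s \<Longrightarrow> g (of_real x) = complex_of_real (p x)"
    and z: "z \<in> ball (of_real a) r" "z \<in> ball (of_real c) s"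
  shows "f z = g z"
proof -
  let ?S = "ball (complex_of_real a) r \<inter> ball (complex_of_real c) s"
  define lo where "lo = max a (c - s)"
  define hi where "hi = min c (a + r)"
  have "c - a < r + s"
  proof -
    have "dist (complex_of_real a) (of_real c) < r + s"
      using z dist_triangle[of "complex_of_real a" "of_real c" z] by (simp add: dist_commute)
    then show ?thesis using a by (simp add: dist_norm norm_minus_commute flip: of_real_diff)
  qed
  then have lohi: "lo < hi" using r a by (auto simp: lo_def hi_def)
  let ?U = "complex_of_real ` {lo<..<hi}"
  have US: "?U \<subseteq> ?S"
    by (auto simp: lo_def hi_def dist_norm simp flip: of_real_diff)
  define \<xi> where "\<xi> = (lo + hi) / 2"
  have \<xi>: "lo < \<xi>" "\<xi> < hi" using lohi by (simp_all add: \<xi>_def)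
  have lim: "complex_of_real \<xi> islimpt ?U"
    unfolding islimpt_approachable
  proof (intro allI impI)
    fix e :: real assume e: "0 < e"
    obtain x where x: "\<xi> < x" "x < min hi (\<xi> + e)" using dense[of \<xi> "min hi (\<xi> + e)"] e \<xi> by auto
    have "dist (complex_of_real x) (of_real \<xi>) < e"
      using x by (simp add: dist_norm flip: of_real_diff)
    moreover have "complex_of_real x \<in> ?U" using x \<xi> by (intro imageI) simp
    ultimately show "\<exists>x'\<in>?U. x' \<noteq> complex_of_real \<xi> \<and> dist x' (complex_of_real \<xi>) < e"
      using x(1) by (intro bexI[of _ "complex_of_real x"]) simp_all
  qed
  have hol: "(\<lambda>z. f z - g z) holomorphic_on ?S"
    by (intro holomorphic_on_diff holomorphic_on_subset[OF f(1)] holomorphic_on_subset[OF f(2)]) simp_all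
  have conn: "connected ?S" by (intro convex_connected convex_Int convex_ball)
  have zero: "f w - g w = 0" if "w \<in> ?U" for w
  proof -
    from that obtain x where x: "w = of_real x" "lo < x" "x < hi" by auto
    then have "0 \<le> x" "\<bar>x - a\<bar> < r" "\<bar>x - c\<bar> < s" using a by (simp_all add: lo_def hi_def)
    then show ?thesis by (simp add: x(1) fp gp)
  qed
  have "complex_of_real \<xi> \<in> ?S" using US \<xi> by (intro subsetD[OF US] imageI) simp
  then have "f z - g z = 0"
    by (rule analytic_continuation[OF hol open_Int[OF open_ball open_ball] conn US _ lim zero IntI[OF z]])
  then show ?thesis by simp
qed

section \<open>The gas of the theorem and its connective constant\<close>

locale gas =
  fixes \<phi> :: "'a::euclidean_space \<Rightarrow> 'a \<Rightarrow> ereal"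
  assumes potential: "potential \<phi>"
    and translation_inv: "translation_invariant \<phi>"
    and tempered: "tempered \<phi>"
    and repulsive: "repulsive \<phi>"
begin

lemma \<phi>_nonneg: "0 \<le> \<phi> x y"
  using repulsive by (simp add: repulsive_def)

definition b :: "'a \<Rightarrow> 'a \<Rightarrow> real" where
  "b x y = exp_neg (\<phi> x y)"

sublocale boltzmann_factor b
proof
  have [measurable]: "(\<lambda>(x, y). \<phi> x y) \<in> borel_measurable (borel \<Otimes>\<^sub>M borel)"
    using potential by (simp add: potential_def borel_prod)
  show "(\<lambda>p. b (fst p) (snd p)) \<in> borel_measurable (borel \<Otimes>\<^sub>M borel)"
    unfolding b_def by measurable
  show "b x y = b y x" for x y
    using potential by (simp add: b_def potential_def)
  show "0 \<le> b x y" "b x y \<le> 1" for x y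
    by (simp_all add: b_def exp_neg_le_1 \<phi>_nonneg)
qed

lemma b_translate: "b (x + a) (y + a) = b x y"
  using translation_inv by (simp add: b_def translation_invariant_def)

definition C :: real where "C = enn2real (temperedness_const \<phi>)"

lemma C_nonneg: "0 \<le> C"
  by (simp add: C_def)

lemma nn_integral_b_le: "(\<integral>\<^sup>+x. ennreal (1 - b x v) \<partial>lborel) \<le> ennreal C"
proof -
  have "(\<integral>\<^sup>+x. ennreal (1 - b x v) \<partial>lborel) = (\<integral>\<^sup>+x. ennreal \<bar>1 - exp_neg (\<phi> x v)\<bar> \<partial>lborel)"
    by (simp add: b_def exp_neg_le_1 \<phi>_nonneg)
  also have "\<dots> \<le> temperedness_const \<phi>"
    unfolding temperedness_const_def by (rule SUP_upper) simp
  also have "\<dots> = ennreal C"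
    using tempered by (simp add: C_def tempered_def)
  finally show ?thesis .
qed

lemma exp_neg_energy: "exp_neg (energy \<phi> k x) = bprod k x"
  unfolding energy_def bprod_def b_def
  by (simp add: exp_neg_sum sum_nonneg \<phi>_nonneg)

lemma partition_function_eq:
  assumes [measurable]: "S \<in> sets borel" and "bounded S"
  shows "partition_function \<phi> S t = ZR t (indicator S)"
proof -
  have W: "set_lebesgue_integral (Pi\<^sub>M {1..k} (\<lambda>_. lborel)) (Pi\<^sub>E {1..k} (\<lambda>_. S))
      (\<lambda>x. exp_neg (energy \<phi> k x)) = W k (indicator S)" for k
    unfolding set_lebesgue_integral_def W_def exp_neg_energy
  proof (rule Bochner_Integration.integral_cong[OF refl])
    fix x assume "x \<in> space (Pi\<^sub>M {1..k} (\<lambda>_. lborel :: 'a measure))"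
    then have "indicat_real (Pi\<^sub>E {1..k} (\<lambda>_. S)) x = (\<Prod>i\<in>{1..k}. indicator S (x i))"
      by (auto simp: space_PiM indicator_def PiE_iff prod_zero_iff intro!: prod.neutral[symmetric] prod_zero[symmetric])
    then show "indicat_real (Pi\<^sub>E {1..k} (\<lambda>_. S)) x *\<^sub>R bprod k x = (\<Prod>i\<in>{1..k}. indicator S (x i)) * bprod k x"
      by simp
  qed
  have s: "summable (\<lambda>k. W k (indicator S) / fact k * t ^ k)"
    by (rule ZR_summable[OF act_indicator[OF assms]])
  have "ZR t (indicator S) = (\<Sum>k. W (Suc k) (indicator S) / fact (Suc k) * t ^ Suc k) + 1"
    unfolding ZR_def using suminf_split_head[OF s] by simp
  then show ?thesis
    unfolding partition_function_def W by (simp add: mult_ac)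
qed

lemma centred_cube_eq: "(centred_cube n :: 'a set) = cube (root DIM('a) (real n))"
  by (simp add: centred_cube_def cube_def Let_def)

lemma finite_volume_pressure_eq:
  "finite_volume_pressure \<phi> t n = ln (ZR t (indicator (cube (root DIM('a) (real n)) :: 'a set))) / real n"
  unfolding finite_volume_pressure_def centred_cube_eq
  by (simp add: partition_function_eq cube_bounded)

lemma finite_volume_pressure_convergent: "0 \<le> t \<Longrightarrow> convergent (finite_volume_pressure \<phi> t)"
  using pressure_convergent[OF b_translate, of t] by (simp add: finite_volume_pressure_eq[abs_def])

text \<open>The indicator in V_k is the exposure rule: v_j feels v_i exactly if it lies nearer to
  v_i than the point v_(i+1) chosen at that step.\<close>

lemma walk_weight_eq: "ennreal (walk_weight \<phi> k x) = walk_integrand 0 k x (\<lambda>_. 1)"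
proof -
  have 1: "exp_neg (\<Sum>i<j - 1. if dist (x j) (x i) < dist (x i) (x (i + 1)) then \<phi> (x j) (x i) else 0) =
      (\<Prod>i\<in>{0..<j - 1}. exposure (x i) (x (Suc i)) (x j))" for j
    by (subst exp_neg_sum)
       (auto simp: exposure_def b_def dist_commute \<phi>_nonneg lessThan_atLeast0 intro!: prod.cong)
  have "walk_weight \<phi> k x = (\<Prod>j\<in>{Suc 0..0 + k}. 1 *
      (\<Prod>i\<in>{0..<j - 1}. exposure (x i) (x (Suc i)) (x j)) * (1 - b (x j) (x (j - 1))))"
    unfolding walk_weight_def 1 by (simp add: b_def)
  then show ?thesis
    unfolding walk_integrand_def
    by (simp only: prod_ennreal[symmetric]) (subst prod_ennreal, auto intro!: mult_nonneg_nonneg prod_nonneg)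
qed

lemma walk_volume_eq: "walk_volume \<phi> k = (SUP v. walk k v (\<lambda>_. 1))"
  unfolding walk_volume_def walk_weight_eq
  by (intro SUP_cong refl) (simp add: walk_eq_nn_integral[where n=0])

lemma walk_le_volume:
  assumes "profile UNIV m"
  shows "walk k v m \<le> walk_volume \<phi> k"
proof -
  have "walk k v m \<le> walk k v (\<lambda>_. 1)"
    by (rule walk_mono[OF profile_nonneg[OF assms] profile_le_1[OF assms]])
  also have "\<dots> \<le> walk_volume \<phi> k" unfolding walk_volume_eq by (rule SUP_upper) simp
  finally show ?thesis .
qed

lemma profile_one: "profile UNIV (\<lambda>_. 1)"
  by (simp add: profile_def)

lemma walk_volume_submult: "walk_volume \<phi> (j + k) \<le> walk_volume \<phi> j * walk_volume \<phi> k"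
proof (subst walk_volume_eq, rule SUP_least)
  fix v :: 'a
  have "walk (j + k) v (\<lambda>_. 1) \<le> walk j v (\<lambda>_. 1) * walk_volume \<phi> k"
    by (rule walk_add_le[OF walk_le_volume profile_one])
  also have "\<dots> \<le> walk_volume \<phi> j * walk_volume \<phi> k"
    by (rule mult_right_mono[OF walk_le_volume[OF profile_one]]) simp
  finally show "walk (j + k) v (\<lambda>_. 1) \<le> walk_volume \<phi> j * walk_volume \<phi> k" .
qed

lemma walk_volume_le: "walk_volume \<phi> k \<le> ennreal C ^ k"
proof (induction k)
  case 0
  then show ?case by (simp add: walk_volume_eq)
next
  case (Suc k)
  have "walk_volume \<phi> 1 \<le> ennreal C"
    unfolding walk_volume_eq
    by (rule SUP_least) (use nn_integral_b_le in \<open>simp add: nbr_def\<close>)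
  then have "walk_volume \<phi> 1 * walk_volume \<phi> k \<le> ennreal C * ennreal C ^ k"
    using Suc by (intro mult_mono) simp_all
  then show ?case using walk_volume_submult[of 1 k] by simp
qed

lemma walk_volume_finite: "walk_volume \<phi> k < \<infinity>"
  using le_less_trans[OF walk_volume_le[of k]] by (simp add: ennreal_power C_nonneg)

lemma root_walk_volume_tendsto:
  "(\<lambda>k. root k (enn2real (walk_volume \<phi> k))) \<longlonglongrightarrow> connective_constant \<phi>"
proof -
  have "convergent (\<lambda>k. root k (enn2real (walk_volume \<phi> k)))"
  proof (rule submultiplicative_root_convergent)
    fix j k
    have "enn2real (walk_volume \<phi> (j + k)) \<le> enn2real (walk_volume \<phi> j * walk_volume \<phi> k)"
      using walk_volume_submult[of j k] walk_volume_finite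
      by (intro enn2real_mono) (simp_all add: ennreal_mult_less_top)
    then show "enn2real (walk_volume \<phi> (j + k)) \<le> enn2real (walk_volume \<phi> j) * enn2real (walk_volume \<phi> k)"
      by (simp add: enn2real_mult)
  qed simp
  then show ?thesis unfolding connective_constant_def by (rule convergent_LIMSEQ_iff[THEN iffD1])
qed

lemma connective_constant_nonneg: "0 \<le> connective_constant \<phi>"
  by (rule LIMSEQ_le_const[OF root_walk_volume_tendsto]) (auto intro!: exI[of _ 0] real_root_ge_zero)

text \<open>The product form covers a vanishing connective constant, where the interval is the whole
  half-line.\<close>

lemma activity_intervalD:
  assumes "t \<in> activity_interval \<phi>"
  shows "0 \<le> t" "t * exp (- 1) * connective_constant \<phi> < 1"
proof -
  let ?D = "connective_constant \<phi>"
  show "0 \<le> t" using assms by (simp add: activity_interval_def)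
  show "t * exp (- 1) * ?D < 1"
  proof (cases "?D = 0")
    case False
    then have D: "0 < ?D" using connective_constant_nonneg by simp
    have "t < exp 1 / ?D" using assms False by (simp add: activity_interval_def)
    then have "t * ?D < exp 1" using D by (simp add: pos_less_divide_eq)
    then have "t * ?D * exp (- 1) < exp 1 * exp (- 1)" by (intro mult_strict_right_mono) simp_all
    then show ?thesis by (simp add: exp_add[symmetric] mult_ac)
  qed simp
qed

text \<open>A \<kappa> strictly above t/e leaves room for complex perturbations of the activity. As
  \<kappa> times the limit of V_k^(1/k) is below 1, the k-th powers of \<kappa> V_k^(1/k) decay
  geometrically.\<close>

lemma exists_contracting_length:
  assumes "t \<in> activity_interval \<phi>"
  shows "\<exists>\<kappa> k. t * exp (- 1) < \<kappa> \<and> \<kappa> ^ k * enn2real (walk_volume \<phi> k) \<le> 1 / 2"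
proof -
  let ?D = "connective_constant \<phi>" and ?v = "\<lambda>k. enn2real (walk_volume \<phi> k)"
  note t = activity_intervalD[OF assms]
  have "\<exists>\<kappa>>t * exp (- 1). \<kappa> * ?D < 1"
  proof (cases "?D = 0")
    case True
    then show ?thesis by (intro exI[of _ "t * exp (- 1) + 1"]) simp
  next
    case False
    then have D: "0 < ?D" using connective_constant_nonneg by simp
    then have "t * exp (- 1) < 1 / ?D" using t(2) by (simp add: pos_less_divide_eq)
    then obtain \<kappa> where "t * exp (- 1) < \<kappa>" "\<kappa> < 1 / ?D" using dense by blast
    then show ?thesis using D by (intro exI[of _ \<kappa>]) (simp add: pos_less_divide_eq)
  qed
  then obtain \<kappa> where \<kappa>: "t * exp (- 1) < \<kappa>" "\<kappa> * ?D < 1" by blast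
  have \<kappa>0: "0 \<le> \<kappa>" using \<kappa>(1) t(1) by (meson exp_ge_zero less_imp_le mult_nonneg_nonneg order_trans)
  obtain r where r: "max 0 (\<kappa> * ?D) < r" "r < 1" using dense[of "max 0 (\<kappa> * ?D)" 1] \<kappa>(2) by auto
  have "(\<lambda>k. \<kappa> * root k (?v k)) \<longlonglongrightarrow> \<kappa> * ?D"
    by (intro tendsto_mult_left root_walk_volume_tendsto)
  then have "\<forall>\<^sub>F k in sequentially. \<kappa> * root k (?v k) < r"
    by (rule order_tendstoD(2)) (use r in simp)
  moreover have "\<forall>\<^sub>F k in sequentially. r ^ k < 1 / 2"
    by (rule order_tendstoD(2)[OF LIMSEQ_power_zero]) (use r in simp_all)
  moreover have "\<forall>\<^sub>F k::nat in sequentially. 1 \<le> k" by (rule eventually_ge_at_top)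
  ultimately have "\<forall>\<^sub>F k in sequentially. \<kappa> * root k (?v k) < r \<and> r ^ k < 1 / 2 \<and> 1 \<le> k"
    by eventually_elim simp
  from eventually_happens'[OF sequentially_bot this]
  obtain k where k: "\<kappa> * root k (?v k) < r" "r ^ k < 1 / 2" "1 \<le> k" by blast
  have "\<kappa> ^ k * ?v k = (\<kappa> * root k (?v k)) ^ k"
    using k(3) by (simp add: power_mult_distrib)
  also have "\<dots> \<le> r ^ k" using k(1) \<kappa>0 by (intro power_mono) (simp_all add: real_root_ge_zero)
  finally show ?thesis using k(2) \<kappa>(1) by (intro exI[of _ \<kappa>] exI[of _ k]) simp
qed

text \<open>The bound on |Z| controls the real part of log Z / n only from above, so compactness is
  applied to the roots of \<open>Z\<close>, which are bounded by exp |z|. Their moduli do not see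
  the choice of logarithm, and at real activities they determine |G| whatever the
  subsequence.\<close>

lemma pressure_locally_holomorphic:
  assumes "t \<in> activity_interval \<phi>"
  shows "\<exists>\<epsilon> f. 0 < \<epsilon> \<and> f holomorphic_on ball (of_real t) \<epsilon> \<and>
    (\<forall>x. 0 \<le> x \<longrightarrow> \<bar>x - t\<bar> < \<epsilon> \<longrightarrow> f (of_real x) = complex_of_real (pressure \<phi> x))"
proof -
  let ?I = "\<lambda>n. indicator (cube (root DIM('a) (real n)) :: 'a set) :: 'a \<Rightarrow> real"
  note t = activity_intervalD(1)[OF assms]
  obtain \<kappa> k where \<kappa>: "t * exp (- 1) < \<kappa>" "\<kappa> ^ k * enn2real (walk_volume \<phi> k) \<le> 1 / 2"
    using exists_contracting_length[OF assms] by blast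
  have "walk k v m \<le> ennreal (enn2real (walk_volume \<phi> k))" if "profile UNIV m" for v m
    using walk_le_volume[OF that] walk_volume_finite[of k] by simp
  then obtain \<epsilon> where \<epsilon>: "0 < \<epsilon>" and nz': "\<And>B m z. B \<in> sets borel \<Longrightarrow> bounded B \<Longrightarrow> profile B m \<Longrightarrow>
      cmod (z - of_real t) \<le> \<epsilon> \<Longrightarrow> Z z m \<noteq> 0"
    using exists_zero_free_radius[OF nn_integral_b_le C_nonneg t \<kappa>(1) _ _ \<kappa>(2)] by auto
  let ?S = "ball (complex_of_real t) \<epsilon>"
  have aI: "act (?I n)" for n by (rule act_indicator[OF cube_borel cube_bounded])
  have nz: "Z z (?I n) \<noteq> 0" if "z \<in> ?S" for z n
    by (rule nz'[OF cube_borel cube_bounded])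
       (use that in \<open>auto simp: profile_def dist_norm norm_minus_commute\<close>)
  have massI: "mass (?I n) \<le> real n" for n
    using profile_bounded_act(2)[OF cube_borel cube_bounded, of "root DIM('a) (real n)" "?I n"]
    by (simp add: profile_def measure_cube)
  have "\<exists>g. g holomorphic_on ?S \<and> (\<forall>z\<in>?S. Z z (?I n) = exp (g z))" for n
    using contractible_imp_holomorphic_log[OF Z_holomorphic[OF aI] convex_imp_contractible[OF convex_ball] nz]
    by metis
  then obtain g where g: "\<And>n. g n holomorphic_on ?S" "\<And>n z. z \<in> ?S \<Longrightarrow> Z z (?I n) = exp (g n z)"
    by metis
  \<comment> \<open>The index is shifted so that the volume is never 0.\<close>
  define F where "F = (\<lambda>n z. exp (g (Suc n) z / of_nat (Suc n)))"
  have Fhol: "F n holomorphic_on ?S" for n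
    unfolding F_def by (intro holomorphic_intros g(1)) simp
  have normF: "cmod (F n z) = exp (ln (cmod (Z z (?I (Suc n)))) / real (Suc n))" if "z \<in> ?S" for n z
  proof -
    have "ln (cmod (Z z (?I (Suc n)))) = Re (g (Suc n) z)"
      unfolding g(2)[OF that] by (simp add: norm_exp_eq_Re)
    then show ?thesis
      unfolding F_def norm_exp_eq_Re by (simp add: Re_divide_of_nat del: of_nat_Suc)
  qed
  have bound: "cmod (F n z) \<le> exp (t + \<epsilon>)" if z: "z \<in> ?S" for n z
  proof -
    have "cmod z \<le> t + \<epsilon>"
      using z norm_triangle_sub[of z "of_real t"] t by (simp add: dist_norm norm_minus_commute)
    have "cmod (Z z (?I (Suc n))) \<le> exp (cmod z * real (Suc n))" by (rule norm_Z_le[OF aI massI])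
    then have "ln (cmod (Z z (?I (Suc n)))) \<le> ln (exp (cmod z * real (Suc n)))"
      using nz[OF z, of "Suc n"] by (subst ln_le_cancel_iff) simp_all
    then have "ln (cmod (Z z (?I (Suc n)))) \<le> cmod z * real (Suc n)" by (simp only: ln_exp)
    then have "ln (cmod (Z z (?I (Suc n)))) / real (Suc n) \<le> cmod z"
      by (simp add: pos_divide_le_eq del: of_nat_Suc)
    then show ?thesis unfolding normF[OF z] using \<open>cmod z \<le> t + \<epsilon>\<close> by simp
  qed
  obtain G r where G: "G holomorphic_on ?S" "strict_mono (r :: nat \<Rightarrow> nat)"
      "\<And>z. z \<in> ?S \<Longrightarrow> (\<lambda>n. F (r n) z) \<longlonglongrightarrow> G z"
  proof (rule Montel[OF open_ball, of "{h. h holomorphic_on ?S \<and> (\<forall>z\<in>?S. cmod (h z) \<le> exp (t + \<epsilon>))}" _ _ F])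
    show "\<And>K. compact K \<Longrightarrow> K \<subseteq> ?S \<Longrightarrow>
       \<exists>B. \<forall>h\<in>{h. h holomorphic_on ?S \<and> (\<forall>z\<in>?S. cmod (h z) \<le> exp (t + \<epsilon>))}. \<forall>z\<in>K. cmod (h z) \<le> B"
      by blast
  qed (use Fhol bound in auto)
  have normG: "cmod (G (of_real x)) = exp (pressure \<phi> x)" if x: "0 \<le> x" "\<bar>x - t\<bar> < \<epsilon>" for x
  proof -
    have xS: "complex_of_real x \<in> ?S"
      using x(2) by (simp add: dist_norm abs_minus_commute flip: of_real_diff)
    have "finite_volume_pressure \<phi> x \<longlonglongrightarrow> pressure \<phi> x"
      unfolding pressure_def using finite_volume_pressure_convergent[OF x(1)] by (simp add: convergent_LIMSEQ_iff)
    moreover have "filterlim (\<lambda>n. Suc (r n)) sequentially sequentially"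
      using filterlim_compose[OF filterlim_Suc filterlim_subseq[OF G(2)]] .
    ultimately have "(\<lambda>n. finite_volume_pressure \<phi> x (Suc (r n))) \<longlonglongrightarrow> pressure \<phi> x"
      by (rule filterlim_compose)
    then have "(\<lambda>n. exp (finite_volume_pressure \<phi> x (Suc (r n)))) \<longlonglongrightarrow> exp (pressure \<phi> x)"
      by (rule tendsto_exp)
    moreover have "cmod (F (r n) (of_real x)) = exp (finite_volume_pressure \<phi> x (Suc (r n)))" for n
      using ZR_ge_1[OF aI x(1), of "Suc (r n)"]
      unfolding normF[OF xS] finite_volume_pressure_eq Z_of_real[OF aI] by simp
    moreover have "(\<lambda>n. cmod (F (r n) (of_real x))) \<longlonglongrightarrow> cmod (G (of_real x))"
      by (rule tendsto_norm[OF G(3)[OF xS]])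
    ultimately show ?thesis using LIMSEQ_unique by simp
  qed
  \<comment> \<open>A limit of zero-free functions could vanish identically, but at t its modulus is
    exp of the pressure; the disc is shrunk to stay away from zeros.\<close>
  have "G (of_real t) \<noteq> 0" using normG[of t] t \<epsilon> by auto
  moreover have "continuous_on ?S G" by (rule holomorphic_on_imp_continuous_on[OF G(1)])
  ultimately obtain d where d: "0 < d" "\<And>z. dist (of_real t) z < d \<Longrightarrow> G z \<noteq> 0"
    using continuous_on_open_avoid[OF _ open_ball, of "of_real t" \<epsilon> G "of_real t" 0] \<epsilon> by auto
  define e where "e = min \<epsilon> d"
  have e: "0 < e" "e \<le> \<epsilon>" "e \<le> d" using \<epsilon> d by (simp_all add: e_def)
  let ?T = "ball (complex_of_real t) e"
  have holG: "G holomorphic_on ?T" by (rule holomorphic_on_subset[OF G(1)]) (use e in auto)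
  have nzG: "G z \<noteq> 0" if "z \<in> ?T" for z by (rule d(2)) (use that e in simp)
  obtain l where l: "l holomorphic_on ?T" "\<And>z. z \<in> ?T \<Longrightarrow> G z = exp (l z)"
    using contractible_imp_holomorphic_log[OF holG convex_imp_contractible[OF convex_ball] nzG] by metis
  \<comment> \<open>On the real axis only the real part of \<open>l\<close> is known. Averaging with
    the reflected function gives a holomorphic function equal to that real part there.\<close>
  define f where "f = (\<lambda>z. (l z + cnj (l (cnj z))) / 2)"
  have cl: "(\<lambda>z. cnj (l (cnj z))) holomorphic_on ?T"
  proof -
    have "cnj z \<in> ?T \<longleftrightarrow> z \<in> ?T" for z
      using complex_mod_cnj[of "of_real t - z"] by (simp add: dist_norm)
    then have "cnj ` ?T = ?T" by (metis complex_cnj_cnj image_eqI image_subsetI subsetI subset_antisym)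
    then have "cnj \<circ> l \<circ> cnj holomorphic_on ?T"
      using l(1) by (intro holomorphic_on_compose_cnj_cnj) simp_all
    then show ?thesis by (simp only: comp_def)
  qed
  have "f holomorphic_on ?T" unfolding f_def by (intro holomorphic_intros l(1) cl) simp
  moreover have "f (of_real x) = complex_of_real (pressure \<phi> x)" if x: "0 \<le> x" "\<bar>x - t\<bar> < e" for x
  proof -
    have xT: "complex_of_real x \<in> ?T"
      using x(2) by (simp add: dist_norm abs_minus_commute flip: of_real_diff)
    have "exp (Re (l (of_real x))) = exp (pressure \<phi> x)"
      using normG[OF x(1)] x(2) e unfolding l(2)[OF xT] by (simp add: norm_exp_eq_Re)
    then show ?thesis by (simp add: f_def complex_add_cnj)
  qed
  ultimately show ?thesis using e(1) by blast
qed

end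

theorem corollary5:
  fixes \<phi> :: "'a::euclidean_space \<Rightarrow> 'a \<Rightarrow> ereal"
  assumes "potential \<phi>"
    and "translation_invariant \<phi>"
    and "tempered \<phi>"
    and "repulsive \<phi>"
  shows "(\<forall>z\<in>activity_interval \<phi>. convergent (finite_volume_pressure \<phi> z)) \<and>
         (\<exists>U f. open U \<and> complex_of_real ` activity_interval \<phi> \<subseteq> U \<and> f holomorphic_on U \<and>
            (\<forall>z\<in>activity_interval \<phi>. f (complex_of_real z) = complex_of_real (pressure \<phi> z)))"
proof -
  interpret gas \<phi> by standard (rule assms)+
  let ?A = "activity_interval \<phi>"
  have nn: "0 \<le> t" if "t \<in> ?A" for t by (rule activity_intervalD(1)[OF that])
  obtain \<epsilon> f where \<epsilon>: "\<And>t. t \<in> ?A \<Longrightarrow> 0 < \<epsilon> t"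
    and f: "\<And>t. t \<in> ?A \<Longrightarrow> f t holomorphic_on ball (of_real t) (\<epsilon> t)"
    and fp: "\<And>t x. t \<in> ?A \<Longrightarrow> 0 \<le> x \<Longrightarrow> \<bar>x - t\<bar> < \<epsilon> t \<Longrightarrow> f t (of_real x) = complex_of_real (pressure \<phi> x)"
    using pressure_locally_holomorphic by metis
  let ?U = "\<Union>t\<in>?A. ball (complex_of_real t) (\<epsilon> t)"
  \<comment> \<open>Any disc containing z may be chosen; \<open>overlapping_balls_agree\<close>
    makes the value independent of the choice.\<close>
  define F where "F = (\<lambda>z. f (SOME t. t \<in> ?A \<and> z \<in> ball (of_real t) (\<epsilon> t)) z)"
  have F: "F z = f t z" if t: "t \<in> ?A" "z \<in> ball (of_real t) (\<epsilon> t)" for t z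
  proof -
    define s where "s = (SOME t. t \<in> ?A \<and> z \<in> ball (complex_of_real t) (\<epsilon> t))"
    have s: "s \<in> ?A" "z \<in> ball (complex_of_real s) (\<epsilon> s)"
      using someI[of "\<lambda>t. t \<in> ?A \<and> z \<in> ball (complex_of_real t) (\<epsilon> t)" t] t by (auto simp: s_def)
    have "f s z = f t z"
    proof (cases s t rule: linorder_cases)
      case less
      show ?thesis
        by (rule overlapping_balls_agree[OF f[OF s(1)] f[OF t(1)] \<epsilon>[OF s(1)] \<epsilon>[OF t(1)] nn[OF s(1)] less
              fp[OF s(1)] fp[OF t(1)] s(2) t(2)])
    next
      case greater
      show ?thesis
        by (rule overlapping_balls_agree[OF f[OF t(1)] f[OF s(1)] \<epsilon>[OF t(1)] \<epsilon>[OF s(1)] nn[OF t(1)] greater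
              fp[OF t(1)] fp[OF s(1)] t(2) s(2), symmetric])
    qed simp
    then show ?thesis by (simp add: F_def s_def)
  qed
  have "F holomorphic_on ?U"
  proof (rule holomorphic_on_UN_open)
    show "F holomorphic_on ball (of_real t) (\<epsilon> t)" if "t \<in> ?A" for t
      by (rule holomorphic_transform[OF f[OF that]]) (simp add: F[OF that])
  qed simp
  moreover have "open ?U" by (intro open_UN ballI open_ball)
  moreover have "complex_of_real ` ?A \<subseteq> ?U" using \<epsilon> by fastforce
  moreover have "F (complex_of_real t) = complex_of_real (pressure \<phi> t)" if "t \<in> ?A" for t
    using F[OF that, of "of_real t"] fp[OF that nn[OF that]] \<epsilon>[OF that] by simp
  moreover have "convergent (finite_volume_pressure \<phi> t)" if "t \<in> ?A" for t
    by (rule finite_volume_pressure_convergent[OF nn[OF that]])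
  ultimately show ?thesis by blast
qed

end
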